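(* Let $(\mathfrak g,\langle\cdot,\cdot\rangle_{\mathfrak g})$ be an abelian metric Lie algebra of signature $(p,q)$, let $0\neq A\in\mathfrak{so}(\mathfrak g,\langle\cdot,\cdot\rangle_{\mathfrak g})\cong\mathfrak{so}(p,q)$, let $\underline A(p,q)=\mathbb R\alpha\oplus\mathfrak g\oplus\mathbb RH$ be the double extension of $\mathfrak g$ by $\mathbb R$ defined by $A$, and let $A(p,q)$ be the simply connected Lie group with Lie algebra $\underline A(p,q)$, with its biinvariant metric. Then: (a) $A(p,q)$ is indecomposable if and only if $\ker A$ is totally isotropic. (b) $A(p,q)$ is solvable, has vanishing scalar curvature, and its Ricci tensor is 2-step nilpotent. Moreover, $A(p,q)$ is Ricci-flat if and only if $\mathrm{tr}_{\mathfrak g}(A^2)=0$, and $A(p,q)$ is flat if and only if $A^2=0$. (c) The holonomy algebra of $A(p,q)$ is abelian and, with respect to the decomposition $\mathbb R\alpha\oplus\mathfrak g\oplus\mathbb RH$, $$\mathfrak{hol}(A(p,q))=\left\{\begin{pmatrix}0&(A^2X)^*&0\\0&0&-A^2X\\0&0&0\end{pmatrix}\ \Big|\ X\in\mathfrak g\right\}\subset\mathfrak{so}(p+1,q+1),$$ where $(A^2X)^*=\langle A^2X,\cdot\rangle_{\mathfrak g}$. (d) If the space $A^2\mathfrak g$ is totally isotropic, then the space $\mathcal P_{A(p,q)}$ of parallel spinor fields on $A(p,q)$ has dimension $2^{[\frac{p+q}2]}(1+2^{-\rho})$, where $\rho=\dim A^2\mathfrak g$. If $A^2\mathfrak g$ is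 not totally isotropic, then $\dim\mathcal P_{A(p,q)}=2^{[\frac{p+q}2]}$.
   Context: A metric Lie algebra is a finite-dimensional real Lie algebra with an $\mathrm{ad}$-invariant non-degenerate symmetric bilinear form; it is indecomposable if it is not the orthogonal direct sum of two non-trivial metric Lie algebras. A Lie group with the corresponding biinvariant pseudo-Riemannian metric is called indecomposable if its metric Lie algebra is. The double extension $\underline A(p,q)=\mathbb R\alpha\oplus\mathfrak g\oplus\mathbb RH$ has brackets $[\alpha,\cdot]=0$, $[X,Y]=\langle AX,Y\rangle_{\mathfrak g}\,\alpha$, $[H,X]=AX$ for $X,Y\in\mathfrak g$, and scalar product extending $\langle\cdot,\cdot\rangle_{\mathfrak g}$ with $\langle\alpha,H\rangle=1$, $\langle\alpha,\alpha\rangle=\langle H,H\rangle=0$, $\mathfrak g\perp\{\alpha,H\}$; its signature is $(p+1,q+1)$. The Ricci tensor being 2-step nilpotent means that, viewed as an endomorphism, it satisfies $\mathrm{Ric}\circ\mathrm{Ric}=0$. $\mathfrak{hol}$ denotes the Lie algebra of the holonomy group of the Levi-Civita connection, acting on the Lie algebra identified with the tangent space at the identity. $\mathcal P$ denotes the complex vector space of sections of the complex spinor bundle (fibre of dimension $2^{[(p+q+2)/2]}$) parallel for the Levi-Civita connection; dimensions are complex. *)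

theory Defs
  imports "HOL-Analysis.Analysis" "HOL-Algebra.Solvable_Groups"
    "HOL-Library.Function_Algebras"
begin

section \<open>Metric Lie algebras\<close>

text \<open>
  A Lie algebra is given by its bracket, a bilinear map on a finite-dimensional real vector space.
  The ambient space is a type of class \<open>euclidean_space\<close>; its built-in inner product is
  used only for the topology and plays no role in the geometry.
  The predicate is relative to a subspace \<open>U\<close>, so that it also applies to summands.
\<close>

definition metric_lie_algebra_on ::
  "'l::euclidean_space set \<Rightarrow> ('l \<Rightarrow> 'l \<Rightarrow> 'l) \<Rightarrow> ('l \<Rightarrow> 'l \<Rightarrow> real) \<Rightarrow> bool" where
  "metric_lie_algebra_on U br B \<longleftrightarrow>
     subspace U \<and> bilinear br \<and> bilinear B \<and>
     (\<forall>x\<in>U. \<forall>y\<in>U. br x y \<in> U) \<and>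
     (\<forall>x\<in>U. br x x = 0) \<and>
     (\<forall>x\<in>U. \<forall>y\<in>U. \<forall>z\<in>U. br x (br y z) + br y (br z x) + br z (br x y) = 0) \<and>
     (\<forall>x\<in>U. \<forall>y\<in>U. B x y = B y x) \<and>
     (\<forall>x\<in>U. \<forall>y\<in>U. \<forall>z\<in>U. B (br x y) z + B y (br x z) = 0) \<and>
     (\<forall>x\<in>U. (\<forall>y\<in>U. B x y = 0) \<longrightarrow> x = 0)"

text \<open>
  Indecomposability of a Lie group with biinvariant metric is that of its metric Lie algebra.
\<close>

definition indecomposable ::
  "('l::euclidean_space \<Rightarrow> 'l \<Rightarrow> 'l) \<Rightarrow> ('l \<Rightarrow> 'l \<Rightarrow> real) \<Rightarrow> bool" where
  "indecomposable br B \<longleftrightarrow>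
     (\<nexists>U V. metric_lie_algebra_on U br B \<and> metric_lie_algebra_on V br B \<and>
        U \<noteq> {0} \<and> V \<noteq> {0} \<and>
        U \<inter> V = {0} \<and> {u + v | u v. u \<in> U \<and> v \<in> V} = UNIV \<and>
        (\<forall>u\<in>U. \<forall>v\<in>V. br u v = 0 \<and> B u v = 0))"

definition pseudo_onb :: "('l::euclidean_space \<Rightarrow> 'l \<Rightarrow> real) \<Rightarrow> 'l set \<Rightarrow> bool" where
  "pseudo_onb B E \<longleftrightarrow> independent E \<and> span E = UNIV \<and>
     (\<forall>e\<in>E. B e e = 1 \<or> B e e = -1) \<and> (\<forall>e\<in>E. \<forall>f\<in>E. e \<noteq> f \<longrightarrow> B e f = 0)"

text \<open>Signature \<open>(p, q)\<close>: \<open>p\<close> negative and \<open>q\<close> positive directions.\<close>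

definition has_signature :: "('l::euclidean_space \<Rightarrow> 'l \<Rightarrow> real) \<Rightarrow> nat \<Rightarrow> nat \<Rightarrow> bool" where
  "has_signature B p q \<longleftrightarrow>
     (\<exists>E. pseudo_onb B E \<and> card {e\<in>E. B e e = -1} = p \<and> card {e\<in>E. B e e = 1} = q)"

definition so_algebra :: "('l::euclidean_space \<Rightarrow> 'l \<Rightarrow> real) \<Rightarrow> ('l \<Rightarrow> 'l) set" where
  "so_algebra B = {T. linear T \<and> (\<forall>x y. B (T x) y + B x (T y) = 0)}"

definition totally_isotropic :: "('l \<Rightarrow> 'l \<Rightarrow> real) \<Rightarrow> 'l set \<Rightarrow> bool" where
  "totally_isotropic B S \<longleftrightarrow> (\<forall>x\<in>S. \<forall>y\<in>S. B x y = 0)"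

text \<open>The trace of an endomorphism; it does not depend on the basis used.\<close>

definition lin_trace :: "('l::euclidean_space \<Rightarrow> 'l) \<Rightarrow> real" where
  "lin_trace T = (\<Sum>b\<in>Basis. T b \<bullet> b)"


section \<open>Double extensions\<close>

text \<open>
  A triple \<open>(a, X, h)\<close> stands for \<open>a \<alpha> + X + h H\<close>.
\<close>

definition dext_bracket :: "('v::euclidean_space \<Rightarrow> 'v) \<Rightarrow> ('v \<Rightarrow> 'v \<Rightarrow> real) \<Rightarrow>
    real \<times> 'v \<times> real \<Rightarrow> real \<times> 'v \<times> real \<Rightarrow> real \<times> 'v \<times> real" where
  "dext_bracket A B = (\<lambda>(a, X, h) (b, Y, k). (B (A X) Y, h *\<^sub>R A Y - k *\<^sub>R A X, 0))"

definition dext_form :: "('v::euclidean_space \<Rightarrow> 'v \<Rightarrow> real) \<Rightarrow>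
    real \<times> 'v \<times> real \<Rightarrow> real \<times> 'v \<times> real \<Rightarrow> real" where
  "dext_form B = (\<lambda>(a, X, h) (b, Y, k). a * k + h * b + B X Y)"


section \<open>Smooth manifolds and Lie groups\<close>

fun Ck_on :: "nat \<Rightarrow> 'a::euclidean_space set \<Rightarrow> ('a \<Rightarrow> 'b::euclidean_space) \<Rightarrow> bool" where
  "Ck_on 0 S f \<longleftrightarrow> continuous_on S f"
| "Ck_on (Suc k) S f \<longleftrightarrow> (\<forall>x\<in>S. f differentiable (at x)) \<and>
     (\<forall>v. Ck_on k S (\<lambda>x. frechet_derivative f (at x) v))"

text \<open>To be used for open sets \<open>S\<close> only.\<close>

definition smooth_on :: "'a::euclidean_space set \<Rightarrow> ('a \<Rightarrow> 'b::euclidean_space) \<Rightarrow> bool" where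
  "smooth_on S f \<longleftrightarrow> (\<forall>k. Ck_on k S f)"

text \<open>A chart is a pair of a domain and a coordinate map; an atlas is a set of charts.\<close>

type_synonym ('m, 'e) atlas = "('m set \<times> ('m \<Rightarrow> 'e)) set"

definition smooth_atlas :: "('m::topological_space, 'e::euclidean_space) atlas \<Rightarrow> bool" where
  "smooth_atlas M \<longleftrightarrow>
     \<Union> (fst ` M) = UNIV \<and>
     (\<forall>(U, c)\<in>M. open U \<and> open (c ` U) \<and> homeomorphism U (c ` U) c (inv_into U c)) \<and>
     (\<forall>(U, c)\<in>M. \<forall>(V, d)\<in>M. smooth_on (c ` (U \<inter> V)) (d \<circ> inv_into U c))"

definition eucl_atlas :: "('e, 'e::euclidean_space) atlas" where
  "eucl_atlas = {(UNIV, id)}"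

definition prod_atlas :: "('m, 'e) atlas \<Rightarrow> ('n, 'f) atlas \<Rightarrow> ('m \<times> 'n, 'e \<times> 'f) atlas" where
  "prod_atlas M N = {(U \<times> V, map_prod c d) | U c V d. (U, c) \<in> M \<and> (V, d) \<in> N}"

text \<open>Smoothness on an open subset \<open>W\<close> of the source manifold.\<close>

definition smooth_map_on ::
  "('m::topological_space, 'e::euclidean_space) atlas \<Rightarrow> ('n::topological_space, 'f::euclidean_space) atlas
    \<Rightarrow> 'm set \<Rightarrow> ('m \<Rightarrow> 'n) \<Rightarrow> bool" where
  "smooth_map_on M N W f \<longleftrightarrow> continuous_on W f \<and>
     (\<forall>(U, c)\<in>M. \<forall>(V, d)\<in>N.
        smooth_on (c ` {x \<in> U \<inter> W. f x \<in> V}) (d \<circ> f \<circ> inv_into U c))"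

abbreviation smooth_fun_on ::
  "('m::topological_space, 'e::euclidean_space) atlas \<Rightarrow> 'm set \<Rightarrow> ('m \<Rightarrow> 'w::euclidean_space) \<Rightarrow> bool" where
  "smooth_fun_on M \<equiv> smooth_map_on M eucl_atlas"

definition lie_group ::
  "('g::{t2_space,second_countable_topology}, 'r) monoid_scheme
    \<Rightarrow> ('g, 'e::euclidean_space) atlas \<Rightarrow> bool" where
  "lie_group G M \<longleftrightarrow> group G \<and> carrier G = UNIV \<and> smooth_atlas M \<and>
     smooth_map_on (prod_atlas M M) M UNIV (\<lambda>(x, y). x \<otimes>\<^bsub>G\<^esub> y) \<and>
     smooth_map_on M M UNIV (\<lambda>x. inv\<^bsub>G\<^esub> x)"


section \<open>The Lie algebra of a Lie group\<close>

text \<open>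
  An identification of a vector space \<open>'l\<close> with the tangent space of \<open>G\<close> at the unit element is
  the same as the differential at \<open>0\<close> of a map \<open>\<eta>\<close> from a neighbourhood of \<open>0\<close> in \<open>'l\<close> to \<open>G\<close> with
  \<open>\<eta> 0 = \<one>\<close> and bijective differential at \<open>0\<close>. Only this differential matters below.
\<close>

definition tangent_identification ::
  "('g::topological_space, 'r) monoid_scheme \<Rightarrow> ('g, 'e::euclidean_space) atlas
    \<Rightarrow> ('l::euclidean_space \<Rightarrow> 'g) \<Rightarrow> bool" where
  "tangent_identification G M \<eta> \<longleftrightarrow> \<eta> 0 = \<one>\<^bsub>G\<^esub> \<and>
     (\<exists>N. open N \<and> 0 \<in> N \<and> smooth_map_on eucl_atlas M N \<eta>) \<and>
     (\<exists>(U, c)\<in>M. \<one>\<^bsub>G\<^esub> \<in> U \<and> bij (frechet_derivative (c \<circ> \<eta>) (at 0)))"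

text \<open>
  The derivative at \<open>g\<close> of a function \<open>f\<close>, defined near \<open>g\<close>, in the direction of the left invariant
  vector field with value \<open>X\<close> at the unit element.
\<close>

definition left_deriv ::
  "('g, 'r) monoid_scheme \<Rightarrow> ('l::euclidean_space \<Rightarrow> 'g) \<Rightarrow> 'l \<Rightarrow> ('g \<Rightarrow> 'w::euclidean_space) \<Rightarrow> 'g \<Rightarrow> 'w" where
  "left_deriv G \<eta> X f g = frechet_derivative (\<lambda>x. f (g \<otimes>\<^bsub>G\<^esub> \<eta> x)) (at 0) X"

text \<open>
  \<open>br\<close> is the bracket of the Lie algebra of \<open>G\<close>, i.e. the commutator of left invariant vector fields:
  the linear isomorphism given by \<open>\<eta>\<close> from \<open>('l, br)\<close> to the Lie algebra of \<open>G\<close> is an isomorphism of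
  Lie algebras.
\<close>

definition has_lie_algebra ::
  "('g::topological_space, 'r) monoid_scheme \<Rightarrow> ('g, 'e::euclidean_space) atlas
    \<Rightarrow> ('l::euclidean_space \<Rightarrow> 'g) \<Rightarrow> ('l \<Rightarrow> 'l \<Rightarrow> 'l) \<Rightarrow> bool" where
  "has_lie_algebra G M \<eta> br \<longleftrightarrow> tangent_identification G M \<eta> \<and>
     (\<forall>X Y W f. open W \<and> smooth_fun_on M W (f :: 'g \<Rightarrow> real) \<longrightarrow>
        (\<forall>g\<in>W. left_deriv G \<eta> (br X Y) f g =
           left_deriv G \<eta> X (left_deriv G \<eta> Y f) g - left_deriv G \<eta> Y (left_deriv G \<eta> X f) g))"


section \<open>Levi-Civita connection and curvature\<close>

text \<open>
  The tangent bundle is trivialised by left translations. A vector field is thus a map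
  \<open>V :: 'g \<Rightarrow> 'l\<close>, which acts on functions by \<open>(V f)(g) = left_deriv G \<eta> (V g) f g\<close>; constant maps are the
  left invariant vector fields. The left invariant metric extending the scalar product \<open>B\<close> on \<open>'l\<close> is
  \<open>B\<close> in every fibre. If \<open>B\<close> is ad-invariant and \<open>G\<close> is connected, this is the biinvariant
  metric determined by \<open>B\<close>.
\<close>

definition affine_connection ::
  "('g::topological_space, 'r) monoid_scheme \<Rightarrow> ('g, 'e::euclidean_space) atlas
    \<Rightarrow> ('l::euclidean_space \<Rightarrow> 'g) \<Rightarrow> (('g \<Rightarrow> 'l) \<Rightarrow> ('g \<Rightarrow> 'l) \<Rightarrow> 'g \<Rightarrow> 'l) \<Rightarrow> bool" where
  "affine_connection G M \<eta> nabla \<longleftrightarrow>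
     (\<forall>V W. smooth_fun_on M UNIV V \<and> smooth_fun_on M UNIV W \<longrightarrow>
        smooth_fun_on M UNIV (nabla V W) \<and>
        (\<forall>V'. smooth_fun_on M UNIV V' \<longrightarrow>
           nabla (\<lambda>g. V g + V' g) W = (\<lambda>g. nabla V W g + nabla V' W g)) \<and>
        (\<forall>W'. smooth_fun_on M UNIV W' \<longrightarrow>
           nabla V (\<lambda>g. W g + W' g) = (\<lambda>g. nabla V W g + nabla V W' g)) \<and>
        (\<forall>f. smooth_fun_on M UNIV (f :: 'g \<Rightarrow> real) \<longrightarrow>
           nabla (\<lambda>g. f g *\<^sub>R V g) W = (\<lambda>g. f g *\<^sub>R nabla V W g) \<and>
           nabla V (\<lambda>g. f g *\<^sub>R W g) =
             (\<lambda>g. left_deriv G \<eta> (V g) f g *\<^sub>R W g + f g *\<^sub>R nabla V W g)))"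

definition torsion_free ::
  "('g::topological_space, 'r) monoid_scheme \<Rightarrow> ('g, 'e::euclidean_space) atlas
    \<Rightarrow> ('l::euclidean_space \<Rightarrow> 'g) \<Rightarrow> (('g \<Rightarrow> 'l) \<Rightarrow> ('g \<Rightarrow> 'l) \<Rightarrow> 'g \<Rightarrow> 'l) \<Rightarrow> bool" where
  "torsion_free G M \<eta> nabla \<longleftrightarrow>
     (\<forall>V W U f. smooth_fun_on M UNIV V \<and> smooth_fun_on M UNIV W \<and>
        open U \<and> smooth_fun_on M U (f :: 'g \<Rightarrow> real) \<longrightarrow>
        (\<forall>g\<in>U. left_deriv G \<eta> (nabla V W g - nabla W V g) f g =
           left_deriv G \<eta> (V g) (\<lambda>h. left_deriv G \<eta> (W h) f h) g -
           left_deriv G \<eta> (W g) (\<lambda>h. left_deriv G \<eta> (V h) f h) g))"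

definition metric_connection ::
  "('g::topological_space, 'r) monoid_scheme \<Rightarrow> ('g, 'e::euclidean_space) atlas
    \<Rightarrow> ('l::euclidean_space \<Rightarrow> 'g) \<Rightarrow> ('l \<Rightarrow> 'l \<Rightarrow> real)
    \<Rightarrow> (('g \<Rightarrow> 'l) \<Rightarrow> ('g \<Rightarrow> 'l) \<Rightarrow> 'g \<Rightarrow> 'l) \<Rightarrow> bool" where
  "metric_connection G M \<eta> B nabla \<longleftrightarrow>
     (\<forall>V W Z. smooth_fun_on M UNIV V \<and> smooth_fun_on M UNIV W \<and> smooth_fun_on M UNIV Z \<longrightarrow>
        (\<forall>g. left_deriv G \<eta> (V g) (\<lambda>h. B (W h) (Z h)) g =
           B (nabla V W g) (Z g) + B (W g) (nabla V Z g)))"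

definition levi_civita ::
  "('g::topological_space, 'r) monoid_scheme \<Rightarrow> ('g, 'e::euclidean_space) atlas
    \<Rightarrow> ('l::euclidean_space \<Rightarrow> 'g) \<Rightarrow> ('l \<Rightarrow> 'l \<Rightarrow> real)
    \<Rightarrow> (('g \<Rightarrow> 'l) \<Rightarrow> ('g \<Rightarrow> 'l) \<Rightarrow> 'g \<Rightarrow> 'l) \<Rightarrow> bool" where
  "levi_civita G M \<eta> B nabla \<longleftrightarrow>
     affine_connection G M \<eta> nabla \<and> torsion_free G M \<eta> nabla \<and> metric_connection G M \<eta> B nabla"

text \<open>
  \<open>curvature\<close> is \<open>R(x, y) z\<close> at the point \<open>g\<close>, computed with the left invariant extensions of the
  tangent vectors \<open>x, y, z\<close>, whose commutator is given by \<open>br\<close>.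
\<close>

definition curvature ::
  "('l \<Rightarrow> 'l \<Rightarrow> 'l) \<Rightarrow> (('g \<Rightarrow> 'l) \<Rightarrow> ('g \<Rightarrow> 'l) \<Rightarrow> 'g \<Rightarrow> 'l::euclidean_space)
    \<Rightarrow> 'g \<Rightarrow> 'l \<Rightarrow> 'l \<Rightarrow> 'l \<Rightarrow> 'l" where
  "curvature br nabla g x y z =
     nabla (\<lambda>_. x) (nabla (\<lambda>_. y) (\<lambda>_. z)) g - nabla (\<lambda>_. y) (nabla (\<lambda>_. x) (\<lambda>_. z)) g
     - nabla (\<lambda>_. br x y) (\<lambda>_. z) g"

definition flat ::
  "('l \<Rightarrow> 'l \<Rightarrow> 'l) \<Rightarrow> (('g \<Rightarrow> 'l) \<Rightarrow> ('g \<Rightarrow> 'l) \<Rightarrow> 'g \<Rightarrow> 'l::euclidean_space) \<Rightarrow> bool" where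
  "flat br nabla \<longleftrightarrow> (\<forall>g x y z. curvature br nabla g x y z = 0)"

definition ricci ::
  "('l \<Rightarrow> 'l \<Rightarrow> 'l) \<Rightarrow> (('g \<Rightarrow> 'l) \<Rightarrow> ('g \<Rightarrow> 'l) \<Rightarrow> 'g \<Rightarrow> 'l::euclidean_space)
    \<Rightarrow> 'g \<Rightarrow> 'l \<Rightarrow> 'l \<Rightarrow> real" where
  "ricci br nabla g y z = lin_trace (\<lambda>x. curvature br nabla g x y z)"

definition ricci_flat ::
  "('l \<Rightarrow> 'l \<Rightarrow> 'l) \<Rightarrow> (('g \<Rightarrow> 'l) \<Rightarrow> ('g \<Rightarrow> 'l) \<Rightarrow> 'g \<Rightarrow> 'l::euclidean_space) \<Rightarrow> bool" where
  "ricci_flat br nabla \<longleftrightarrow> (\<forall>g y z. ricci br nabla g y z = 0)"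

text \<open>The Ricci tensor as an endomorphism, by means of the non-degenerate form \<open>B\<close>.\<close>

definition ricci_op ::
  "('l \<Rightarrow> 'l \<Rightarrow> 'l) \<Rightarrow> ('l \<Rightarrow> 'l \<Rightarrow> real) \<Rightarrow> (('g \<Rightarrow> 'l) \<Rightarrow> ('g \<Rightarrow> 'l) \<Rightarrow> 'g \<Rightarrow> 'l::euclidean_space)
    \<Rightarrow> 'g \<Rightarrow> 'l \<Rightarrow> 'l" where
  "ricci_op br B nabla g y = (THE u. \<forall>z. B u z = ricci br nabla g y z)"

definition scalar_curvature ::
  "('l \<Rightarrow> 'l \<Rightarrow> 'l) \<Rightarrow> ('l \<Rightarrow> 'l \<Rightarrow> real) \<Rightarrow> (('g \<Rightarrow> 'l) \<Rightarrow> ('g \<Rightarrow> 'l) \<Rightarrow> 'g \<Rightarrow> 'l::euclidean_space)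
    \<Rightarrow> 'g \<Rightarrow> real" where
  "scalar_curvature br B nabla g = lin_trace (ricci_op br B nabla g)"


section \<open>Parallel transport and holonomy\<close>

definition piecewise_smooth_path ::
  "('g::topological_space, 'e::euclidean_space) atlas \<Rightarrow> (real \<Rightarrow> 'g) \<Rightarrow> bool" where
  "piecewise_smooth_path M \<gamma> \<longleftrightarrow> path \<gamma> \<and>
     (\<exists>S. finite S \<and> {0, 1} \<subseteq> S \<and> S \<subseteq> {0..1} \<and>
        (\<forall>a\<in>S. \<forall>b\<in>S. a < b \<and> {a<..<b} \<inter> S = {} \<longrightarrow>
           (\<exists>I \<delta>. open I \<and> {a..b} \<subseteq> I \<and> smooth_map_on eucl_atlas M I \<delta> \<and>
              (\<forall>t\<in>{a..b}. \<gamma> t = \<delta> t))))"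

text \<open>
  The velocity of \<open>\<gamma>\<close> at \<open>t\<close>, as a derivation, is the left translate to \<open>\<gamma> t\<close> of \<open>X\<close>.
\<close>

definition has_velocity ::
  "('g::topological_space, 'r) monoid_scheme \<Rightarrow> ('g, 'e::euclidean_space) atlas
    \<Rightarrow> ('l::euclidean_space \<Rightarrow> 'g) \<Rightarrow> (real \<Rightarrow> 'g) \<Rightarrow> real \<Rightarrow> 'l \<Rightarrow> bool" where
  "has_velocity G M \<eta> \<gamma> t X \<longleftrightarrow>
     (\<forall>W f. open W \<and> \<gamma> t \<in> W \<and> smooth_fun_on M W (f :: 'g \<Rightarrow> real) \<longrightarrow>
        ((\<lambda>s. f (\<gamma> s)) has_real_derivative left_deriv G \<eta> X f (\<gamma> t)) (at t))"

text \<open>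
  A vector field \<open>v\<close> along \<open>\<gamma>\<close>, written in the left trivialisation, has covariant derivative
  \<open>v' + \<nabla>\<^sub>X (v t)\<close>, where \<open>X\<close> is the velocity and the vector \<open>v t\<close> is extended to a left invariant field.
\<close>

definition parallel_along ::
  "('g::topological_space, 'r) monoid_scheme \<Rightarrow> ('g, 'e::euclidean_space) atlas
    \<Rightarrow> ('l::euclidean_space \<Rightarrow> 'g) \<Rightarrow> (('g \<Rightarrow> 'l) \<Rightarrow> ('g \<Rightarrow> 'l) \<Rightarrow> 'g \<Rightarrow> 'l)
    \<Rightarrow> (real \<Rightarrow> 'g) \<Rightarrow> (real \<Rightarrow> 'l) \<Rightarrow> bool" where
  "parallel_along G M \<eta> nabla \<gamma> v \<longleftrightarrow> continuous_on {0..1} v \<and>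
     (\<exists>S. finite S \<and> (\<forall>t\<in>{0<..<1} - S. \<exists>X. has_velocity G M \<eta> \<gamma> t X \<and>
        (v has_vector_derivative - nabla (\<lambda>_. X) (\<lambda>_. v t) (\<gamma> t)) (at t)))"

text \<open>The holonomy group at the unit element, acting on \<open>'l\<close>.\<close>

definition holonomy_group ::
  "('g::topological_space, 'r) monoid_scheme \<Rightarrow> ('g, 'e::euclidean_space) atlas
    \<Rightarrow> ('l::euclidean_space \<Rightarrow> 'g) \<Rightarrow> (('g \<Rightarrow> 'l) \<Rightarrow> ('g \<Rightarrow> 'l) \<Rightarrow> 'g \<Rightarrow> 'l) \<Rightarrow> ('l \<Rightarrow> 'l) set" where
  "holonomy_group G M \<eta> nabla =
     {T. \<exists>\<gamma>. piecewise_smooth_path M \<gamma> \<and> \<gamma> 0 = \<one>\<^bsub>G\<^esub> \<and> \<gamma> 1 = \<one>\<^bsub>G\<^esub> \<and>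
        (\<forall>x. \<exists>v. parallel_along G M \<eta> nabla \<gamma> v \<and> v 0 = x \<and> v 1 = T x)}"

definition endo_exp :: "('l::euclidean_space \<Rightarrow> 'l) \<Rightarrow> 'l \<Rightarrow> 'l" where
  "endo_exp T x = (\<Sum>n. (T ^^ n) x /\<^sub>R fact n)"

text \<open>The Lie algebra of a Lie subgroup of the general linear group.\<close>

definition linear_group_lie_algebra :: "('l::euclidean_space \<Rightarrow> 'l) set \<Rightarrow> ('l \<Rightarrow> 'l) set" where
  "linear_group_lie_algebra K = {T. linear T \<and> (\<forall>t::real. endo_exp (\<lambda>x. t *\<^sub>R T x) \<in> K)}"

definition holonomy_algebra ::
  "('g::topological_space, 'r) monoid_scheme \<Rightarrow> ('g, 'e::euclidean_space) atlas
    \<Rightarrow> ('l::euclidean_space \<Rightarrow> 'g) \<Rightarrow> (('g \<Rightarrow> 'l) \<Rightarrow> ('g \<Rightarrow> 'l) \<Rightarrow> 'g \<Rightarrow> 'l) \<Rightarrow> ('l \<Rightarrow> 'l) set" where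
  "holonomy_algebra G M \<eta> nabla = linear_group_lie_algebra (holonomy_group G M \<eta> nabla)"


section \<open>Parallel spinors\<close>

text \<open>
  The spinor module of \<open>('l, B)\<close> as a complex module over the Clifford algebra with the relation
  \<open>x \<cdot> y + y \<cdot> x = -2 B x y\<close>, given by the Clifford multiplication \<open>cl\<close>. A module of
  dimension \<open>2^[n/2]\<close>, \<open>n = dim 'l\<close>, is automatically irreducible; for odd \<open>n\<close> there are two of them,
  with isomorphic restrictions to the spin group.
\<close>

definition spinor_module ::
  "('l::euclidean_space \<Rightarrow> 'l \<Rightarrow> real) \<Rightarrow> ('l \<Rightarrow> complex^'s^'s) \<Rightarrow> bool" where
  "spinor_module B cl \<longleftrightarrow> CARD('s) = 2 ^ (DIM('l) div 2) \<and> linear cl \<and>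
     (\<forall>x y. cl x ** cl y + cl y ** cl x = (- 2 * B x y) *\<^sub>R mat 1)"

text \<open>
  The action on spinors of \<open>D\<close> in the Lie algebra of skew endomorphisms:
  \<open>1/2 \<Sum>\<^sub>i\<^sub><\<^sub>j \<epsilon>\<^sub>i \<epsilon>\<^sub>j \<langle>D e\<^sub>i, e\<^sub>j\<rangle> e\<^sub>i \<cdot> e\<^sub>j\<close> for a pseudo-orthonormal basis \<open>E\<close>. As the summand is
  symmetric in \<open>i, j\<close> and vanishes for \<open>i = j\<close>, the sum extends over all pairs, with factor \<open>1/4\<close>.
\<close>

definition spin_action ::
  "('l::euclidean_space \<Rightarrow> 'l \<Rightarrow> real) \<Rightarrow> ('l \<Rightarrow> complex^'s^'s) \<Rightarrow> 'l set \<Rightarrow> ('l \<Rightarrow> 'l) \<Rightarrow> complex^'s^'s" where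
  "spin_action B cl E D =
     (\<Sum>e\<in>E. \<Sum>f\<in>E. (1/4 * B e e * B f f * B (D e) f) *\<^sub>R (cl e ** cl f))"

text \<open>
  On a simply connected Lie group the spin structure is unique, and the spinor bundle is
  trivialised by the left invariant frame \<open>E\<close>: spinor fields are maps from \<open>G\<close> to the spinor
  module, with the spin connection \<open>\<nabla>\<^sub>X \<psi> = X(\<psi>) + 1/2 \<Sum>\<^sub>i\<^sub><\<^sub>j \<epsilon>\<^sub>i \<epsilon>\<^sub>j \<langle>\<nabla>\<^sub>X e\<^sub>i, e\<^sub>j\<rangle> e\<^sub>i \<cdot> e\<^sub>j \<cdot> \<psi>\<close>.
\<close>

definition parallel_spinors ::
  "('g::topological_space, 'r) monoid_scheme \<Rightarrow> ('g, 'e::euclidean_space) atlas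
    \<Rightarrow> ('l::euclidean_space \<Rightarrow> 'g) \<Rightarrow> ('l \<Rightarrow> 'l \<Rightarrow> real)
    \<Rightarrow> (('g \<Rightarrow> 'l) \<Rightarrow> ('g \<Rightarrow> 'l) \<Rightarrow> 'g \<Rightarrow> 'l)
    \<Rightarrow> ('l \<Rightarrow> complex^'s^'s) \<Rightarrow> 'l set \<Rightarrow> ('g \<Rightarrow> complex^'s) set" where
  "parallel_spinors G M \<eta> B nabla cl E =
     {\<psi>. smooth_fun_on M UNIV \<psi> \<and>
        (\<forall>X g. left_deriv G \<eta> X \<psi> g
           + spin_action B cl E (\<lambda>y. nabla (\<lambda>_. X) (\<lambda>_. y) g) *v \<psi> g = 0)}"

definition spinor_space_dim :: "('g \<Rightarrow> complex^'s) set \<Rightarrow> nat" where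
  "spinor_space_dim P = vector_space.dim (\<lambda>(z::complex) \<psi> g. z *s \<psi> g) P"


section \<open>Double extensions are metric Lie algebras\<close>

lemma dext_metric_lie_algebra:
  fixes B :: "'v::euclidean_space \<Rightarrow> 'v \<Rightarrow> real"
  assumes B: "metric_lie_algebra_on UNIV (\<lambda>_ _. 0) B" and A: "A \<in> so_algebra B"
  shows "metric_lie_algebra_on UNIV (dext_bracket A B) (dext_form B)"
proof -
  have bB: "bilinear B" and sB: "\<And>x y. B x y = B y x" and nB: "\<And>x. (\<And>y. B x y = 0) \<Longrightarrow> x = 0"
    using B unfolding metric_lie_algebra_on_def by auto
  have lA: "linear A" and skA: "\<And>x y. B (A x) y = - B x (A y)"
    using A unfolding so_algebra_def by (auto simp: eq_neg_iff_add_eq_0)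
  have skA0: "B (A x) x = 0" for x
    using skA[of x x] sB[of x "A x"] by simp
  note Bs = bilinear_ladd[OF bB] bilinear_radd[OF bB] bilinear_lmul[OF bB] bilinear_rmul[OF bB]
    bilinear_lsub[OF bB] bilinear_rsub[OF bB] bilinear_lzero[OF bB] bilinear_rzero[OF bB]
  note As = linear_add[OF lA] linear_cmul[OF lA] linear_diff[OF lA] linear_0[OF lA]
  have 1: "bilinear (dext_bracket A B)"
    unfolding bilinear_def by (auto intro!: linearI simp: dext_bracket_def Bs As algebra_simps)
  have 2: "bilinear (dext_form B)"
    unfolding bilinear_def by (auto intro!: linearI simp: dext_form_def Bs algebra_simps)
  have 3: "dext_bracket A B x x = 0" for x
    by (cases x) (auto simp: dext_bracket_def skA0 zero_prod_def)
  have 4: "dext_bracket A B x (dext_bracket A B y z) + dext_bracket A B y (dext_bracket A B z x)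
      + dext_bracket A B z (dext_bracket A B x y) = 0" for x y z
  proof -
    obtain a X h where x: "x = (a, X, h)" by (cases x)
    obtain b Y k where y: "y = (b, Y, k)" by (cases y)
    obtain c Z l where z: "z = (c, Z, l)" by (cases z)
    have s: "B (A u) (A v) = B (A v) (A u)" for u v by (rule sB)
    show ?thesis
      by (simp add: x y z dext_bracket_def Bs As algebra_simps zero_prod_def
          s[of Y X] s[of Z X] s[of Z Y])
  qed
  have 5: "dext_form B x y = dext_form B y x" for x y
    by (cases x; cases y) (simp add: dext_form_def sB)
  have 6: "dext_form B (dext_bracket A B x y) z + dext_form B y (dext_bracket A B x z) = 0" for x y z
  proof -
    obtain a X h where x: "x = (a, X, h)" by (cases x)
    obtain b Y k where y: "y = (b, Y, k)" by (cases y)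
    obtain c Z l where z: "z = (c, Z, l)" by (cases z)
    show ?thesis
      using skA[of Y Z] sB[of Y "A X"]
      by (simp add: x y z dext_bracket_def dext_form_def Bs As algebra_simps)
  qed
  have 7: "x = 0" if "\<And>y. dext_form B x y = 0" for x
  proof -
    obtain a X h where x: "x = (a, X, h)" by (cases x)
    have "a = 0" "h = 0" using that[of "(0, 0, 1)"] that[of "(1, 0, 0)"]
      by (simp_all add: x dext_form_def Bs)
    moreover have "X = 0"
    proof (rule nB)
      show "B X Y = 0" for Y using that[of "(0, Y, 0)"] by (simp add: x dext_form_def)
    qed
    ultimately show ?thesis by (simp add: x zero_prod_def)
  qed
  show ?thesis unfolding metric_lie_algebra_on_def using 1 2 3 4 5 6 7 by auto
qed

lemma Collect_insert2_image:
  "{e \<in> insert u (insert w (i ` E)). P e} =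
     (if P u then {u} else {}) \<union> (if P w then {w} else {}) \<union> i ` {e \<in> E. P (i e)}"
  by auto

lemma dext_signature:
  fixes B :: "'v::euclidean_space \<Rightarrow> 'v \<Rightarrow> real"
  assumes bB: "bilinear B" and "has_signature B p q"
  shows "has_signature (dext_form B) (p + 1) (q + 1)"
proof -
  obtain E where iE: "independent E" and sE: "span E = UNIV"
    and nE: "\<And>e. e \<in> E \<Longrightarrow> B e e = 1 \<or> B e e = -1"
    and oE: "\<And>e f. e \<in> E \<Longrightarrow> f \<in> E \<Longrightarrow> e \<noteq> f \<Longrightarrow> B e f = 0"
    and p: "card {e\<in>E. B e e = -1} = p" and q: "card {e\<in>E. B e e = 1} = q"
    using assms(2) unfolding has_signature_def pseudo_onb_def by blast
  have fE: "finite E" using iE by (simp add: independent_imp_finite)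
  have cE: "card E = DIM('v)" using dim_span_eq_card_independent[OF iE] sE by simp
  note Bs = bilinear_lzero[OF bB] bilinear_rzero[OF bB]
  define i :: "'v \<Rightarrow> real \<times> 'v \<times> real" where "i = (\<lambda>e. (0, e, 0))"
  define u :: "real \<times> 'v \<times> real" where "u = (1, 0, 1/2)"
  define w :: "real \<times> 'v \<times> real" where "w = (1, 0, -1/2)"
  define F where "F = insert u (insert w (i ` E))"
  have ini: "inj i" by (auto simp: i_def inj_on_def)
  have ne: "u \<noteq> w" "u \<notin> range i" "w \<notin> range i" by (auto simp: u_def w_def i_def)
  have spF: "span F = UNIV"
  proof -
    have li: "linear i" by (auto intro!: linearI simp: i_def)
    have "i Y \<in> span F" for Y
    proof -
      have "i Y \<in> span (i ` E)" using sE by (simp add: linear_span_image[OF li])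
      then show ?thesis using span_mono[of "i ` E" F] by (auto simp: F_def)
    qed
    moreover have "u \<in> span F" "w \<in> span F" by (auto simp: F_def span_base)
    moreover have "(a, Y, h) = i Y + ((a/2 + h) *\<^sub>R u + (a/2 - h) *\<^sub>R w)" for a Y h
      by (simp add: i_def u_def w_def algebra_simps)
    ultimately have "(a, Y, h) \<in> span F" for a Y h by (metis span_add span_scale)
    then show ?thesis by auto
  qed
  have ci: "card (i ` S) = card S" for S
    by (rule card_image) (rule inj_on_subset[OF ini], simp)
  have ni: "u \<notin> i ` S" "w \<notin> i ` S" for S using ne by auto
  have fF: "finite F" using fE by (simp add: F_def)
  have "card F = card E + 2"
    using ne(1) ni fE by (simp add: F_def ci)
  then have iF: "independent F"
    using spF cE fF by (intro card_le_dim_spanning[of F UNIV]) simp_all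
  have Bi: "dext_form B (i e) (i f) = B e f" for e f by (simp add: i_def dext_form_def)
  have Bu: "dext_form B u u = 1" "dext_form B w w = -1" "dext_form B u w = 0" "dext_form B w u = 0"
    "dext_form B u (i e) = 0" "dext_form B w (i e) = 0" "dext_form B (i e) u = 0"
    "dext_form B (i e) w = 0" for e
    by (simp_all add: i_def u_def w_def dext_form_def Bs)
  have Collect_F: "{e\<in>F. P e} = (if P u then {u} else {}) \<union> (if P w then {w} else {})
      \<union> i ` {e\<in>E. P (i e)}" for P
    unfolding F_def by (rule Collect_insert2_image)
  have "{e\<in>F. dext_form B e e = -1} = insert w (i ` {e\<in>E. B e e = -1})"
    "{e\<in>F. dext_form B e e = 1} = insert u (i ` {e\<in>E. B e e = 1})"
    unfolding Collect_F by (simp_all add: Bi Bu)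
  moreover have "card (insert w (i ` {e\<in>E. B e e = -1})) = p + 1"
    "card (insert u (i ` {e\<in>E. B e e = 1})) = q + 1"
    using p q fE ni by (simp_all add: ci)
  moreover have "pseudo_onb (dext_form B) F"
  proof -
    have F: "e = u \<or> e = w \<or> (\<exists>x\<in>E. e = i x)" if "e \<in> F" for e
      using that unfolding F_def by (simp only: insert_iff image_iff)
    have "dext_form B e e = 1 \<or> dext_form B e e = -1" if "e \<in> F" for e
      using F[OF that] nE by (elim disjE bexE) (simp_all only: Bi Bu simp_thms)
    moreover have "dext_form B e f = 0" if "e \<in> F" "f \<in> F" "e \<noteq> f" for e f
    proof -
      have "B x y = 0" if "x \<in> E" "y \<in> E" "i x \<noteq> i y" for x y
        using that oE by (cases "x = y") simp_all
      then show ?thesis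
        using F[OF that(1)] F[OF that(2)] that(3) by (elim disjE bexE) (simp_all only: Bi Bu simp_thms)
    qed
    ultimately show ?thesis unfolding pseudo_onb_def using iF spF by (intro conjI ballI impI) simp_all
  qed
  ultimately show ?thesis unfolding has_signature_def by (intro exI[of _ F]) simp
qed

end

theory Submission
  imports Defs
begin

text \<open>
  The left invariant forms of \<open>A(p,q)\<close> satisfy \<open>d\<theta>\<^sup>H = 0\<close>, \<open>d(e\<^sup>t\<^sup>A \<theta>\<^sup>g) = 0\<close> for a primitive \<open>t\<close> of \<open>\<theta>\<^sup>H\<close>, and
  \<open>\<theta>\<^sup>\<alpha> + \<langle>A x, dx\<rangle>/2\<close> is closed for a primitive \<open>x\<close> of \<open>e\<^sup>t\<^sup>A \<theta>\<^sup>g\<close>. As the group is simply connected, these primitives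
  exist globally and give functions \<open>a, x, t\<close>, whose common kernel is discrete and normal, hence central, so that
  the group is solvable. The Koszul formula for left invariant fields gives \<open>\<nabla>\<^sub>X Y = [X, Y]/2\<close> and the curvature.
  Along a curve, the \<open>g\<close>-component \<open>v\<close> of a parallel field with \<open>H\<close>-component \<open>h\<close> satisfies
  \<open>(e\<^sup>t\<^sup>A\<^sup>/\<^sup>2 v - h/2 e\<^sup>-\<^sup>t\<^sup>A\<^sup>/\<^sup>2 A x)' = h/4 t' e\<^sup>-\<^sup>t\<^sup>A\<^sup>/\<^sup>2 A\<^sup>2 x\<close>, which lies in the image of \<open>A\<^sup>2\<close>; this bounds the holonomy
  from above, and small loops in the coordinates realise all of it. A spinor at the unit element extends to a
  parallel one iff it is annihilated by all \<open>\<alpha> \<cdot> A\<^sup>2 Z\<close>, and the parallel extension is explicit in \<open>x\<close> and \<open>t\<close>. In the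
  Clifford module, each further isotropic vector halves the dimension of the joint kernel.
\<close>

section \<open>Smooth functions\<close>

text \<open>The group is an abstract type with an atlas, and only the differential of
  \<open>\<eta>\<close> at \<open>0\<close> carries information, so no global product structure is
  given. The coordinate map is never inverted globally: solvability needs only a discrete kernel,
  and holonomy only a local inverse near the unit. Half angles appear because
  \<open>\<nabla>\<close> in the direction \<open>H\<close> acts on \<open>g\<close> by
  \<open>A/2\<close>, while the coordinate \<open>x\<close> is built with the full rotation;
  twisting by \<open>e^(tA/2)\<close> puts both into one frame, in which the transport equation
  loses its exponentials up to terms in the image of \<open>A^2\<close>. The holonomy algebra is
  defined by one-parameter groups contained in the holonomy group. Hence each
  \<open>exp(r T)\<close> must itself be the transport along a loop; knowing curvature as an
  infinitesimal holonomy would not be enough. Closed formulas are possible since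
  \<open>T^3 = 0\<close> and the transport along suitable loops depends on a single area. For the
  upper bound, membership in the image of \<open>A^2\<close> is tested by Euclidean functionals. For
  spinors everything rests on \<open>(\<alpha> \<cdot> Y)(\<alpha> \<cdot> Z) = 0\<close>, which
  cuts exponential series down to affine expressions.\<close>

lemma Ck_on_cong:
  assumes "open S" and eq: "\<And>x. x \<in> S \<Longrightarrow> f x = g x" and "Ck_on k S f"
  shows "Ck_on k S g"
  using eq assms(3)
proof (induction k arbitrary: f g)
  case 0
  then show ?case unfolding Ck_on.simps using continuous_on_cong[OF refl, of S f g] by blast
next
  case (Suc k)
  have d: "(g has_derivative frechet_derivative f (at x)) (at x)" if "x \<in> S" for x
  proof (rule has_derivative_transform_within_open[OF _ assms(1) that])
    show "(f has_derivative frechet_derivative f (at x)) (at x)"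
      using Suc.prems(2) that frechet_derivative_works by auto
  qed (rule Suc.prems(1))
  have eq: "frechet_derivative f (at x) = frechet_derivative g (at x)" if "x \<in> S" for x
    by (rule frechet_derivative_at[OF d[OF that]])
  have "Ck_on k S (\<lambda>x. frechet_derivative g (at x) v)" for v
    by (rule Suc.IH[of "\<lambda>x. frechet_derivative f (at x) v"]) (use Suc.prems(2) eq in auto)
  then show ?case
    using d by (auto simp: differentiable_def)
qed

lemma Ck_on_subset: "Ck_on k S f \<Longrightarrow> T \<subseteq> S \<Longrightarrow> Ck_on k T f"
  by (induction k arbitrary: f) (auto intro: continuous_on_subset)

lemma Ck_on_local:
  assumes "\<And>x. x \<in> S \<Longrightarrow> \<exists>T. open T \<and> x \<in> T \<and> Ck_on k T f"
  shows "Ck_on k S f"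
  using assms
proof (induction k arbitrary: f)
  case 0
  have "isCont f x" if "x \<in> S" for x
    using 0[OF that] by (auto simp: continuous_on_eq_continuous_at)
  then show ?case by (simp add: continuous_at_imp_continuous_on)
next
  case (Suc k)
  then have "f differentiable (at x)" if "x \<in> S" for x using that by fastforce
  moreover have "Ck_on k S (\<lambda>x. frechet_derivative f (at x) v)" for v
    by (rule Suc.IH) (use Suc.prems in fastforce)
  ultimately show ?case by simp
qed

lemma Ck_on_SucI:
  assumes "open S" and d: "\<And>x. x \<in> S \<Longrightarrow> (f has_derivative D x) (at x)"
    and "\<And>v. Ck_on k S (\<lambda>x. D x v)"
  shows "Ck_on (Suc k) S f"
proof -
  have "D x v = frechet_derivative f (at x) v" if "x \<in> S" for x v
    using frechet_derivative_at[OF d[OF that]] by simp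
  then have "Ck_on k S (\<lambda>x. frechet_derivative f (at x) v)" for v
    by (rule Ck_on_cong[OF assms(1) _ assms(3)[of v]])
  then show ?thesis using d by (auto simp: differentiable_def)
qed

lemma Ck_on_Suc_frechet_derivative:
  "Ck_on (Suc k) S f \<Longrightarrow> Ck_on k S (\<lambda>x. frechet_derivative f (at x) v)"
  by simp

text \<open>The recursion descends through derivatives only, so that the classes decrease in
  \<open>k\<close> is not part of the definition; at the bottom, differentiability supplies
  continuity.\<close>

lemma Ck_on_SucD: "Ck_on (Suc k) S f \<Longrightarrow> Ck_on k S f"
proof (induction k arbitrary: f)
  case 0
  then show ?case
    by (simp add: differentiable_imp_continuous_within continuous_at_imp_continuous_on)
next
  case (Suc k)
  have "Ck_on k S (\<lambda>x. frechet_derivative f (at x) v)" for v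
    using Suc.IH[OF Ck_on_Suc_frechet_derivative[OF Suc.prems]] .
  then show ?case using Suc.prems by simp
qed

lemma Ck_on_Suc_has_derivative:
  "Ck_on (Suc k) S f \<Longrightarrow> x \<in> S \<Longrightarrow> (f has_derivative frechet_derivative f (at x)) (at x)"
  using frechet_derivative_works by auto

lemma Ck_on_const: "Ck_on k S (\<lambda>x. c)"
  by (induction k arbitrary: c) auto

lemma Ck_on_add:
  assumes "open S"
  shows "Ck_on k S f \<Longrightarrow> Ck_on k S g \<Longrightarrow> Ck_on k S (\<lambda>x. f x + g x)"
proof (induction k arbitrary: f g)
  case (Suc k)
  show ?case
    by (rule Ck_on_SucI[OF assms has_derivative_add[OF Ck_on_Suc_has_derivative[OF Suc.prems(1)]
      Ck_on_Suc_has_derivative[OF Suc.prems(2)]]]) (use Suc.prems in \<open>simp_all add: Suc.IH\<close>)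
qed (auto intro: continuous_on_add)

lemma Ck_on_sum:
  assumes "open S" "\<And>i. i \<in> I \<Longrightarrow> Ck_on k S (f i)"
  shows "Ck_on k S (\<lambda>x. \<Sum>i\<in>I. f i x)"
  using assms(2) by (induction I rule: infinite_finite_induct) (auto intro: Ck_on_const Ck_on_add[OF assms(1)])

lemma Ck_on_bounded_linear:
  assumes "open S" "bounded_linear L"
  shows "Ck_on k S f \<Longrightarrow> Ck_on k S (\<lambda>x. L (f x))"
proof (induction k arbitrary: f)
  case 0
  then show ?case using assms(2) by (simp add: bounded_linear.continuous_on)
next
  case (Suc k)
  show ?case
    by (rule Ck_on_SucI[OF assms(1) bounded_linear.has_derivative[OF assms(2) Ck_on_Suc_has_derivative[OF Suc.prems(1)]]])
     (use Suc.prems in \<open>simp_all add: Suc.IH\<close>)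
qed

lemma Ck_on_bounded_bilinear:
  assumes "open S" "bounded_bilinear h"
  shows "Ck_on k S f \<Longrightarrow> Ck_on k S g \<Longrightarrow> Ck_on k S (\<lambda>x. h (f x) (g x))"
proof (induction k arbitrary: f g)
  case 0
  then show ?case using assms(2) by (simp add: bounded_bilinear.continuous_on)
next
  case (Suc k)
  show ?case
    by (rule Ck_on_SucI[OF assms(1) bounded_bilinear.FDERIV[OF assms(2) Ck_on_Suc_has_derivative[OF Suc.prems(1)]
       Ck_on_Suc_has_derivative[OF Suc.prems(2)]]])
     (use Suc.prems in \<open>auto intro!: Ck_on_add[OF assms(1)] Suc.IH intro: Ck_on_SucD\<close>)
qed

lemma Ck_on_linear:
  assumes "open S" "bounded_linear L"
  shows "Ck_on k S L"
proof (cases k)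
  case 0
  then show ?thesis using assms(2) by (simp add: linear_continuous_on)
next
  case (Suc n)
  show ?thesis unfolding Suc
    by (rule Ck_on_SucI[OF assms(1) bounded_linear_imp_has_derivative[OF assms(2)] Ck_on_const])
qed

lemma linear_apply_eq_sum_Basis:
  fixes L :: "'a::euclidean_space \<Rightarrow> 'b::real_vector"
  assumes "linear L"
  shows "L v = (\<Sum>b\<in>Basis. (v \<bullet> b) *\<^sub>R L b)"
proof -
  have "L (\<Sum>b\<in>Basis. (v \<bullet> b) *\<^sub>R b) = (\<Sum>b\<in>Basis. (v \<bullet> b) *\<^sub>R L b)"
    by (simp only: linear_sum[OF assms] linear_cmul[OF assms])
  then show ?thesis by (simp only: euclidean_representation)
qed

lemma Ck_on_compose:
  assumes "open S" "open T"
  shows "Ck_on k T g \<Longrightarrow> Ck_on k S f \<Longrightarrow> f ` S \<subseteq> T \<Longrightarrow> Ck_on k S (\<lambda>x. g (f x))"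
proof (induction k arbitrary: f g)
  case 0
  then show ?case by (auto intro: continuous_on_compose2)
next
  case (Suc k)
  have fS: "f x \<in> T" if "x \<in> S" for x using Suc.prems that by auto
  show ?case
  proof (rule Ck_on_SucI[OF assms(1)])
    show "((\<lambda>x. g (f x)) has_derivative (\<lambda>v. frechet_derivative g (at (f x)) (frechet_derivative f (at x) v))) (at x)"
      if "x \<in> S" for x
      using has_derivative_compose[OF Ck_on_Suc_has_derivative[OF Suc.prems(2) that]
          Ck_on_Suc_has_derivative[OF Suc.prems(1) fS[OF that]]] .
    show "Ck_on k S (\<lambda>x. frechet_derivative g (at (f x)) (frechet_derivative f (at x) v))" for v
    proof (rule Ck_on_cong[OF assms(1)])
      \<comment> \<open>The induction hypothesis speaks of derivatives in fixed directions, but here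
        the direction of the outer derivative moves with \<open>x\<close>. Expanding it in the basis
        leaves products of functions of class \<open>k\<close>.\<close>
      show "(\<Sum>b\<in>Basis. (frechet_derivative f (at x) v \<bullet> b) *\<^sub>R frechet_derivative g (at (f x)) b)
        = frechet_derivative g (at (f x)) (frechet_derivative f (at x) v)" if "x \<in> S" for x
      proof -
        have l: "linear (frechet_derivative g (at (f x)))"
          using Ck_on_Suc_has_derivative[OF Suc.prems(1) fS[OF that]] has_derivative_linear by blast
        show ?thesis by (rule linear_apply_eq_sum_Basis[OF l, symmetric])
      qed
      have "Ck_on k S (\<lambda>x. frechet_derivative g (at (f x)) b)" for b
        by (rule Suc.IH[OF Ck_on_Suc_frechet_derivative[OF Suc.prems(1)] Ck_on_SucD[OF Suc.prems(2)] Suc.prems(3)])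
      moreover have "Ck_on k S (\<lambda>x. frechet_derivative f (at x) v \<bullet> b)" for b
        using Suc.prems(2) by (intro Ck_on_bounded_linear[OF assms(1) bounded_linear_inner_left]) simp
      ultimately show "Ck_on k S (\<lambda>x. \<Sum>b\<in>Basis. (frechet_derivative f (at x) v \<bullet> b) *\<^sub>R frechet_derivative g (at (f x)) b)"
        by (intro Ck_on_sum[OF assms(1)] Ck_on_bounded_bilinear[OF assms(1) bounded_bilinear_scaleR])
    qed
  qed
qed

text \<open>Smoothness as a property of germs: sums, products and composites need no bookkeeping of
  common domains, and \<open>smooth_at_cong\<close> allows changes away from the point.\<close>

definition smooth_at :: "('a::euclidean_space \<Rightarrow> 'b::euclidean_space) \<Rightarrow> 'a \<Rightarrow> bool" where
  "smooth_at f x \<longleftrightarrow> (\<exists>S. open S \<and> x \<in> S \<and> smooth_on S f)"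

lemma smooth_on_iff_smooth_at:
  assumes "open S" shows "smooth_on S f \<longleftrightarrow> (\<forall>x\<in>S. smooth_at f x)"
proof
  show "\<forall>x\<in>S. smooth_at f x" if "smooth_on S f" using that assms unfolding smooth_at_def by blast
  show "smooth_on S f" if "\<forall>x\<in>S. smooth_at f x"
    unfolding smooth_on_def
  proof (intro allI Ck_on_local)
    show "\<exists>T. open T \<and> x \<in> T \<and> Ck_on k T f" if "x \<in> S" for x k
      using \<open>\<forall>x\<in>S. smooth_at f x\<close> that unfolding smooth_at_def smooth_on_def by blast
  qed
qed

lemma smooth_at_eventually: "smooth_at f x \<Longrightarrow> eventually (smooth_at f) (nhds x)"
  unfolding eventually_nhds by (metis smooth_at_def)

lemma smooth_at_cong:
  assumes "eventually (\<lambda>y. f y = g y) (nhds x)" "smooth_at f x"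
  shows "smooth_at g x"
proof -
  obtain S T where **: "open S" "x \<in> S" "smooth_on S f" "open T" "x \<in> T" "\<And>y. y \<in> T \<Longrightarrow> f y = g y"
    using assms unfolding smooth_at_def eventually_nhds by auto
  then have "Ck_on k (S \<inter> T) f" for k
    unfolding smooth_on_def by (blast intro: Ck_on_subset)
  then have "open (S \<inter> T) \<and> x \<in> S \<inter> T \<and> smooth_on (S \<inter> T) g"
    unfolding smooth_on_def using ** by (auto intro: Ck_on_cong[of "S \<inter> T" f g])
  then show ?thesis unfolding smooth_at_def by blast
qed

lemma smooth_at_has_derivative: "smooth_at f x \<Longrightarrow> (f has_derivative frechet_derivative f (at x)) (at x)"
  unfolding smooth_at_def smooth_on_def using Ck_on_Suc_has_derivative by blast

lemma smooth_at_isCont: "smooth_at f x \<Longrightarrow> isCont f x"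
  using smooth_at_has_derivative has_derivative_continuous by blast

lemma smooth_at_frechet_derivative: "smooth_at f x \<Longrightarrow> smooth_at (\<lambda>y. frechet_derivative f (at y) v) x"
proof -
  assume "smooth_at f x"
  then obtain S where "open S" "x \<in> S" "\<And>k. Ck_on (Suc k) S f"
    unfolding smooth_at_def smooth_on_def by blast
  then show ?thesis unfolding smooth_at_def smooth_on_def by (intro exI[of _ S]) simp
qed

lemma smooth_at_const [simp, intro]: "smooth_at (\<lambda>x. c) x"
  unfolding smooth_at_def smooth_on_def by (intro exI[of _ UNIV]) (simp add: Ck_on_const)

lemma smooth_at_linear: "bounded_linear L \<Longrightarrow> smooth_at L x"
  unfolding smooth_at_def smooth_on_def by (intro exI[of _ UNIV]) (simp add: Ck_on_linear)

lemma smooth_at_id [simp, intro]: "smooth_at (\<lambda>x. x) x"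
  by (rule smooth_at_linear) (rule bounded_linear_ident)

lemma smooth_at_bounded_bilinear:
  assumes "bounded_bilinear h" "smooth_at f x" "smooth_at g x"
  shows "smooth_at (\<lambda>x. h (f x) (g x)) x"
proof -
  obtain S T where *: "open S" "x \<in> S" "smooth_on S f" "open T" "x \<in> T" "smooth_on T g"
    using assms unfolding smooth_at_def by auto
  then have "Ck_on k (S \<inter> T) f" "Ck_on k (S \<inter> T) g" for k
    unfolding smooth_on_def by (blast intro: Ck_on_subset)+
  then have "open (S \<inter> T) \<and> x \<in> S \<inter> T \<and> smooth_on (S \<inter> T) (\<lambda>x. h (f x) (g x))"
    using * by (auto simp: smooth_on_def intro: Ck_on_bounded_bilinear[OF _ assms(1)])
  then show ?thesis unfolding smooth_at_def by blast
qed

lemma smooth_at_compose: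
  assumes "smooth_at g (f x)" "smooth_at f x"
  shows "smooth_at (\<lambda>x. g (f x)) x"
proof -
  obtain S T where *: "open S" "x \<in> S" "smooth_on S f" "open T" "f x \<in> T" "smooth_on T g"
    using assms unfolding smooth_at_def by auto
  have "continuous_on S f" using * unfolding smooth_on_def by (metis Ck_on.simps(1))
  then have o: "open (S \<inter> f -` T)" using * by (simp add: continuous_open_preimage)
  have "Ck_on k (S \<inter> f -` T) f" for k
    using * unfolding smooth_on_def by (blast intro: Ck_on_subset)
  then have "Ck_on k (S \<inter> f -` T) (\<lambda>x. g (f x))" for k
    by (rule Ck_on_compose[OF o \<open>open T\<close>, rotated]) (use * in \<open>auto simp: smooth_on_def\<close>)
  then have "open (S \<inter> f -` T) \<and> x \<in> S \<inter> f -` T \<and> smooth_on (S \<inter> f -` T) (\<lambda>x. g (f x))"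
    using * o by (simp add: smooth_on_def)
  then show ?thesis unfolding smooth_at_def by blast
qed

lemma smooth_at_bounded_linear: "bounded_linear L \<Longrightarrow> smooth_at f x \<Longrightarrow> smooth_at (\<lambda>x. L (f x)) x"
  by (rule smooth_at_compose) (rule smooth_at_linear)

lemma smooth_at_add: "smooth_at f x \<Longrightarrow> smooth_at g x \<Longrightarrow> smooth_at (\<lambda>x. f x + g x) x"
proof -
  assume "smooth_at f x" "smooth_at g x"
  then obtain S T where *: "open S" "x \<in> S" "smooth_on S f" "open T" "x \<in> T" "smooth_on T g"
    unfolding smooth_at_def by auto
  then have "Ck_on k (S \<inter> T) f" "Ck_on k (S \<inter> T) g" for k
    unfolding smooth_on_def by (blast intro: Ck_on_subset)+
  then have "open (S \<inter> T) \<and> x \<in> S \<inter> T \<and> smooth_on (S \<inter> T) (\<lambda>x. f x + g x)"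
    using * by (auto simp: smooth_on_def intro: Ck_on_add)
  then show ?thesis unfolding smooth_at_def by blast
qed

lemma smooth_at_sum:
  assumes "\<And>i. i \<in> I \<Longrightarrow> smooth_at (f i) x"
  shows "smooth_at (\<lambda>x. \<Sum>i\<in>I. f i x) x"
  using assms by (induction I rule: infinite_finite_induct) (auto intro: smooth_at_add)

lemma smooth_at_scaleR: "smooth_at f x \<Longrightarrow> smooth_at g x \<Longrightarrow> smooth_at (\<lambda>x. f x *\<^sub>R g x) x"
  by (rule smooth_at_bounded_bilinear[OF bounded_bilinear_scaleR])

lemma smooth_at_minus: "smooth_at f x \<Longrightarrow> smooth_at (\<lambda>x. - f x) x"
  by (rule smooth_at_bounded_linear[OF bounded_linear_minus[OF bounded_linear_ident]])

lemma smooth_at_diff: "smooth_at f x \<Longrightarrow> smooth_at g x \<Longrightarrow> smooth_at (\<lambda>x. f x - g x) x"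
  using smooth_at_add[OF _ smooth_at_minus] by fastforce

lemma smooth_at_mult:
  fixes f g :: "_ \<Rightarrow> real"
  shows "smooth_at f x \<Longrightarrow> smooth_at g x \<Longrightarrow> smooth_at (\<lambda>x. f x * g x) x"
  by (rule smooth_at_bounded_bilinear[OF bounded_bilinear_mult])

lemma smooth_at_Pair:
  assumes "smooth_at f x" "smooth_at g x"
  shows "smooth_at (\<lambda>x. (f x, g x)) x"
proof -
  have "bounded_linear (\<lambda>z::'b. (z, 0::'c))" "bounded_linear (\<lambda>z::'c. (0::'b, z))"
    by (auto intro!: bounded_linear_Pair)
  then have "smooth_at (\<lambda>x. (f x, 0) + (0, g x)) x"
    using assms by (intro smooth_at_add) (auto intro: smooth_at_bounded_linear)
  then show ?thesis by simp
qed

lemma smooth_at_fst: "smooth_at f x \<Longrightarrow> smooth_at (\<lambda>x. fst (f x)) x"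
  by (rule smooth_at_bounded_linear[OF bounded_linear_fst])

lemma smooth_at_snd: "smooth_at f x \<Longrightarrow> smooth_at (\<lambda>x. snd (f x)) x"
  by (rule smooth_at_bounded_linear[OF bounded_linear_snd])

text \<open>A linear map depending on \<open>y\<close> is controlled by its values on the basis, so
  smoothness for each fixed vector gives smoothness for a moving one.\<close>

lemma smooth_at_linear_apply:
  assumes "\<forall>\<^sub>F y in nhds x. linear (L y)" "\<And>v. smooth_at (\<lambda>y. L y v) x" "smooth_at f x"
  shows "smooth_at (\<lambda>y. L y (f y)) x"
proof (rule smooth_at_cong)
  show "\<forall>\<^sub>F y in nhds x. (\<Sum>b\<in>Basis. (f y \<bullet> b) *\<^sub>R L y b) = L y (f y)"
    using assms(1) by eventually_elim (simp add: linear_apply_eq_sum_Basis[symmetric])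
  show "smooth_at (\<lambda>y. \<Sum>b\<in>Basis. (f y \<bullet> b) *\<^sub>R L y b) x"
    using assms(2,3) by (intro smooth_at_sum smooth_at_scaleR smooth_at_bounded_linear[OF bounded_linear_inner_left])
qed

text \<open>The regularity of \<open>f\<close> improves by one at each step.\<close>

lemma smooth_on_bootstrap:
  fixes f :: "'a::euclidean_space \<Rightarrow> 'b::euclidean_space"
  assumes "open S" and T: "open T" and d: "\<And>x. x \<in> S \<Longrightarrow> (f has_derivative (\<lambda>v. D v (x, f x))) (at x)"
    and im: "\<And>x. x \<in> S \<Longrightarrow> (x, f x) \<in> T"
    and sm: "\<And>v. smooth_on T (D v)"
  shows "smooth_on S f"
proof -
  have "Ck_on k S f" for k
  proof (induction k)
    case 0
    then show ?case
      using d by (auto intro!: continuous_at_imp_continuous_on has_derivative_continuous)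
  next
    case (Suc k)
    have "Ck_on k S (\<lambda>x. (x, f x))"
    proof (rule Ck_on_cong[OF assms(1)])
      show "Ck_on k S (\<lambda>x. (x, 0) + (0, f x))"
        by (rule Ck_on_add[OF assms(1) Ck_on_linear[OF assms(1)] Ck_on_bounded_linear[OF assms(1) _ Suc]])
          (auto intro!: bounded_linear_Pair)
    qed simp
    then have "Ck_on k S (\<lambda>x. D v (x, f x))" for v
      by (rule Ck_on_compose[OF assms(1) T, rotated]) (use sm im in \<open>auto simp: smooth_on_def\<close>)
    from Ck_on_SucI[OF assms(1) d this] show ?case .
  qed
  then show ?thesis by (simp add: smooth_on_def)
qed

section \<open>Flows of linear vector fields\<close>

text \<open>Makes the time of the exponential explicit; the condition in
  \<open>linear_group_lie_algebra\<close> then reads \<open>flow T t \<in> K\<close> for all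
  \<open>t\<close>.\<close>

definition flow :: "('l::euclidean_space \<Rightarrow> 'l) \<Rightarrow> real \<Rightarrow> 'l \<Rightarrow> 'l" where
  "flow T t = endo_exp (\<lambda>x. t *\<^sub>R T x)"

lemma funpow_scaleR:
  assumes "linear (T :: 'l::real_vector \<Rightarrow> 'l)"
  shows "((\<lambda>x. t *\<^sub>R T x) ^^ n) x = t ^ n *\<^sub>R (T ^^ n) x"
  by (induction n) (simp_all add: linear_cmul[OF assms])

lemma linear_funpow: "linear (T :: 'l::real_vector \<Rightarrow> 'l) \<Longrightarrow> linear (T ^^ n)"
  by (induction n) (simp_all add: linear_id linear_compose)

lemma norm_funpow_le:
  assumes "linear (T :: 'l::euclidean_space \<Rightarrow> 'l)"
  obtains K where "K > 0" "\<And>n x. norm ((T ^^ n) x) \<le> K ^ n * norm x"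
proof -
  obtain K where K: "K > 0" "\<And>x. norm (T x) \<le> norm x * K"
    using bounded_linear.pos_bounded assms linear_conv_bounded_linear by blast
  have "norm ((T ^^ n) x) \<le> K ^ n * norm x" for n x
  proof (induction n)
    case (Suc n)
    have "norm (T ((T ^^ n) x)) \<le> norm ((T ^^ n) x) * K" by (rule K)
    also have "\<dots> \<le> (K ^ n * norm x) * K" using Suc K by (intro mult_right_mono) auto
    finally show ?case by (simp add: mult_ac)
  qed simp
  with K that show thesis by blast
qed

lemma summable_endo_exp:
  assumes "linear (T :: 'l::euclidean_space \<Rightarrow> 'l)"
  shows "summable (\<lambda>n. (T ^^ n) x /\<^sub>R fact n)"
proof -
  obtain K where K: "K > 0" "\<And>n x. norm ((T ^^ n) x) \<le> K ^ n * norm x"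
    using norm_funpow_le[OF assms] by blast
  have "summable (\<lambda>n. K ^ n /\<^sub>R fact n)" by (rule summable_exp_generic)
  then have "summable (\<lambda>n. K ^ n /\<^sub>R fact n * norm x)" by (rule summable_mult2)
  moreover have "norm ((T ^^ n) x /\<^sub>R fact n) \<le> K ^ n /\<^sub>R fact n * norm x" for n
    using K(2)[of n x] by (simp add: field_simps)
  ultimately show ?thesis by (rule summable_comparison_test'[where N=0])
qed

lemma flow_eq:
  assumes "linear T"
  shows "flow T t x = (\<Sum>n. t ^ n *\<^sub>R (T ^^ n) x /\<^sub>R fact n)"
    and "summable (\<lambda>n. t ^ n *\<^sub>R (T ^^ n) x /\<^sub>R fact n)"
  using summable_endo_exp[OF linear_compose_scale_right[OF assms], of t x]
  by (simp_all add: flow_def endo_exp_def funpow_scaleR[OF assms])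

text \<open>Holds term by term in the series. With \<open>L\<close> equal to \<open>T\<close>, to a
  real scaling, or to a complex scaling of spinors, it yields commutation and both kinds of
  homogeneity.\<close>

lemma flow_intertwine:
  assumes T: "linear T" and U: "linear U" and L: "linear L" and c: "\<And>x. L (T x) = U (L x)"
  shows "L (flow T t x) = flow U t (L x)"
proof -
  have "L ((T ^^ n) x) = (U ^^ n) (L x)" for n by (induction n) (simp_all add: c)
  moreover have "L (flow T t x) = (\<Sum>n. L (t ^ n *\<^sub>R (T ^^ n) x /\<^sub>R fact n))"
    unfolding flow_eq[OF T]
    using bounded_linear.suminf[OF _ flow_eq(2)[OF T], of L] L by (simp add: linear_conv_bounded_linear)
  ultimately show ?thesis by (simp add: flow_eq[OF U] linear_cmul[OF L])
qed

lemma flow_commute: "linear T \<Longrightarrow> T (flow T t x) = flow T t (T x)"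
  by (rule flow_intertwine) auto

lemma linear_flow:
  assumes T: "linear T"
  shows "linear (flow T t)"
proof (rule linearI)
  show "flow T t (c *\<^sub>R x) = c *\<^sub>R flow T t x" for c x
    by (rule flow_intertwine[OF T T, symmetric]) (auto simp: linear_cmul[OF T])
  show "flow T t (x + y) = flow T t x + flow T t y" for x y
    unfolding flow_eq[OF T] suminf_add[OF flow_eq(2)[OF T] flow_eq(2)[OF T]]
    by (simp add: linear_add[OF linear_funpow[OF T]] scaleR_add_right)
qed

lemma flow_0 [simp]:
  assumes T: "linear T" shows "flow T 0 x = x"
proof -
  have "(\<Sum>n. 0 ^ n *\<^sub>R (T ^^ n) x /\<^sub>R fact n) = (\<Sum>n\<in>{0}. 0 ^ n *\<^sub>R (T ^^ n) x /\<^sub>R fact n)"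
    by (rule suminf_finite) auto
  then show ?thesis by (simp add: flow_eq[OF T])
qed

text \<open>Each Euclidean component is an everywhere convergent real power series in
  \<open>t\<close>, which may be differentiated term by term.\<close>

lemma flow_has_vector_derivative:
  assumes T: "linear T"
  shows "((\<lambda>t. flow T t x) has_vector_derivative flow T t (T x)) (at t)"
  unfolding has_vector_derivative_def
proof (subst has_derivative_componentwise_within, intro ballI)
  fix b :: 'a assume "b \<in> Basis"
  define c where "c n = ((T ^^ n) x \<bullet> b) / fact n" for n
  have e: "flow T t y \<bullet> b = (\<Sum>n. ((T ^^ n) y \<bullet> b) / fact n * t ^ n)"
    and s: "summable (\<lambda>n. ((T ^^ n) y \<bullet> b) / fact n * t ^ n)" for t y
  proof -
    have "(\<lambda>n. (t ^ n *\<^sub>R (T ^^ n) y /\<^sub>R fact n) \<bullet> b) sums (flow T t y \<bullet> b)"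
      unfolding flow_eq[OF T]
      by (rule bounded_linear.sums[OF bounded_linear_inner_left summable_sums[OF flow_eq(2)[OF T]]])
    then have "(\<lambda>n. ((T ^^ n) y \<bullet> b) / fact n * t ^ n) sums (flow T t y \<bullet> b)"
      by (simp add: field_simps)
    then show "flow T t y \<bullet> b = (\<Sum>n. ((T ^^ n) y \<bullet> b) / fact n * t ^ n)"
     "summable (\<lambda>n. ((T ^^ n) y \<bullet> b) / fact n * t ^ n)"
      by (simp_all add: sums_iff)
  qed
  have d: "diffs c n = ((T ^^ n) (T x) \<bullet> b) / fact n" for n
    by (simp add: diffs_def c_def funpow_swap1 field_simps del: of_nat_Suc)
  have "((\<lambda>t. \<Sum>n. c n * t ^ n) has_real_derivative (\<Sum>n. diffs c n * t ^ n)) (at t)"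
    by (rule termdiffs_strong_converges_everywhere) (use s in \<open>simp add: c_def\<close>)
  then have "((\<lambda>t. flow T t x \<bullet> b) has_real_derivative (flow T t (T x) \<bullet> b)) (at t)"
    unfolding e by (simp add: c_def[symmetric] d)
  then show "((\<lambda>t. flow T t x \<bullet> b) has_derivative (\<lambda>h. (h *\<^sub>R flow T t (T x)) \<bullet> b)) (at t)"
    by (simp add: has_field_derivative_def mult_commute_abs)
qed

lemma has_derivative_flow:
  assumes T: "linear T" and f: "(f has_derivative f') (at z within S)" and g: "(g has_derivative g') (at z within S)"
  shows "((\<lambda>z. flow T (f z) (g z)) has_derivative
     (\<lambda>h. f' h *\<^sub>R flow T (f z) (T (g z)) + flow T (f z) (g' h))) (at z within S)"
proof -
  have d: "((\<lambda>z. flow T (f z) b) has_derivative (\<lambda>h. f' h *\<^sub>R flow T (f z) (T b))) (at z within S)" for b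
    using has_derivative_compose[OF f flow_has_vector_derivative[OF T, unfolded has_vector_derivative_def]] .
  have "((\<lambda>z. \<Sum>b\<in>Basis. (g z \<bullet> b) *\<^sub>R flow T (f z) b) has_derivative
     (\<lambda>h. \<Sum>b\<in>Basis. (g z \<bullet> b) *\<^sub>R (f' h *\<^sub>R flow T (f z) (T b)) + (g' h \<bullet> b) *\<^sub>R flow T (f z) b)) (at z within S)"
    by (intro has_derivative_sum bounded_bilinear.FDERIV[OF bounded_bilinear_scaleR] d
         has_derivative_inner_left g)
  moreover have "linear (\<lambda>y. f' h *\<^sub>R flow T (f z) (T y))" for h
    using linear_compose_scale_right[OF linear_compose[OF T linear_flow[OF T]]] by (simp add: o_def)
  then have "(\<Sum>b\<in>Basis. (g z \<bullet> b) *\<^sub>R (f' h *\<^sub>R flow T (f z) (T b))) = f' h *\<^sub>R flow T (f z) (T (g z))" for h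
    using linear_apply_eq_sum_Basis[of "\<lambda>y. f' h *\<^sub>R flow T (f z) (T y)" "g z"] by simp
  ultimately show ?thesis
    by (simp add: sum.distrib linear_apply_eq_sum_Basis[OF linear_flow[OF T], symmetric])
qed

lemma smooth_at_flow:
  assumes T: "linear T" and f: "smooth_at f z" and g: "smooth_at g z"
  shows "smooth_at (\<lambda>z. flow T (f z) (g z)) z"
proof (rule smooth_at_linear_apply[OF _ _ g])
  show "smooth_at (\<lambda>y. flow T (f y) v) z" for v
  proof (rule smooth_at_compose[OF _ f])
    have "Ck_on k UNIV (\<lambda>t. flow T t v)" for k
    proof (induction k arbitrary: v)
      case 0
      then show ?case
        using flow_has_vector_derivative[OF T]
        by (auto intro!: continuous_at_imp_continuous_on has_vector_derivative_continuous)
    next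
      case (Suc k)
      have "Ck_on k UNIV (\<lambda>t. h *\<^sub>R flow T t (T v))" for h
        by (rule Ck_on_bounded_linear[OF open_UNIV bounded_linear_scaleR_right Suc])
      from Ck_on_SucI[OF open_UNIV flow_has_vector_derivative[OF T, unfolded has_vector_derivative_def] this]
      show ?case .
    qed
    then show "smooth_at (\<lambda>t. flow T t v) (f z)"
      unfolding smooth_at_def smooth_on_def by blast
  qed
qed (simp add: linear_flow[OF T])

lemma has_derivative_zero_imp_const:
  fixes f :: "real \<Rightarrow> 'a::real_normed_vector"
  assumes "\<And>x. (f has_derivative (\<lambda>h. 0)) (at x)"
  shows "f x = f y"
  using has_derivative_zero_unique[of UNIV f x y] assms by auto

lemma flow_add:
  assumes T: "linear T"
  shows "flow T (s + t) x = flow T s (flow T t x)"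
proof -
  \<comment> \<open>The left side has zero derivative in \<open>s\<close> and equals the right side
    at \<open>s = 0\<close>. The case \<open>t = 0\<close> gives invertibility, and cancelling
    \<open>flow T (-s)\<close> gives the group law.\<close>
  have c: "flow T (-s) (flow T (s + t) x) = flow T t x" for s t x
  proof -
    have "((\<lambda>s. flow T (-s) (flow T (s + t) x)) has_derivative (\<lambda>h. 0)) (at r)" for r
    proof -
      have "((\<lambda>s. flow T (-s) (flow T (s + t) x)) has_derivative
        (\<lambda>h. - h *\<^sub>R flow T (-r) (T (flow T (r + t) x)) + flow T (-r) (h *\<^sub>R flow T (r + t) (T x) + flow T (r + t) 0))) (at r)"
        by (intro has_derivative_flow[OF T] derivative_eq_intros) auto
      then show ?thesis
        by (simp add: flow_commute[OF T] linear_0[OF linear_flow[OF T]] linear_cmul[OF linear_flow[OF T]])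
    qed
    from has_derivative_zero_imp_const[OF this, where x=s and y=0] show ?thesis by (simp add: T)
  qed
  have i: "flow T s (flow T (-s) y) = y" for y
    using c[where s="-s" and t=0 and x=y] by (simp add: T)
  show ?thesis using i[of "flow T (s + t) x"] by (simp add: c)
qed

lemma flow_minus_cancel [simp]:
  assumes T: "linear T"
  shows "flow T s (flow T (-s) y) = y" "flow T (-s) (flow T s y) = y"
  using flow_add[OF T, of s "-s" y] flow_add[OF T, of "-s" s y] by (simp_all add: T)

lemma flow_isometry:
  assumes T: "linear T" and B: "bilinear B" and skew: "\<And>x y. B (T x) y + B x (T y) = 0"
  shows "B (flow T t x) (flow T t y) = (B x y :: real)"
proof -
  have bb: "bounded_bilinear B" using B by (simp add: bilinear_conv_bounded_bilinear)
  have "((\<lambda>s. B (flow T s x) (flow T s y)) has_derivative (\<lambda>h. 0)) (at r)" for r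
  proof -
    have d: "((\<lambda>s. flow T s x) has_derivative (\<lambda>h. h *\<^sub>R flow T r (T x))) (at r)" for x
      using flow_has_vector_derivative[OF T] by (simp add: has_vector_derivative_def)
    have "B (flow T r x) (h *\<^sub>R flow T r (T y)) + B (h *\<^sub>R flow T r (T x)) (flow T r y) = 0" for h
      using skew[of "flow T r x" "flow T r y"]
      by (simp add: bilinear_lmul[OF B] bilinear_rmul[OF B] flow_commute[OF T] add.commute flip: distrib_left)
    with bounded_bilinear.FDERIV[OF bb d[of x] d[of y]] show ?thesis by simp
  qed
  from has_derivative_zero_imp_const[OF this, where x=t and y=0] show ?thesis by (simp add: T)
qed

section \<open>Smooth functions and plots on manifolds\<close>

text \<open>The pointwise form of \<open>smooth_fun_on\<close>, with every chart at the point;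
  \<open>mfd_smooth_atI\<close> shows that one of them suffices.\<close>

definition mfd_smooth_at ::
  "('m::topological_space, 'e::euclidean_space) atlas \<Rightarrow> ('m \<Rightarrow> 'w::euclidean_space) \<Rightarrow> 'm \<Rightarrow> bool" where
  "mfd_smooth_at M f g \<longleftrightarrow> (\<forall>(U, c)\<in>M. g \<in> U \<longrightarrow> smooth_at (\<lambda>y. f (inv_into U c y)) (c g))"

text \<open>Plots are smooth maps from Euclidean spaces into the manifold: inverse charts,
  \<open>\<eta>\<close>, curves and their products. Continuity is included because it keeps nearby
  values in the chart domain, where \<open>c\<close> has a meaning.\<close>

definition plot_at ::
  "('m::topological_space, 'e::euclidean_space) atlas \<Rightarrow> ('a::euclidean_space \<Rightarrow> 'm) \<Rightarrow> 'a \<Rightarrow> bool" where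
  "plot_at M \<psi> x \<longleftrightarrow> isCont \<psi> x \<and> (\<forall>(U, c)\<in>M. \<psi> x \<in> U \<longrightarrow> smooth_at (\<lambda>y. c (\<psi> y)) x)"

lemma smooth_atI: "open S \<Longrightarrow> x \<in> S \<Longrightarrow> smooth_on S f \<Longrightarrow> smooth_at f x"
  by (auto simp: smooth_at_def)

lemma isCont_eventually_open:
  assumes "isCont f x" "open U" "f x \<in> U"
  shows "\<forall>\<^sub>F y in nhds x. f y \<in> U"
  using assms topological_tendstoD[of f "f x" "nhds x" U] by (simp add: continuous_within tendsto_at_iff_tendsto_nhds)

locale smooth_manifold =
  fixes M :: "('m::t2_space, 'e::euclidean_space) atlas"
  assumes smooth_atlas: "smooth_atlas M"
begin

lemma chart_open: "(U, c) \<in> M \<Longrightarrow> open U"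
  and chart_image_open: "(U, c) \<in> M \<Longrightarrow> open (c ` U)"
  and chart_homeomorphism: "(U, c) \<in> M \<Longrightarrow> homeomorphism U (c ` U) c (inv_into U c)"
  using smooth_atlas unfolding smooth_atlas_def by auto

lemma chart_ex: obtains U c where "(U, c) \<in> M" "g \<in> U"
proof -
  have "g \<in> \<Union> (fst ` M)" using smooth_atlas unfolding smooth_atlas_def by blast
  then show thesis using that by (metis UN_E prod.collapse)
qed

lemma chart_inv: "(U, c) \<in> M \<Longrightarrow> x \<in> U \<Longrightarrow> inv_into U c (c x) = x"
  using chart_homeomorphism homeomorphism_apply1 by blast

lemma chart_inv_mem: "(U, c) \<in> M \<Longrightarrow> y \<in> c ` U \<Longrightarrow> inv_into U c y \<in> U"
  by (rule inv_into_into)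

lemma chart_apply_inv: "(U, c) \<in> M \<Longrightarrow> y \<in> c ` U \<Longrightarrow> c (inv_into U c y) = y"
  by (rule f_inv_into_f)

lemma chart_isCont: "(U, c) \<in> M \<Longrightarrow> x \<in> U \<Longrightarrow> isCont c x"
  using chart_homeomorphism chart_open by (metis continuous_on_eq_continuous_at homeomorphism_cont1)

lemma chart_inv_isCont: "(U, c) \<in> M \<Longrightarrow> y \<in> c ` U \<Longrightarrow> isCont (inv_into U c) y"
  using chart_homeomorphism chart_image_open by (metis continuous_on_eq_continuous_at homeomorphism_cont2)

lemma chart_image_Int_open:
  assumes "(U, c) \<in> M" "open W"
  shows "open (c ` (U \<inter> W))"
proof -
  have "c ` (U \<inter> W) = c ` U \<inter> inv_into U c -` W"
  proof safe
    fix x assume "x \<in> U" "inv_into U c (c x) \<in> W"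
    then show "c x \<in> c ` (U \<inter> W)" using chart_inv[OF assms(1)] by simp
  qed (auto simp: chart_inv[OF assms(1)])
  moreover have "continuous_on (c ` U) (inv_into U c)"
    using chart_homeomorphism[OF assms(1)] homeomorphism_cont2 by blast
  ultimately show ?thesis
    using assms chart_image_open continuous_open_preimage by metis
qed

lemma smooth_at_transition:
  assumes "(U, c) \<in> M" "(V, d) \<in> M" "g \<in> U" "g \<in> V"
  shows "smooth_at (\<lambda>y. d (inv_into U c y)) (c g)"
proof (rule smooth_atI)
  show "open (c ` (U \<inter> V))" using assms chart_open chart_image_Int_open by blast
  show "smooth_on (c ` (U \<inter> V)) (\<lambda>y. d (inv_into U c y))"
    using smooth_atlas assms unfolding smooth_atlas_def o_def by blast
qed (use assms in auto)

lemma chart_eventually_mem: "(U, c) \<in> M \<Longrightarrow> g \<in> U \<Longrightarrow> \<forall>\<^sub>F y in nhds (c g). y \<in> c ` U"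
  using chart_image_open eventually_nhds_in_open by blast

lemma mfd_smooth_atI:
  assumes "(U, c) \<in> M" "g \<in> U" "smooth_at (\<lambda>y. f (inv_into U c y)) (c g)"
  shows "mfd_smooth_at M f g"
  unfolding mfd_smooth_at_def
proof clarify
  fix V d assume V: "(V, d) \<in> M" "g \<in> V"
  have "\<forall>\<^sub>F y in nhds (d g). inv_into V d y \<in> U"
    using isCont_eventually_open[OF chart_inv_isCont[OF V(1)] chart_open[OF assms(1)], of "d g"] V assms
    by (simp add: chart_inv)
  then have ev: "\<forall>\<^sub>F y in nhds (d g). f (inv_into U c (c (inv_into V d y))) = f (inv_into V d y)"
    by eventually_elim (simp add: chart_inv[OF assms(1)])
  have "smooth_at (\<lambda>y. f (inv_into U c (c (inv_into V d y)))) (d g)"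
  proof (rule smooth_at_compose[where f="\<lambda>y. c (inv_into V d y)"])
    show "smooth_at (\<lambda>y. f (inv_into U c y)) (c (inv_into V d (d g)))"
      using assms V by (simp add: chart_inv)
  qed (rule smooth_at_transition[OF V(1) assms(1) V(2) assms(2)])
  then show "smooth_at (\<lambda>y. f (inv_into V d y)) (d g)" by (rule smooth_at_cong[OF ev])
qed

lemma mfd_smooth_atD:
  "mfd_smooth_at M f g \<Longrightarrow> (U, c) \<in> M \<Longrightarrow> g \<in> U \<Longrightarrow> smooth_at (\<lambda>y. f (inv_into U c y)) (c g)"
  unfolding mfd_smooth_at_def by auto

lemma plot_chart_inv:
  assumes "(U, c) \<in> M" "y \<in> c ` U"
  shows "plot_at M (inv_into U c) y"
  unfolding plot_at_def
proof (intro conjI ballI)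
  fix Vd assume "Vd \<in> M"
  then obtain V d where Vd: "Vd = (V, d)" "(V, d) \<in> M" by (cases Vd) auto
  have "smooth_at (\<lambda>y. d (inv_into U c y)) y" if "inv_into U c y \<in> V"
    using smooth_at_transition[OF assms(1) Vd(2) chart_inv_mem[OF assms] that] chart_apply_inv[OF assms] by simp
  then show "case Vd of (V, d) \<Rightarrow> inv_into U c y \<in> V \<longrightarrow> smooth_at (\<lambda>y. d (inv_into U c y)) y"
    by (simp add: Vd)
qed (rule chart_inv_isCont[OF assms])

lemma plot_atD:
  assumes "plot_at M \<psi> x"
  shows "isCont \<psi> x" "(U, c) \<in> M \<Longrightarrow> \<psi> x \<in> U \<Longrightarrow> smooth_at (\<lambda>y. c (\<psi> y)) x"
  using assms unfolding plot_at_def by auto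

lemma mfd_smooth_at_plot:
  assumes "mfd_smooth_at M f (\<psi> x)" "plot_at M \<psi> x"
  shows "smooth_at (\<lambda>y. f (\<psi> y)) x"
proof -
  obtain U c where U: "(U, c) \<in> M" "\<psi> x \<in> U" by (rule chart_ex)
  have "\<forall>\<^sub>F y in nhds x. \<psi> y \<in> U"
    using isCont_eventually_open[OF plot_atD(1)[OF assms(2)] chart_open[OF U(1)] U(2)] .
  then have ev: "\<forall>\<^sub>F y in nhds x. f (inv_into U c (c (\<psi> y))) = f (\<psi> y)"
    by eventually_elim (simp add: chart_inv[OF U(1)])
  have "smooth_at (\<lambda>y. f (inv_into U c (c (\<psi> y)))) x"
    by (rule smooth_at_compose[OF mfd_smooth_atD[OF assms(1) U] plot_atD(2)[OF assms(2) U]])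
  then show ?thesis by (rule smooth_at_cong[OF ev])
qed

lemma plot_atI:
  assumes "isCont \<psi> x" "(U, c) \<in> M" "\<psi> x \<in> U" "smooth_at (\<lambda>y. c (\<psi> y)) x"
  shows "plot_at M \<psi> x"
  unfolding plot_at_def
proof (intro conjI ballI)
  fix Vd assume "Vd \<in> M"
  then obtain V d where Vd: "Vd = (V, d)" "(V, d) \<in> M" by (cases Vd) auto
  have "smooth_at (\<lambda>y. d (\<psi> y)) x" if "\<psi> x \<in> V"
  proof (rule smooth_at_cong)
    show "\<forall>\<^sub>F y in nhds x. d (inv_into U c (c (\<psi> y))) = d (\<psi> y)"
      using isCont_eventually_open[OF assms(1) chart_open[OF assms(2)] assms(3)]
      by eventually_elim (simp add: chart_inv[OF assms(2)])
    show "smooth_at (\<lambda>y. d (inv_into U c (c (\<psi> y)))) x"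
      by (rule smooth_at_compose[OF smooth_at_transition[OF assms(2) Vd(2) assms(3) that] assms(4)])
  qed
  then show "case Vd of (V, d) \<Rightarrow> \<psi> x \<in> V \<longrightarrow> smooth_at (\<lambda>y. d (\<psi> y)) x"
    by (simp add: Vd)
qed (rule assms)

lemma plot_at_compose:
  assumes "plot_at M \<psi> (h x)" "smooth_at h x"
  shows "plot_at M (\<lambda>y. \<psi> (h y)) x"
proof -
  obtain U c where U: "(U, c) \<in> M" "\<psi> (h x) \<in> U" by (rule chart_ex)
  show ?thesis
  proof (rule plot_atI)
    show "(U, c) \<in> M" "\<psi> (h x) \<in> U" by fact+
    show "isCont (\<lambda>y. \<psi> (h y)) x"
      using isCont_o2[OF smooth_at_isCont[OF assms(2)] plot_atD(1)[OF assms(1)]] .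
    show "smooth_at (\<lambda>y. c (\<psi> (h y))) x"
      by (rule smooth_at_compose[OF plot_atD(2)[OF assms(1) U] assms(2)])
  qed
qed

lemma plot_at_const: "plot_at M (\<lambda>_. g) x"
proof -
  obtain U c where U: "(U, c) \<in> M" "g \<in> U" by (rule chart_ex)
  then show ?thesis by (intro plot_atI[OF _ U]) auto
qed

lemma mfd_smooth_at_isCont:
  assumes "mfd_smooth_at M f g"
  shows "isCont f g"
proof -
  obtain U c where U: "(U, c) \<in> M" "g \<in> U" by (rule chart_ex)
  have "isCont (\<lambda>x. f (inv_into U c (c x))) g"
    by (rule isCont_o2[OF chart_isCont[OF U] smooth_at_isCont[OF mfd_smooth_atD[OF assms U]]])
  moreover
  have "\<forall>\<^sub>F y in nhds g. y \<in> U" using chart_open[OF U(1)] U(2) eventually_nhds_in_open by blast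
  then have "\<forall>\<^sub>F y in nhds g. f (inv_into U c (c y)) = f y"
    by eventually_elim (simp add: chart_inv[OF U(1)])
  from isCont_cong[OF this] calculation show ?thesis by simp
qed

lemma smooth_fun_on_iff:
  assumes "open W"
  shows "smooth_fun_on M W f \<longleftrightarrow> (\<forall>g\<in>W. mfd_smooth_at M f g)"
proof
  assume *: "smooth_fun_on M W f"
  show "\<forall>g\<in>W. mfd_smooth_at M f g"
  proof
    fix g assume g: "g \<in> W"
    obtain U c where U: "(U, c) \<in> M" "g \<in> U" by (rule chart_ex)
    have "smooth_on (c ` (U \<inter> W)) (\<lambda>y. f (inv_into U c y))"
      using * U unfolding smooth_map_on_def eucl_atlas_def by (fastforce simp: o_def Int_def)
    then have "smooth_at (\<lambda>y. f (inv_into U c y)) (c g)"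
      by (rule smooth_atI[OF chart_image_Int_open[OF U(1) assms], rotated]) (use U g in blast)
    then show "mfd_smooth_at M f g" by (rule mfd_smooth_atI[OF U])
  qed
next
  assume *: "\<forall>g\<in>W. mfd_smooth_at M f g"
  have "continuous_on W f" by (rule continuous_at_imp_continuous_on) (use * mfd_smooth_at_isCont in blast)
  moreover have "smooth_on (c ` (U \<inter> W)) (\<lambda>y. f (inv_into U c y))" if "(U, c) \<in> M" for U c
    unfolding smooth_on_iff_smooth_at[OF chart_image_Int_open[OF that assms]]
  proof clarify
    show "smooth_at (\<lambda>y. f (inv_into U c y)) (c x)" if "x \<in> U" "x \<in> W" for x
      using mfd_smooth_atD[OF _ \<open>(U, c) \<in> M\<close> that(1)] * that(2) by blast
  qed
  ultimately show "smooth_fun_on M W f"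
    unfolding smooth_map_on_def eucl_atlas_def by (auto simp: o_def Int_def)
qed

lemma mfd_smooth_at_chart: "(U, c) \<in> M \<Longrightarrow> g \<in> U \<Longrightarrow> mfd_smooth_at M c g"
  by (rule mfd_smooth_atI, assumption+, rule smooth_at_transition)

lemma mfd_smooth_at_cong:
  assumes "\<forall>\<^sub>F y in nhds g. f y = h y" "mfd_smooth_at M f g"
  shows "mfd_smooth_at M h g"
proof -
  obtain U c where U: "(U, c) \<in> M" "g \<in> U" by (rule chart_ex)
  have "(inv_into U c \<longlongrightarrow> inv_into U c (c g)) (nhds (c g))"
    using chart_inv_isCont[OF U(1) imageI[OF U(2)]] by (simp add: isCont_def tendsto_at_iff_tendsto_nhds)
  then have "\<forall>\<^sub>F y in nhds (c g). f (inv_into U c y) = h (inv_into U c y)"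
    using assms(1) unfolding chart_inv[OF U] filterlim_iff by blast
  from smooth_at_cong[OF this mfd_smooth_atD[OF assms(2) U]] show ?thesis by (rule mfd_smooth_atI[OF U])
qed

lemma mfd_smooth_at_compose:
  "smooth_at h (f g) \<Longrightarrow> mfd_smooth_at M f g \<Longrightarrow> mfd_smooth_at M (\<lambda>x. h (f x)) g"
proof -
  assume *: "smooth_at h (f g)" "mfd_smooth_at M f g"
  obtain U c where U: "(U, c) \<in> M" "g \<in> U" by (rule chart_ex)
  have "smooth_at (\<lambda>y. h (f (inv_into U c y))) (c g)"
    by (rule smooth_at_compose[OF _ mfd_smooth_atD[OF *(2) U]]) (simp add: *(1) chart_inv[OF U])
  then show ?thesis by (rule mfd_smooth_atI[OF U])
qed

lemma mfd_smooth_at_Pair: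
  "mfd_smooth_at M f g \<Longrightarrow> mfd_smooth_at M h g \<Longrightarrow> mfd_smooth_at M (\<lambda>x. (f x, h x)) g"
  unfolding mfd_smooth_at_def by (auto intro!: smooth_at_Pair)

lemma mfd_smooth_at_const: "mfd_smooth_at M (\<lambda>_. a) g"
  unfolding mfd_smooth_at_def by auto

lemma mfd_smooth_at_bounded_linear:
  "bounded_linear L \<Longrightarrow> mfd_smooth_at M f g \<Longrightarrow> mfd_smooth_at M (\<lambda>x. L (f x)) g"
  by (rule mfd_smooth_at_compose) (rule smooth_at_linear)

lemma plot_at_of_smooth_map_on:
  assumes "smooth_map_on eucl_atlas M N \<psi>" "open N" "x \<in> N"
  shows "plot_at M \<psi> x"
proof -
  have c: "isCont \<psi> x" using assms continuous_on_eq_continuous_at unfolding smooth_map_on_def by blast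
  obtain U d where U: "(U, d) \<in> M" "\<psi> x \<in> U" by (rule chart_ex)
  have "smooth_on {y \<in> N. \<psi> y \<in> U} (\<lambda>y. d (\<psi> y))"
    using assms(1) U unfolding smooth_map_on_def eucl_atlas_def by (auto simp: o_def)
  moreover have "{y \<in> N. \<psi> y \<in> U} = N \<inter> \<psi> -` U" by auto
  then have "open {y \<in> N. \<psi> y \<in> U}"
    using assms chart_open[OF U(1)] continuous_open_preimage unfolding smooth_map_on_def by metis
  ultimately have "smooth_at (\<lambda>y. d (\<psi> y)) x" using assms U by (auto intro: smooth_atI)
  then show ?thesis using plot_atI[OF c U] by blast
qed

lemma smooth_map_on_of_plot_at:
  assumes "open N" "\<And>x. x \<in> N \<Longrightarrow> plot_at M \<psi> x"
  shows "smooth_map_on eucl_atlas M N \<psi>"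
proof -
  have c: "continuous_on N \<psi>" using plot_atD(1)[OF assms(2)] by (simp add: continuous_at_imp_continuous_on)
  have "smooth_on {y \<in> N. \<psi> y \<in> U} (\<lambda>y. d (\<psi> y))" if "(U, d) \<in> M" for U d
  proof -
    have "{y \<in> N. \<psi> y \<in> U} = N \<inter> \<psi> -` U" by auto
    then have "open {y \<in> N. \<psi> y \<in> U}"
      using c assms(1) chart_open[OF that] continuous_open_preimage by metis
    then show ?thesis using plot_atD(2)[OF assms(2) that] by (simp add: smooth_on_iff_smooth_at)
  qed
  then show ?thesis using c unfolding smooth_map_on_def eucl_atlas_def by (auto simp: o_def)
qed

end

section \<open>Left invariant derivatives on Lie groups\<close>

lemma smooth_at_eventually_smooth_at_snd:
  fixes F :: "'a::euclidean_space \<times> 'b::euclidean_space \<Rightarrow> 'c::euclidean_space"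
  assumes F: "smooth_at F (x, h x)" and h: "smooth_at h x"
  shows "\<forall>\<^sub>F y in nhds x. smooth_at F (y, h y)"
proof -
  have "isCont (\<lambda>y. (y, h y)) x" using smooth_at_isCont[OF h] by (intro continuous_intros) auto
  then have "((\<lambda>y. (y, h y)) \<longlongrightarrow> (x, h x)) (nhds x)"
    using tendsto_at_iff_tendsto_nhds[of "\<lambda>y. (y, h y)" x] by (simp add: isCont_def)
  with smooth_at_eventually[OF F] show ?thesis unfolding filterlim_iff by blast
qed

lemma frechet_derivative_snd:
  assumes "smooth_at F (y, x)"
  shows "((\<lambda>x. F (y, x)) has_derivative (\<lambda>v. frechet_derivative F (at (y, x)) (0, v))) (at x)"
proof -
  have "((\<lambda>x. (y, x)) has_derivative (\<lambda>v. (0, v))) (at x)"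
    by (auto intro!: derivative_eq_intros)
  from has_derivative_compose[OF this smooth_at_has_derivative[OF assms]] show ?thesis .
qed

text \<open>The point of differentiation may move with the parameter: \<open>h = 0\<close> serves
  derivatives along left translates of \<open>\<eta>\<close>, and \<open>h y = y\<close> the
  derivative on the diagonal in \<open>coframe\<close>.\<close>

lemma smooth_at_partial_derivative:
  assumes F: "smooth_at F (x, h x)" and h: "smooth_at h x"
  shows "smooth_at (\<lambda>y. frechet_derivative (\<lambda>z. F (y, z)) (at (h y)) v) x"
proof (rule smooth_at_cong)
  show "smooth_at (\<lambda>y. frechet_derivative F (at (y, h y)) (0, v)) x"
    by (rule smooth_at_compose[OF smooth_at_frechet_derivative[of F], OF _ smooth_at_Pair[OF smooth_at_id h]]) (rule F)
  show "\<forall>\<^sub>F y in nhds x. frechet_derivative F (at (y, h y)) (0, v) = frechet_derivative (\<lambda>z. F (y, z)) (at (h y)) v"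
    using smooth_at_eventually_smooth_at_snd[OF assms]
    by eventually_elim (use frechet_derivative_at[OF frechet_derivative_snd] in metis)
qed

locale lie_group_frame =
  fixes G :: "('g::{t2_space,second_countable_topology}, 'r) monoid_scheme"
    and M :: "('g, 'e::euclidean_space) atlas"
    and \<eta> :: "'l::euclidean_space \<Rightarrow> 'g"
    and br :: "'l \<Rightarrow> 'l \<Rightarrow> 'l"
  assumes lie_group: "lie_group G M" and has_lie_algebra: "has_lie_algebra G M \<eta> br"

sublocale lie_group_frame \<subseteq> smooth_manifold M
  using lie_group by unfold_locales (auto simp: lie_group_def)

sublocale lie_group_frame \<subseteq> group G
  using lie_group by (auto simp: lie_group_def)

context lie_group_frame
begin

abbreviation gmult (infixl "\<odot>" 70) where "x \<odot> y \<equiv> x \<otimes>\<^bsub>G\<^esub> y"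
abbreviation ginv where "ginv x \<equiv> inv\<^bsub>G\<^esub> x"
abbreviation gone where "gone \<equiv> \<one>\<^bsub>G\<^esub>"
abbreviation ld where "ld \<equiv> left_deriv G \<eta>"

lemma carrier_UNIV [simp]: "carrier G = UNIV"
  using lie_group by (auto simp: lie_group_def)

lemma g_assoc: "(x \<odot> y) \<odot> z = x \<odot> (y \<odot> z)" by (rule m_assoc) auto
lemma g_one [simp]: "x \<odot> gone = x" "gone \<odot> x = x" by (auto intro: r_one l_one)
lemma g_inv [simp]: "ginv x \<odot> x = gone" "x \<odot> ginv x = gone" by (auto intro: r_inv l_inv)
lemma g_inv_cancel [simp]: "ginv x \<odot> (x \<odot> y) = y" "x \<odot> (ginv x \<odot> y) = y"
  by (simp_all flip: g_assoc)

text \<open>Translates smoothness for the product atlas into a statement about plots, the form in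
  which smoothness of the multiplication is used from here on.\<close>

lemma plot_mult:
  assumes "plot_at M \<phi> x" "plot_at M \<psi> x"
  shows "plot_at M (\<lambda>y. \<phi> y \<odot> \<psi> y) x"
proof -
  have sm: "smooth_map_on (prod_atlas M M) M UNIV (\<lambda>(x, y). x \<odot> y)"
    using lie_group by (auto simp: lie_group_def)
  then have cm: "continuous_on UNIV (\<lambda>(x, y). x \<odot> y)" by (auto simp: smooth_map_on_def)
  obtain U c where U: "(U, c) \<in> M" "\<phi> x \<in> U" by (rule chart_ex)
  obtain V d where V: "(V, d) \<in> M" "\<psi> x \<in> V" by (rule chart_ex)
  obtain W e where W: "(W, e) \<in> M" "\<phi> x \<odot> \<psi> x \<in> W" by (rule chart_ex)
  have cc: "isCont (\<lambda>y. (\<phi> y, \<psi> y)) x"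
    using plot_atD(1)[OF assms(1)] plot_atD(1)[OF assms(2)] by (rule isCont_Pair)
  have "isCont (\<lambda>(x, y). x \<odot> y) p" for p
    using cm continuous_on_eq_continuous_at[OF open_UNIV, of "\<lambda>(x, y). x \<odot> y"] by blast
  from isCont_o2[OF cc this] have c: "isCont (\<lambda>y. \<phi> y \<odot> \<psi> y) x" by simp
  define P where "P = {p \<in> U \<times> V. fst p \<odot> snd p \<in> W}"
  define k where "k = map_prod c d"
  have inj: "inj_on k (U \<times> V)"
    using chart_inv[OF U(1)] chart_inv[OF V(1)] unfolding k_def
    by (intro map_prod_inj_on) (metis inj_onI)+
  have ki: "inv_into (U \<times> V) k (c u, d v) = (u, v)" if "u \<in> U" "v \<in> V" for u v
    using inv_into_f_f[OF inj, of "(u, v)"] that by (simp add: k_def)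
  have "P = (U \<times> V) \<inter> (\<lambda>(x, y). x \<odot> y) -` W" by (auto simp: P_def)
  moreover have "open (U \<times> V)" using chart_open U V open_Times by blast
  ultimately have oP: "open P"
    using cm chart_open[OF W(1)] by (metis continuous_open_preimage continuous_on_subset subset_UNIV)
  \<comment> \<open>Local smoothness can be read off from \<open>smooth_on\<close> only on an open
    set, so the coordinate image of \<open>P\<close> is written as an open part of \<open>c\<close>
    U \<times> d \<open>V\<close>.\<close>
  have "k ` P = (c ` U \<times> d ` V) \<inter> (\<lambda>(a, b). (inv_into U c a, inv_into V d b)) -` P"
    using chart_inv[OF U(1)] chart_inv[OF V(1)] by (fastforce simp: P_def k_def image_iff)
  moreover have "continuous_on (c ` U \<times> d ` V) (\<lambda>(a, b). (inv_into U c a, inv_into V d b))"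
    unfolding case_prod_unfold
    using homeomorphism_cont2[OF chart_homeomorphism[OF U(1)]] homeomorphism_cont2[OF chart_homeomorphism[OF V(1)]]
    by (intro continuous_on_Pair continuous_on_compose2[OF _ continuous_on_fst[OF continuous_on_id]]
         continuous_on_compose2[OF _ continuous_on_snd[OF continuous_on_id]]) auto
  moreover have "open (c ` U \<times> d ` V)" using chart_image_open U V open_Times by blast
  ultimately have ok: "open (k ` P)" using oP by (metis continuous_open_preimage)
  have "(U \<times> V, k) \<in> prod_atlas M M" using U V by (auto simp: prod_atlas_def k_def)
  then have "smooth_on (k ` P) (\<lambda>z. e ((\<lambda>(x, y). x \<odot> y) (inv_into (U \<times> V) k z)))"
    using sm W(1) unfolding smooth_map_on_def P_def by (fastforce simp: o_def case_prod_unfold)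
  moreover have "(c (\<phi> x), d (\<psi> x)) \<in> k ` P" using U V W by (force simp: P_def k_def)
  ultimately have s: "smooth_at (\<lambda>z. e ((\<lambda>(x, y). x \<odot> y) (inv_into (U \<times> V) k z))) (c (\<phi> x), d (\<psi> x))"
    using smooth_atI[OF ok] by blast
  show ?thesis
  proof (rule plot_atI[OF c W(1)])
    have "smooth_at (\<lambda>y. e ((\<lambda>(x, y). x \<odot> y) (inv_into (U \<times> V) k (c (\<phi> y), d (\<psi> y))))) x"
      by (rule smooth_at_compose[of _ "\<lambda>y. (c (\<phi> y), d (\<psi> y))", OF s])
        (intro smooth_at_Pair plot_atD(2)[OF assms(1) U] plot_atD(2)[OF assms(2) V])
    moreover have "\<forall>\<^sub>F y in nhds x. e ((\<lambda>(x, y). x \<odot> y) (inv_into (U \<times> V) k (c (\<phi> y), d (\<psi> y)))) = e (\<phi> y \<odot> \<psi> y)"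
      using isCont_eventually_open[OF plot_atD(1)[OF assms(1)] chart_open[OF U(1)] U(2)]
        isCont_eventually_open[OF plot_atD(1)[OF assms(2)] chart_open[OF V(1)] V(2)]
      by eventually_elim (simp add: ki)
    ultimately show "smooth_at (\<lambda>y. e (\<phi> y \<odot> \<psi> y)) x" by (rule smooth_at_cong[rotated])
  qed (rule W)
qed

lemma plot_inv:
  assumes "plot_at M \<phi> x"
  shows "plot_at M (\<lambda>y. ginv (\<phi> y)) x"
proof -
  have sm: "smooth_map_on M M UNIV ginv"
    using lie_group by (auto simp: lie_group_def)
  then have cm: "continuous_on UNIV ginv" by (auto simp: smooth_map_on_def)
  then have "isCont ginv p" for p by (simp add: continuous_on_eq_continuous_at)
  from isCont_o2[OF plot_atD(1)[OF assms] this] have c: "isCont (\<lambda>y. ginv (\<phi> y)) x" .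
  obtain U c where U: "(U, c) \<in> M" "\<phi> x \<in> U" by (rule chart_ex)
  obtain W e where W: "(W, e) \<in> M" "ginv (\<phi> x) \<in> W" by (rule chart_ex)
  have o: "open (ginv -` W)" using cm chart_open[OF W(1)] by (simp add: open_vimage)
  have "smooth_on (c ` (U \<inter> ginv -` W)) (\<lambda>z. e (ginv (inv_into U c z)))"
    using sm W(1) U(1) unfolding smooth_map_on_def by (fastforce simp: o_def vimage_def Int_def)
  then have s: "smooth_at (\<lambda>z. e (ginv (inv_into U c z))) (c (\<phi> x))"
    by (rule smooth_atI[OF chart_image_Int_open[OF U(1) o], rotated]) (use U W in auto)
  show ?thesis
  proof (rule plot_atI[OF c W(1)])
    have "smooth_at (\<lambda>y. e (ginv (inv_into U c (c (\<phi> y))))) x"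
      by (rule smooth_at_compose[OF s plot_atD(2)[OF assms(1) U]])
    moreover have "\<forall>\<^sub>F y in nhds x. e (ginv (inv_into U c (c (\<phi> y)))) = e (ginv (\<phi> y))"
      using isCont_eventually_open[OF plot_atD(1)[OF assms(1)] chart_open[OF U(1)] U(2)]
      by eventually_elim (simp add: chart_inv[OF U(1)])
    ultimately show "smooth_at (\<lambda>y. e (ginv (\<phi> y))) x" by (rule smooth_at_cong[rotated])
  qed (rule W)
qed

lemma tangent: "tangent_identification G M \<eta>"
  using has_lie_algebra by (auto simp: has_lie_algebra_def)

lemma eta_0 [simp]: "\<eta> 0 = gone"
  using tangent by (auto simp: tangent_identification_def)

lemma eventually_plot_eta: "\<forall>\<^sub>F x in nhds 0. plot_at M \<eta> x"
proof -
  obtain N where "open N" "0 \<in> N" "smooth_map_on eucl_atlas M N \<eta>"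
    using tangent by (auto simp: tangent_identification_def)
  then show ?thesis unfolding eventually_nhds using plot_at_of_smooth_map_on by blast
qed

lemma plot_eta: "plot_at M \<eta> 0"
  using eventually_plot_eta by (rule eventually_nhds_x_imp_x)

lemma plot_translate: "plot_at M (\<lambda>x. g \<odot> \<eta> x) 0"
  by (rule plot_mult[OF plot_at_const plot_eta])

lemma has_derivative_ld:
  assumes "mfd_smooth_at M f g"
  shows "((\<lambda>x. f (g \<odot> \<eta> x)) has_derivative (\<lambda>X. ld X f g)) (at 0)"
  unfolding left_deriv_def using assms
  by (intro smooth_at_has_derivative mfd_smooth_at_plot[where \<psi>="\<lambda>x. g \<odot> \<eta> x"] plot_translate) simp

lemma ldI: "((\<lambda>x. f (g \<odot> \<eta> x)) has_derivative D) (at 0) \<Longrightarrow> ld X f g = D X"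
  unfolding left_deriv_def using frechet_derivative_at by force

lemma linear_ld: "mfd_smooth_at M f g \<Longrightarrow> linear (\<lambda>X. ld X f g)"
  using has_derivative_ld has_derivative_linear by blast

text \<open>A left derivative along a plot is a partial derivative at \<open>0\<close> of the smooth
  function \<open>(y, x) \<mapsto> f (\<psi> y \<odot> \<eta> x)\<close> of two Euclidean
  variables.\<close>

lemma smooth_at_ld_plot:
  assumes f: "mfd_smooth_at M f (\<psi> a)" and p: "plot_at M \<psi> a"
  shows "smooth_at (\<lambda>y. ld X f (\<psi> y)) a"
  unfolding left_deriv_def
proof (rule smooth_at_partial_derivative[of "\<lambda>z. f (\<psi> (fst z) \<odot> \<eta> (snd z))" a "\<lambda>_. 0", simplified])
  show "smooth_at (\<lambda>z. f (\<psi> (fst z) \<odot> \<eta> (snd z))) (a, 0)"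
    using f p plot_eta by (intro mfd_smooth_at_plot[of f "\<lambda>z. \<psi> (fst z) \<odot> \<eta> (snd z)"] plot_mult
      plot_at_compose[of \<psi> fst] plot_at_compose[of \<eta> snd]) (auto intro: smooth_at_linear bounded_linear_fst bounded_linear_snd)
qed

lemma mfd_smooth_at_ld:
  assumes "mfd_smooth_at M f g"
  shows "mfd_smooth_at M (ld X f) g"
proof -
  obtain U c where U: "(U, c) \<in> M" "g \<in> U" by (rule chart_ex)
  show ?thesis using assms
    by (intro mfd_smooth_atI[OF U] smooth_at_ld_plot plot_chart_inv[OF U(1)]) (auto simp: U chart_inv[OF U])
qed

lemma has_derivative_plot:
  assumes "mfd_smooth_at M f (\<psi> x)" "plot_at M \<psi> x" and U: "(U, c) \<in> M" "\<psi> x \<in> U"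
  shows "((\<lambda>y. f (\<psi> y)) has_derivative (\<lambda>v. frechet_derivative (\<lambda>y. f (inv_into U c y)) (at (c (\<psi> x)))
     (frechet_derivative (\<lambda>y. c (\<psi> y)) (at x) v))) (at x)"
proof -
  have ev: "\<forall>\<^sub>F y in nhds x. f (inv_into U c (c (\<psi> y))) = f (\<psi> y)"
    using isCont_eventually_open[OF plot_atD(1)[OF assms(2)] chart_open[OF U(1)] U(2)]
    by eventually_elim (simp add: chart_inv[OF U(1)])
  have "((\<lambda>y. f (inv_into U c (c (\<psi> y)))) has_derivative (\<lambda>v. frechet_derivative (\<lambda>y. f (inv_into U c y)) (at (c (\<psi> x)))
     (frechet_derivative (\<lambda>y. c (\<psi> y)) (at x) v))) (at x)"
    by (rule has_derivative_compose[OF smooth_at_has_derivative[OF plot_atD(2)[OF assms(2) U]]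
          smooth_at_has_derivative[OF mfd_smooth_atD[OF assms(1) U]]])
  then show ?thesis
    by (rule has_derivative_transform_eventually)
      (use ev in \<open>auto simp: eventually_at_filter intro: eventually_mono eventually_nhds_x_imp_x\<close>)
qed

lemma ld_chart:
  assumes "mfd_smooth_at M f g" and U: "(U, c) \<in> M" "g \<in> U"
  shows "ld X f g = frechet_derivative (\<lambda>y. f (inv_into U c y)) (at (c g)) (ld X c g)"
  using has_derivative_plot[of f "\<lambda>x. g \<odot> \<eta> x" 0 U c] assms plot_translate[of g]
  by (simp add: left_deriv_def ldI[unfolded left_deriv_def])

lemma unit_chart:
  obtains U c where "(U, c) \<in> M" "gone \<in> U" "bij (\<lambda>X. ld X c gone)"
proof -
  obtain U c where "(U, c) \<in> M" "gone \<in> U" "bij (frechet_derivative (c \<circ> \<eta>) (at 0))"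
    using tangent by (auto simp: tangent_identification_def)
  then show thesis by (intro that[of U c]) (simp_all add: left_deriv_def o_def)
qed

end

section \<open>Coframes, logarithmic derivatives and vanishing derivatives\<close>

lemma frechet_derivative_cong:
  assumes "\<forall>\<^sub>F y in nhds x. f y = g y"
  shows "frechet_derivative f (at x) = frechet_derivative g (at x)"
proof -
  have e: "f x = g x" using assms by (rule eventually_nhds_x_imp_x)
  have "\<forall>\<^sub>F y in at x. f y = g y" using assms by (auto simp: eventually_at_filter elim: eventually_mono)
  have e': "\<forall>\<^sub>F y in at x. g y = f y" using \<open>\<forall>\<^sub>F y in at x. f y = g y\<close> by eventually_elim simp
  have "(f has_derivative D) (at x) \<longleftrightarrow> (g has_derivative D) (at x)" for D
    using has_derivative_transform_eventually[OF _ \<open>\<forall>\<^sub>F y in at x. f y = g y\<close> e]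
      has_derivative_transform_eventually[OF _ e' e[symmetric]] by blast
  then show ?thesis unfolding frechet_derivative_def by simp
qed

context lie_group_frame
begin

lemma eventually_translate:
  assumes "\<forall>\<^sub>F h in nhds g. P h"
  shows "\<forall>\<^sub>F x in nhds 0. P (g \<odot> \<eta> x)"
proof -
  have "((\<lambda>x. g \<odot> \<eta> x) \<longlongrightarrow> g) (nhds 0)"
    using plot_atD(1)[OF plot_translate[of g]] tendsto_at_iff_tendsto_nhds[of "\<lambda>x. g \<odot> \<eta> x" 0]
    by (simp add: isCont_def)
  with assms show ?thesis unfolding filterlim_iff by blast
qed

lemma ld_cong:
  assumes "\<forall>\<^sub>F h in nhds g. f h = k h"
  shows "ld X f g = ld X k g"
  unfolding left_deriv_def by (rule frechet_derivative_cong[THEN fun_cong, OF eventually_translate[OF assms]])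

text \<open>A dual frame that is smooth without inverting a matrix-valued function. In coordinates,
  \<open>K (y, z)\<close> is \<open>g^-1 h\<close>, where \<open>g, h\<close> have coordinates
  \<open>y, z\<close>. Its \<open>z\<close>-derivative on the diagonal sends the left invariant
  frame at \<open>g\<close> to the frame at the unit, where a single fixed inverse \<open>L\<close>
  reads off the vector.\<close>

lemma coframe:
  assumes U: "(U, c) \<in> M"
  obtains \<theta> :: "'e \<Rightarrow> 'e \<Rightarrow> 'l" where
    "\<And>y. y \<in> c ` U \<Longrightarrow> linear (\<theta> y)"
    "\<And>y X. y \<in> c ` U \<Longrightarrow> \<theta> y (ld X c (inv_into U c y)) = X"
    "\<And>y w. y \<in> c ` U \<Longrightarrow> ld (\<theta> y w) c (inv_into U c y) = w"
    "\<And>y w. y \<in> c ` U \<Longrightarrow> smooth_at (\<lambda>y. \<theta> y w) y"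
proof -
  obtain V d where V: "(V, d) \<in> M" "gone \<in> V" "bij (\<lambda>X. ld X d gone)" by (rule unit_chart)
  define L where "L = inv_into UNIV (\<lambda>X. ld X d gone)"
  have lin1: "linear (\<lambda>X. ld X d gone)" by (rule linear_ld[OF mfd_smooth_at_chart[OF V(1,2)]])
  have LE: "L (ld X d gone) = X" and EL: "ld (L w) d gone = w" for X w
    unfolding L_def using inv_into_f_f[OF bij_is_inj[OF V(3)] UNIV_I] surj_f_inv_f[OF bij_is_surj[OF V(3)]]
    by auto
  have linL: "linear L"
  proof (rule linearI)
    show "L (a + b) = L a + L b" for a b
      using LE[of "L a + L b"] linear_add[OF lin1] by (simp add: EL)
    show "L (r *\<^sub>R a) = r *\<^sub>R L a" for r a
      using LE[of "r *\<^sub>R L a"] linear_cmul[OF lin1] by (simp add: EL)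
  qed
  define K where "K = (\<lambda>z. d (ginv (inv_into U c (fst z)) \<odot> inv_into U c (snd z)))"
  define \<theta> where "\<theta> y w = L (frechet_derivative (\<lambda>z. K (y, z)) (at y) w)" for y w
  have mV: "mfd_smooth_at M d gone" by (rule mfd_smooth_at_chart[OF V(1,2)])
  have K: "smooth_at K (y, y)" if "y \<in> c ` U" for y
    unfolding K_def
  proof (rule mfd_smooth_at_plot[where f=d and \<psi>="\<lambda>z. ginv (inv_into U c (fst z)) \<odot> inv_into U c (snd z)"])
    show "plot_at M (\<lambda>z. ginv (inv_into U c (fst z)) \<odot> inv_into U c (snd z)) (y, y)"
      using plot_chart_inv[OF U that]
      by (intro plot_mult plot_inv plot_at_compose[of "inv_into U c" fst] plot_at_compose[of "inv_into U c" snd])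
        (auto intro: smooth_at_linear bounded_linear_fst bounded_linear_snd)
  qed (use mV in simp)
  have Kd: "((\<lambda>z. K (y, z)) has_derivative frechet_derivative (\<lambda>z. K (y, z)) (at y)) (at y)" if "y \<in> c ` U" for y
    using frechet_derivative_snd[OF K[OF that]] frechet_derivative_works differentiableI by blast
  have KE: "frechet_derivative (\<lambda>z. K (y, z)) (at y) (ld X c (inv_into U c y)) = ld X d gone"
    if y: "y \<in> c ` U" for y X
  proof -
    define g where "g = inv_into U c y"
    have g: "g \<in> U" "c g = y" using chart_inv_mem chart_apply_inv U that by (auto simp: g_def)
    have "mfd_smooth_at M (\<lambda>h. d (ginv g \<odot> h)) g"
    proof (rule mfd_smooth_atI[OF U g(1)], rule mfd_smooth_at_plot[where f=d and \<psi>="\<lambda>z. ginv g \<odot> inv_into U c z"])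
      show "plot_at M (\<lambda>z. ginv g \<odot> inv_into U c z) (c g)"
        using y by (intro plot_mult plot_at_const plot_chart_inv[OF U]) (simp add: g)
      show "mfd_smooth_at M d (ginv g \<odot> inv_into U c (c g))"
        using mV by (simp add: chart_inv[OF U g(1)])
    qed
    from ld_chart[OF this U g(1), of X] show ?thesis
      by (simp add: g K_def left_deriv_def flip: g_def)
  qed
  \<comment> \<open>Translating back by \<open>g\<close> undoes \<open>K (y, _)\<close> near
    \<open>y\<close>. By the chain rule the derivative of \<open>K\<close> has a left inverse, which
    makes \<open>\<theta> y\<close> injective and hence a two-sided inverse of the frame.\<close>
  have inj: "w = w'" if y: "y \<in> c ` U"
    and e: "frechet_derivative (\<lambda>z. K (y, z)) (at y) w = frechet_derivative (\<lambda>z. K (y, z)) (at y) w'" for y w w'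
  proof -
    define g where "g = inv_into U c y"
    have g: "g \<in> U" "c g = y" using chart_inv_mem chart_apply_inv U that by (auto simp: g_def)
    have "smooth_at (\<lambda>u. c (g \<odot> inv_into V d u)) (d gone)"
      by (rule mfd_smooth_at_plot[where f=c and \<psi>="\<lambda>u. g \<odot> inv_into V d u", OF _ plot_mult[OF plot_at_const plot_chart_inv[OF V(1)]]])
        (use V g in \<open>simp_all add: chart_inv mfd_smooth_at_chart[OF U]\<close>)
    moreover have Ky: "K (y, y) = d gone" by (simp add: K_def)
    ultimately have D: "((\<lambda>z. c (g \<odot> inv_into V d (K (y, z)))) has_derivative
      (\<lambda>w. frechet_derivative (\<lambda>u. c (g \<odot> inv_into V d u)) (at (d gone)) (frechet_derivative (\<lambda>z. K (y, z)) (at y) w))) (at y)"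
      using has_derivative_compose[OF Kd[OF y], of "\<lambda>u. c (g \<odot> inv_into V d u)"]
        smooth_at_has_derivative[of "\<lambda>u. c (g \<odot> inv_into V d u)" "d gone"] by simp
    have "isCont (\<lambda>z. ginv g \<odot> inv_into U c z) y"
      by (rule plot_atD(1)[OF plot_mult[OF plot_at_const plot_chart_inv[OF U y]]])
    from isCont_eventually_open[OF this chart_open[OF V(1)]]
    have "\<forall>\<^sub>F z in nhds y. ginv g \<odot> inv_into U c z \<in> V" using V by (simp flip: g_def)
    moreover have "\<forall>\<^sub>F z in nhds y. z \<in> c ` U" using chart_eventually_mem[OF U g(1)] g by simp
    ultimately have "\<forall>\<^sub>F z in nhds y. c (g \<odot> inv_into V d (K (y, z))) = z"
      by eventually_elim (simp add: K_def chart_inv[OF V(1)] chart_apply_inv[OF U] flip: g_def)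
    from frechet_derivative_cong[OF this] have "frechet_derivative (\<lambda>z. c (g \<odot> inv_into V d (K (y, z)))) (at y) = (\<lambda>w. w)"
      using frechet_derivative_at[OF has_derivative_ident, of y] by simp
    then have R: "frechet_derivative (\<lambda>u. c (g \<odot> inv_into V d u)) (at (d gone)) (frechet_derivative (\<lambda>z. K (y, z)) (at y) w) = w" for w
      using fun_cong[OF frechet_derivative_at[OF D], of w] by simp
    show ?thesis
      using arg_cong[OF e, of "frechet_derivative (\<lambda>u. c (g \<odot> inv_into V d u)) (at (d gone))"]
      unfolding R .
  qed
  show thesis
  proof (rule that[of \<theta>])
    fix y assume y: "y \<in> c ` U"
    show "linear (\<theta> y)"
      unfolding \<theta>_def using linear_compose[OF has_derivative_linear[OF Kd[OF y]] linL] by (simp add: o_def)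
    show "\<theta> y (ld X c (inv_into U c y)) = X" for X
      by (simp add: \<theta>_def KE[OF y] LE)
    show "ld (\<theta> y w) c (inv_into U c y) = w" for w
      by (rule inj[OF y]) (simp add: \<theta>_def KE[OF y] EL)
    show "smooth_at (\<lambda>y. \<theta> y w) y" for w
      unfolding \<theta>_def using linL K[OF y]
      by (intro smooth_at_bounded_linear[where L=L] smooth_at_partial_derivative[of K y "\<lambda>y. y"])
        (auto simp: linear_conv_bounded_linear)
  qed
qed

lemma ld_chart_surj:
  assumes U: "(U, c) \<in> M" "g \<in> U"
  obtains X where "ld X c g = w"
proof -
  obtain \<theta> :: "'e \<Rightarrow> 'e \<Rightarrow> 'l" where
    "\<And>y w. y \<in> c ` U \<Longrightarrow> ld (\<theta> y w) c (inv_into U c y) = w"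
    by (rule coframe[OF U(1)]) (rule that)
  from this[of "c g" w] show thesis using U that by (auto simp: chart_inv)
qed

text \<open>The logarithmic derivative: the velocity of the plot in direction \<open>v\<close>,
  translated to the unit. The chart is chosen arbitrarily, but
  \<open>frechet_derivative_plot\<close> characterises the value by all smooth functions.\<close>

definition maurer_cartan :: "('a::euclidean_space \<Rightarrow> 'g) \<Rightarrow> 'a \<Rightarrow> 'a \<Rightarrow> 'l" where
  "maurer_cartan \<psi> x v = (let c = SOME c. \<exists>U. (U, c) \<in> M \<and> \<psi> x \<in> U in
     SOME X. ld X c (\<psi> x) = frechet_derivative (\<lambda>y. c (\<psi> y)) (at x) v)"

lemma frechet_derivative_plot:
  assumes f: "mfd_smooth_at M f (\<psi> x)" and p: "plot_at M \<psi> x"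
  shows "frechet_derivative (\<lambda>y. f (\<psi> y)) (at x) v = ld (maurer_cartan \<psi> x v) f (\<psi> x)"
proof -
  define c where "c = (SOME c. \<exists>U. (U, c) \<in> M \<and> \<psi> x \<in> U)"
  have "\<exists>c U. (U, c) \<in> M \<and> \<psi> x \<in> U" using chart_ex[of "\<psi> x"] by blast
  from someI_ex[OF this] obtain U where U: "(U, c) \<in> M" "\<psi> x \<in> U" unfolding c_def by blast
  obtain X where "ld X c (\<psi> x) = frechet_derivative (\<lambda>y. c (\<psi> y)) (at x) v"
    by (rule ld_chart_surj[OF U])
  then have "ld (maurer_cartan \<psi> x v) c (\<psi> x) = frechet_derivative (\<lambda>y. c (\<psi> y)) (at x) v"
    unfolding maurer_cartan_def Let_def c_def[symmetric] by (rule someI)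
  then show ?thesis
    using frechet_derivative_at[OF has_derivative_plot[OF f p U], symmetric] ld_chart[OF f U] by simp
qed

lemma ld_inner:
  assumes "mfd_smooth_at M f g"
  shows "ld X (\<lambda>h. f h \<bullet> b) g = ld X f g \<bullet> b"
  by (rule ldI[where D="\<lambda>X. ld X f g \<bullet> b"]) (intro has_derivative_inner_left has_derivative_ld[OF assms])

lemma mfd_smooth_at_inner: "mfd_smooth_at M f g \<Longrightarrow> mfd_smooth_at M (\<lambda>h. f h \<bullet> b) g"
  by (rule mfd_smooth_at_bounded_linear[OF bounded_linear_inner_left])

text \<open>Tangent vectors are determined as derivations. The test functions are local, so the
  components of a chart serve, and a coframe recovers the vector from them.\<close>

lemma ld_injective:
  assumes "\<And>(f :: 'g \<Rightarrow> real) W. open W \<Longrightarrow> g \<in> W \<Longrightarrow> (\<And>h. h \<in> W \<Longrightarrow> mfd_smooth_at M f h) \<Longrightarrow> ld X f g = ld Y f g"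
  shows "X = Y"
proof -
  obtain U c where U: "(U, c) \<in> M" "g \<in> U" by (rule chart_ex)
  have "ld X c g \<bullet> b = ld Y c g \<bullet> b" for b
    using assms[OF chart_open[OF U(1)] U(2) mfd_smooth_at_inner[OF mfd_smooth_at_chart[OF U(1)]], of b]
    unfolding ld_inner[OF mfd_smooth_at_chart[OF U]] .
  then have "ld X c g = ld Y c g" by (rule euclidean_eqI)
  moreover obtain \<theta> :: "'e \<Rightarrow> 'e \<Rightarrow> 'l" where
    "\<And>y X. y \<in> c ` U \<Longrightarrow> \<theta> y (ld X c (inv_into U c y)) = X"
    by (rule coframe[OF U(1)]) (rule that)
  note this[of "c g" X] this[of "c g" Y]
  ultimately show ?thesis using U by (auto simp: chart_inv)
qed

lemma ld_bracket:
  fixes f :: "'g \<Rightarrow> 'c::euclidean_space"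
  assumes W: "open W" "g \<in> W" and f: "\<And>g. g \<in> W \<Longrightarrow> mfd_smooth_at M f g"
  shows "ld (br X Y) f g = ld X (ld Y f) g - ld Y (ld X f) g"
proof (rule euclidean_eqI)
  fix b :: 'c
  have ev: "\<forall>\<^sub>F h in nhds g. ld Z (\<lambda>h. f h \<bullet> b) h = ld Z f h \<bullet> b" for Z
    using eventually_nhds_in_open[OF W] by eventually_elim (rule ld_inner[OF f])
  have l: "ld Z (ld Z' (\<lambda>h. f h \<bullet> b)) g = ld Z (ld Z' f) g \<bullet> b" for Z Z'
    using ld_cong[OF ev] ld_inner[OF mfd_smooth_at_ld[OF f[OF W(2)]]] by simp
  have "smooth_fun_on M W (\<lambda>h. f h \<bullet> b)"
    using f by (simp add: smooth_fun_on_iff[OF W(1)] mfd_smooth_at_inner)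
  then have "ld (br X Y) (\<lambda>h. f h \<bullet> b) g = ld X (ld Y (\<lambda>h. f h \<bullet> b)) g - ld Y (ld X (\<lambda>h. f h \<bullet> b)) g"
    using has_lie_algebra W unfolding has_lie_algebra_def by blast
  then show "ld (br X Y) f g \<bullet> b = (ld X (ld Y f) g - ld Y (ld X f) g) \<bullet> b"
    by (simp add: l ld_inner[OF f[OF W(2)]] inner_diff_left)
qed

lemma ld_zero_locally_const:
  assumes W: "open W" "g \<in> W" and f: "\<And>h. h \<in> W \<Longrightarrow> mfd_smooth_at M f h"
    and z: "\<And>X h. h \<in> W \<Longrightarrow> ld X f h = 0"
  shows "\<exists>T. open T \<and> g \<in> T \<and> (\<forall>h\<in>T. f g = f h)"
proof -
  obtain U c where U: "(U, c) \<in> M" "g \<in> U" by (rule chart_ex)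
  obtain r where r: "r > 0" "ball (c g) r \<subseteq> c ` (U \<inter> W)"
    using chart_image_Int_open[OF U(1) W(1)] U(2) W(2) by (meson IntI imageI openE)
  have d: "((\<lambda>y. f (inv_into U c y)) has_derivative (\<lambda>v. 0)) (at y)" if "y \<in> c ` (U \<inter> W)" for y
  proof -
    define k where "k = inv_into U c y"
    have k: "k \<in> U" "c k = y" "k \<in> W" using that by (auto simp: k_def chart_inv[OF U(1)])
    have "frechet_derivative (\<lambda>y. f (inv_into U c y)) (at y) v = 0" for v
    proof -
      obtain X where "ld X c k = v" by (rule ld_chart_surj[OF U(1) k(1)])
      then show ?thesis using ld_chart[OF f[OF k(3)] U(1) k(1), of X] z[OF k(3)] k(2) by simp
    qed
    then have "frechet_derivative (\<lambda>y. f (inv_into U c y)) (at y) = (\<lambda>v. 0)" by blast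
    then show ?thesis
      using smooth_at_has_derivative[OF mfd_smooth_atD[OF f[OF k(3)] U(1) k(1)]] k(2) by simp
  qed
  have c: "f (inv_into U c y) = f (inv_into U c (c g))" if "y \<in> ball (c g) r" for y
  proof (rule has_derivative_zero_unique[of "ball (c g) r"])
    show "((\<lambda>y. f (inv_into U c y)) has_derivative (\<lambda>v. 0)) (at y within ball (c g) r)" if "y \<in> ball (c g) r" for y
      using d r that by (meson has_derivative_at_withinI subsetD)
  qed (use r that in auto)
  define T where "T = U \<inter> c -` ball (c g) r"
  have "open T" unfolding T_def
    using chart_open[OF U(1)] homeomorphism_cont1[OF chart_homeomorphism[OF U(1)]]
    by (simp add: continuous_open_preimage)
  moreover have "f g = f h" if "h \<in> T" for h
    using c[of "c h"] that U by (auto simp: T_def chart_inv)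
  moreover have "g \<in> T" using U r by (simp add: T_def)
  ultimately show ?thesis by blast
qed

lemma ld_zero_imp_const:
  assumes con: "connected (UNIV :: 'g set)" and f: "\<And>g. mfd_smooth_at M f g" and z: "\<And>X g. ld X f g = 0"
  shows "f g = f h"
proof -
  have loc: "\<exists>T. open T \<and> g \<in> T \<and> (\<forall>h\<in>T. f g = f h)" for g
    by (rule ld_zero_locally_const[OF open_UNIV UNIV_I f z])
  show ?thesis
  proof (rule connected_local_const[OF con UNIV_I UNIV_I])
    show "\<forall>g\<in>UNIV. \<forall>\<^sub>F h in at g within UNIV. f g = f h"
    proof
      fix g
      obtain T where "open T" "g \<in> T" "\<forall>h\<in>T. f g = f h" using loc by blast
      then show "\<forall>\<^sub>F h in at g within UNIV. f g = f h"
        unfolding eventually_at_topological by blast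
    qed
  qed
qed

end

section \<open>Primitives of closed forms\<close>

text \<open>The primitive is the integral of \<open>\<omega>\<close> along segments from a base
  point \<open>z\<close>. Differentiation under the integral gives an integrand which closedness
  turns into the total derivative of \<open>t \<omega>(p t y) v\<close>.\<close>

lemma poincare:
  fixes \<omega> :: "'e::euclidean_space \<Rightarrow> 'e \<Rightarrow> 'w::euclidean_space"
  assumes S: "open S" "convex S" and lin: "\<And>y. y \<in> S \<Longrightarrow> linear (\<omega> y)"
    and sm: "\<And>y w. y \<in> S \<Longrightarrow> smooth_at (\<lambda>y. \<omega> y w) y"
    and sym: "\<And>y u w. y \<in> S \<Longrightarrow> frechet_derivative (\<lambda>y. \<omega> y w) (at y) u = frechet_derivative (\<lambda>y. \<omega> y u) (at y) w"
  obtains f where "\<And>y. y \<in> S \<Longrightarrow> (f has_derivative \<omega> y) (at y)"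
proof (cases "S = {}")
  case False
  then obtain z where z: "z \<in> S" by blast
  define p where "p t y = z + t *\<^sub>R (y - z)" for t :: real and y
  have pS: "p t y \<in> S" if "y \<in> S" "t \<in> {0..1}" for t y
    using convexD_alt[OF S(2) z that(1), of t] that(2) by (simp add: p_def algebra_simps)
  define D where "D y v w = frechet_derivative (\<lambda>y. \<omega> y w) (at y) v" for y v w
  have dD: "((\<lambda>y. \<omega> y w) has_derivative (\<lambda>v. D y v w)) (at y)" if "y \<in> S" for y w
    unfolding D_def by (rule smooth_at_has_derivative[OF sm[OF that]])
  have Dlin: "linear (\<lambda>v. D y v w)" if "y \<in> S" for y w
    using dD[OF that] has_derivative_linear by blast
  have Dlin2: "linear (\<lambda>w. D y v w)" if "y \<in> S" for y v
    using Dlin[OF that, of v] sym[OF that] by (simp add: D_def)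
  \<comment> \<open>Chain rule with both the base point and the vector moving. It covers the
    derivative in \<open>y\<close> for the Leibniz rule and the derivative in \<open>t\<close> for
    the fundamental theorem.\<close>
  have w\<omega>: "((\<lambda>x. \<omega> (h x) (k x)) has_derivative (\<lambda>v. D (h x) (h' v) (k x) + \<omega> (h x) (k' v))) (at x)"
    if "(h has_derivative h') (at x)" "(k has_derivative k') (at x)" "h x \<in> S"
    for h :: "'b::euclidean_space \<Rightarrow> 'e" and k h' k' x
  proof -
    have ev: "\<forall>\<^sub>F y in nhds x. h y \<in> S"
      using isCont_eventually_open[OF has_derivative_continuous[OF that(1)] S(1) that(3)] .
    have "((\<lambda>x. \<Sum>b\<in>Basis. (k x \<bullet> b) *\<^sub>R \<omega> (h x) b) has_derivative
       (\<lambda>v. \<Sum>b\<in>Basis. (k x \<bullet> b) *\<^sub>R D (h x) (h' v) b + (k' v \<bullet> b) *\<^sub>R \<omega> (h x) b)) (at x)"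
      by (intro has_derivative_sum bounded_bilinear.FDERIV[OF bounded_bilinear_scaleR]
           has_derivative_inner_left that(2) has_derivative_compose[OF that(1) dD[OF that(3)]])
    then have "((\<lambda>x. \<Sum>b\<in>Basis. (k x \<bullet> b) *\<^sub>R \<omega> (h x) b) has_derivative
       (\<lambda>v. D (h x) (h' v) (k x) + \<omega> (h x) (k' v))) (at x)"
      by (simp add: sum.distrib linear_apply_eq_sum_Basis[OF Dlin2[OF that(3)], symmetric]
          linear_apply_eq_sum_Basis[OF lin[OF that(3)], symmetric])
    then show ?thesis
    proof (rule has_derivative_transform_eventually)
      show "\<forall>\<^sub>F y in at x. (\<Sum>b\<in>Basis. (k y \<bullet> b) *\<^sub>R \<omega> (h y) b) = \<omega> (h y) (k y)"
      proof -
        have "\<forall>\<^sub>F y in at x. h y \<in> S" using ev by (auto simp: eventually_at_filter elim: eventually_mono)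
        then show ?thesis by eventually_elim (rule linear_apply_eq_sum_Basis[OF lin, symmetric])
      qed
    qed (simp_all add: linear_apply_eq_sum_Basis[OF lin[OF that(3)], symmetric])
  qed
  define f where "f y = integral (cbox 0 1) (\<lambda>t. \<omega> (p t y) (y - z))" for y
  \<comment> \<open>The \<open>y\<close>-derivative of the integrand, packed as a bounded linear
    map: differentiation under the integral wants it continuous in operator norm, which is then
    checked vector by vector.\<close>
  define F' where "F' y t = Blinfun (\<lambda>v. D (p t y) (t *\<^sub>R v) (y - z) + \<omega> (p t y) v)" for y t
  have bl: "bounded_linear (\<lambda>v. D (p t y) (t *\<^sub>R v) (y - z) + \<omega> (p t y) v)" if "y \<in> S" "t \<in> {0..1}" for y t
    using linear_compose[OF linear_compose_scale_right[OF linear_ident, of t] Dlin[OF pS[OF that]]] lin[OF pS[OF that]]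
    by (simp add: linear_conv_bounded_linear[symmetric] linear_compose_add o_def)
  have F'a: "blinfun_apply (F' y t) = (\<lambda>v. D (p t y) (t *\<^sub>R v) (y - z) + \<omega> (p t y) v)" if "y \<in> S" "t \<in> {0..1}" for y t
    unfolding F'_def by (rule bounded_linear_Blinfun_apply[OF bl[OF that]])
  have cont\<omega>: "continuous_on (S \<times> {0..1}) (\<lambda>(y, t). D (p t y) (t *\<^sub>R v) (y - z) + \<omega> (p t y) v)" for v
  proof -
    have "smooth_at (\<lambda>(y, t). D (p t y) (t *\<^sub>R v) (y - z) + \<omega> (p t y) v) (y, t)" if "y \<in> S" "t \<in> {0..1}" for y t
    proof -
      have P: "smooth_at (\<lambda>x. p (snd x) (fst x)) (y, t)"
        unfolding p_def by (intro smooth_at_add smooth_at_scaleR smooth_at_diff smooth_at_const smooth_at_linear bounded_linear_fst bounded_linear_snd)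
      have S': "p t y \<in> S" by (rule pS[OF that])
      have ev: "\<forall>\<^sub>F x in nhds (y, t). p (snd x) (fst x) \<in> S"
        using isCont_eventually_open[OF smooth_at_isCont[OF P] S(1)] S' by simp
      have "smooth_at (\<lambda>x. D (p (snd x) (fst x)) v w) (y, t)" for w
        unfolding D_def using S'
        by (intro smooth_at_compose[OF _ P, of "\<lambda>y. frechet_derivative (\<lambda>y. \<omega> y w) (at y) v"] smooth_at_frechet_derivative sm) simp
      then have "smooth_at (\<lambda>x. D (p (snd x) (fst x)) v (fst x - z)) (y, t)"
      proof (rule smooth_at_linear_apply[of "\<lambda>x w. D (p (snd x) (fst x)) v w", rotated])
        show "\<forall>\<^sub>F x in nhds (y, t). linear (\<lambda>w. D (p (snd x) (fst x)) v w)"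
          using ev by eventually_elim (rule Dlin2)
        show "smooth_at (\<lambda>x. fst x - z) (y, t)"
          by (rule smooth_at_diff[OF smooth_at_fst[OF smooth_at_id] smooth_at_const])
      qed
      then have "smooth_at (\<lambda>x. snd x *\<^sub>R D (p (snd x) (fst x)) v (fst x - z)) (y, t)"
        by (rule smooth_at_scaleR[OF smooth_at_snd[OF smooth_at_id]])
      moreover have "smooth_at (\<lambda>x. \<omega> (p (snd x) (fst x)) v) (y, t)"
        using S' by (intro smooth_at_compose[OF _ P, of "\<lambda>y. \<omega> y v"] sm) simp
      ultimately have "smooth_at (\<lambda>x. snd x *\<^sub>R D (p (snd x) (fst x)) v (fst x - z) + \<omega> (p (snd x) (fst x)) v) (y, t)"
        by (rule smooth_at_add)
      moreover have "\<forall>\<^sub>F x in nhds (y, t). snd x *\<^sub>R D (p (snd x) (fst x)) v (fst x - z) + \<omega> (p (snd x) (fst x)) v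
         = (\<lambda>(y, t). D (p t y) (t *\<^sub>R v) (y - z) + \<omega> (p t y) v) x"
        using ev by eventually_elim (use linear_cmul[OF Dlin] in \<open>auto simp: case_prod_unfold\<close>)
      ultimately show ?thesis using smooth_at_cong by fast
    qed
    then show ?thesis by (intro continuous_at_imp_continuous_on) (auto intro: smooth_at_isCont)
  qed
  have der: "(f has_derivative \<omega> y) (at y)" if y: "y \<in> S" for y
  proof -
    have "(f has_derivative blinfun_apply (integral (cbox 0 1) (F' y))) (at y within S)"
      unfolding f_def
    proof (rule leibniz_rule[OF _ _ _ y S(2)])
      show "((\<lambda>y. \<omega> (p t y) (y - z)) has_derivative blinfun_apply (F' y t)) (at y within S)"
        if "y \<in> S" "t \<in> cbox 0 1" for y t
      proof -
        have t: "t \<in> {0..1}" using that by simp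
        have d1: "((\<lambda>y. p t y) has_derivative (\<lambda>v. t *\<^sub>R v)) (at y)"
          unfolding p_def by (auto intro!: derivative_eq_intros simp: algebra_simps)
        have d2: "((\<lambda>y. y - z) has_derivative (\<lambda>v. v)) (at y)"
          by (auto intro!: derivative_eq_intros)
        show ?thesis
          unfolding F'a[OF that(1) t] by (rule has_derivative_at_withinI[OF w\<omega>[OF d1 d2 pS[OF that(1) t]]])
      qed
      show "(\<lambda>t. \<omega> (p t y) (y - z)) integrable_on cbox 0 1" if "y \<in> S" for y
      proof (rule integrable_continuous, rule continuous_at_imp_continuous_on, rule ballI)
        fix t :: real assume t: "t \<in> cbox 0 1"
        have "((\<lambda>t. p t y) has_derivative (\<lambda>h. h *\<^sub>R (y - z))) (at t)"
          unfolding p_def by (auto intro!: derivative_eq_intros)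
        from has_derivative_continuous[OF w\<omega>[OF this has_derivative_const[of "y - z"]]]
        show "isCont (\<lambda>t. \<omega> (p t y) (y - z)) t" using pS[OF that] t by simp
      qed
      show "continuous_on (S \<times> cbox 0 1) (\<lambda>(y, t). F' y t)"
      proof (rule continuous_on_blinfun_componentwise)
        fix v :: 'e
        have "continuous_on (S \<times> cbox 0 1) (\<lambda>(y, t). D (p t y) (t *\<^sub>R v) (y - z) + \<omega> (p t y) v)"
          using cont\<omega> by simp
        then show "continuous_on (S \<times> cbox 0 1) (\<lambda>x. blinfun_apply (case x of (y, t) \<Rightarrow> F' y t) v)"
          by (rule continuous_on_eq) (auto simp: F'a)
      qed
    qed
    moreover have "blinfun_apply (integral (cbox 0 1) (F' y)) v = \<omega> y v" for v
    proof -
      have "continuous_on (cbox 0 1) (F' y)"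
      proof (rule continuous_on_blinfun_componentwise)
        fix v :: 'e
        have "continuous_on (cbox 0 1) (\<lambda>t. (\<lambda>(y, t). D (p t y) (t *\<^sub>R v) (y - z) + \<omega> (p t y) v) (y, t))"
          by (rule continuous_on_compose2[OF cont\<omega>]) (use y in \<open>auto intro!: continuous_intros\<close>)
        then show "continuous_on (cbox 0 1) (\<lambda>t. blinfun_apply (F' y t) v)"
          by (rule continuous_on_eq) (use y in \<open>auto simp: F'a\<close>)
      qed
      then have i: "F' y integrable_on cbox 0 1" by (rule integrable_continuous)
      have "blinfun_apply (integral (cbox 0 1) (F' y)) v = integral (cbox 0 1) (\<lambda>t. blinfun_apply (F' y t) v)"
        by (rule blinfun_apply_integral[OF i])
      also have "\<dots> = integral {0..1} (\<lambda>t. D (p t y) (t *\<^sub>R v) (y - z) + \<omega> (p t y) v)"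
        by (rule integral_cong[THEN trans]) (use y in \<open>auto simp: F'a\<close>)
      also have "\<dots> = 1 *\<^sub>R \<omega> (p 1 y) v - 0 *\<^sub>R \<omega> (p 0 y) v"
      proof (rule integral_unique, rule fundamental_theorem_of_calculus)
        fix t :: real assume t: "t \<in> {0..1}"
        have pt: "p t y \<in> S" by (rule pS[OF y t])
        have d: "((\<lambda>t. p t y) has_derivative (\<lambda>h. h *\<^sub>R (y - z))) (at t)"
          unfolding p_def by (auto intro!: derivative_eq_intros)
        have "((\<lambda>t. t *\<^sub>R \<omega> (p t y) v) has_derivative (\<lambda>h. t *\<^sub>R (D (p t y) (h *\<^sub>R (y - z)) v + \<omega> (p t y) 0) + h *\<^sub>R \<omega> (p t y) v)) (at t)"
          by (rule bounded_bilinear.FDERIV[OF bounded_bilinear_scaleR has_derivative_ident w\<omega>[OF d has_derivative_const[of v] pt]])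
        \<comment> \<open>This is where \<open>d\<omega> = 0\<close> enters: the roles of the test
          vector \<open>v\<close> and of the direction \<open>y - z\<close> of the segment are
          exchanged.\<close>
        moreover have "D (p t y) (h *\<^sub>R (y - z)) v = h *\<^sub>R D (p t y) v (y - z)" for h
          using sym[OF pt, of v "y - z"] by (simp add: linear_cmul[OF Dlin[OF pt]]) (simp add: D_def)
        moreover have "D (p t y) (t *\<^sub>R v) (y - z) = t *\<^sub>R D (p t y) v (y - z)"
          by (simp add: linear_cmul[OF Dlin[OF pt]])
        ultimately have "((\<lambda>t. t *\<^sub>R \<omega> (p t y) v) has_derivative (\<lambda>h. h *\<^sub>R (D (p t y) (t *\<^sub>R v) (y - z) + \<omega> (p t y) v))) (at t)"
          by (simp add: linear_0[OF lin[OF pt]] scaleR_add_right mult.commute)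
        then show "((\<lambda>t. t *\<^sub>R \<omega> (p t y) v) has_vector_derivative D (p t y) (t *\<^sub>R v) (y - z) + \<omega> (p t y) v) (at t within {0..1})"
          unfolding has_vector_derivative_def by (rule has_derivative_at_withinI)
      qed simp
      finally show ?thesis by (simp add: p_def)
    qed
    then have "blinfun_apply (integral (cbox 0 1) (F' y)) = \<omega> y" by blast
    ultimately show ?thesis using at_within_open[OF y S(1)] by simp
  qed
  then show thesis by (rule that)
qed (use that in auto)

context lie_group_frame
begin

text \<open>The hypothesis \<open>closed\<close> is Cartan's formula for \<open>dF = 0\<close>,
  evaluated on left invariant fields. A coframe rewrites \<open>F\<close> as a one-form in a chart,
  where the Poincare lemma applies on a ball.\<close>

lemma local_primitive:
  fixes F :: "'l \<Rightarrow> 'g \<Rightarrow> 'w::euclidean_space"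
  assumes sm: "\<And>X g. mfd_smooth_at M (F X) g" and lin: "\<And>g. linear (\<lambda>X. F X g)"
    and closed: "\<And>X Y g. ld X (F Y) g - ld Y (F X) g = F (br X Y) g"
  obtains U f where "open U" "g0 \<in> U" "path_connected U"
    "\<And>g. g \<in> U \<Longrightarrow> mfd_smooth_at M f g" "\<And>g X. g \<in> U \<Longrightarrow> ld X f g = F X g"
proof -
  obtain U c where U: "(U, c) \<in> M" "g0 \<in> U" by (rule chart_ex)
  obtain \<theta> :: "'e \<Rightarrow> 'e \<Rightarrow> 'l" where th:
    "\<And>y. y \<in> c ` U \<Longrightarrow> linear (\<theta> y)"
    "\<And>y X. y \<in> c ` U \<Longrightarrow> \<theta> y (ld X c (inv_into U c y)) = X"
    "\<And>y w. y \<in> c ` U \<Longrightarrow> ld (\<theta> y w) c (inv_into U c y) = w"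
    "\<And>y w. y \<in> c ` U \<Longrightarrow> smooth_at (\<lambda>y. \<theta> y w) y"
    by (rule coframe[OF U(1)]) (rule that)
  define \<omega> where "\<omega> y w = F (\<theta> y w) (inv_into U c y)" for y w
  have sF: "smooth_at (\<lambda>y. F X (inv_into U c y)) y" if "y \<in> c ` U" for X y
    by (rule mfd_smooth_at_plot[OF sm plot_chart_inv[OF U(1) that]])
  have lin\<omega>: "linear (\<omega> y)" if "y \<in> c ` U" for y
    using linear_compose[OF th(1)[OF that] lin] by (simp add: \<omega>_def[abs_def] o_def)
  have sm\<omega>: "smooth_at (\<lambda>y. \<omega> y w) y" if "y \<in> c ` U" for y w
    unfolding \<omega>_def
    by (rule smooth_at_linear_apply[where L="\<lambda>y X. F X (inv_into U c y)" and f="\<lambda>y. \<theta> y w"])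
      (use lin sF[OF that] th(4)[OF that] in auto)
  define e where "e X y = ld X c (inv_into U c y)" for X y
  have se: "smooth_at (e X) y" if "y \<in> c ` U" for X y
    unfolding e_def by (rule smooth_at_ld_plot[OF mfd_smooth_at_chart[OF U(1) chart_inv_mem[OF U(1) that]] plot_chart_inv[OF U(1) that]])
  have \<omega>e: "\<omega> y (e X y) = F X (inv_into U c y)" if "y \<in> c ` U" for X y
    by (simp add: \<omega>_def e_def th(2)[OF that])
  have esurj: "e (\<theta> y w) y = w" if "y \<in> c ` U" for w y by (simp add: e_def th(3)[OF that])
  define D where "D y v w = frechet_derivative (\<lambda>y. \<omega> y w) (at y) v" for y v w
  \<comment> \<open>Product rule for \<open>F X = \<omega>(e X)\<close>. The second summand contains
    second derivatives of the chart and is not symmetric in \<open>X\<close> and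
    \<open>Y\<close>.\<close>
  have ldF: "ld Y (F X) (inv_into U c y) = D y (e Y y) (e X y) + \<omega> y (ld Y (ld X c) (inv_into U c y))"
    if y: "y \<in> c ` U" for X Y y
  proof -
    define g where "g = inv_into U c y"
    have g: "g \<in> U" "c g = y" using chart_inv_mem chart_apply_inv U(1) that by (auto simp: g_def)
    have A: "((\<lambda>y. \<Sum>b\<in>Basis. (e X y \<bullet> b) *\<^sub>R \<omega> y b) has_derivative
       (\<lambda>v. \<Sum>b\<in>Basis. (e X y \<bullet> b) *\<^sub>R D y v b + (frechet_derivative (e X) (at y) v \<bullet> b) *\<^sub>R \<omega> y b)) (at y)"
      unfolding D_def
      by (intro has_derivative_sum bounded_bilinear.FDERIV[OF bounded_bilinear_scaleR]
           has_derivative_inner_left smooth_at_has_derivative sm\<omega> se y)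
    have ev: "\<forall>\<^sub>F y in nhds y. (\<Sum>b\<in>Basis. (e X y \<bullet> b) *\<^sub>R \<omega> y b) = F X (inv_into U c y)"
      using chart_eventually_mem[OF U(1) g(1)] unfolding g(2)
      by eventually_elim (simp add: linear_apply_eq_sum_Basis[OF lin\<omega>, symmetric] \<omega>e)
    have "frechet_derivative (\<lambda>y. F X (inv_into U c y)) (at y) =
      (\<lambda>v. \<Sum>b\<in>Basis. (e X y \<bullet> b) *\<^sub>R D y v b + (frechet_derivative (e X) (at y) v \<bullet> b) *\<^sub>R \<omega> y b)"
      using trans[OF frechet_derivative_cong[OF ev, symmetric] frechet_derivative_at[OF A, symmetric]] .
    moreover have "linear (D y v)" for v
    proof (rule linearI)
      have d: "((\<lambda>y. \<omega> y w) has_derivative (\<lambda>v. D y v w)) (at y)" for w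
        unfolding D_def by (rule smooth_at_has_derivative[OF sm\<omega>[OF y]])
      have ev: "\<forall>\<^sub>F y in nhds y. y \<in> c ` U" using chart_eventually_mem[OF U(1) g(1)] unfolding g(2) .
      show "D y v (a + b) = D y v a + D y v b" for a b
      proof -
        have "\<forall>\<^sub>F y in nhds y. \<omega> y (a + b) = \<omega> y a + \<omega> y b"
          using ev by eventually_elim (rule linear_add[OF lin\<omega>])
        from fun_cong[OF frechet_derivative_cong[OF this], of v] show ?thesis
          using fun_cong[OF frechet_derivative_at[OF has_derivative_add[OF d[of a] d[of b]]], of v] by (simp add: D_def[of y v "a + b"])
      qed
      show "D y v (r *\<^sub>R a) = r *\<^sub>R D y v a" for a r
      proof -
        have "\<forall>\<^sub>F y in nhds y. \<omega> y (r *\<^sub>R a) = r *\<^sub>R \<omega> y a"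
          using ev by eventually_elim (rule linear_cmul[OF lin\<omega>])
        from fun_cong[OF frechet_derivative_cong[OF this], of v] show ?thesis
          using fun_cong[OF frechet_derivative_at[OF has_derivative_scaleR_right[OF d[of a], of r]], of v] by (simp add: D_def[of y v "r *\<^sub>R a"])
      qed
    qed
    ultimately have "frechet_derivative (\<lambda>y. F X (inv_into U c y)) (at y) v =
      D y v (e X y) + \<omega> y (frechet_derivative (e X) (at y) v)" for v
      by (simp add: sum.distrib linear_apply_eq_sum_Basis[OF lin\<omega>[OF y], symmetric] linear_apply_eq_sum_Basis[of "D y v", symmetric])
    moreover have "ld Y (F X) g = frechet_derivative (\<lambda>y. F X (inv_into U c y)) (at y) (e Y y)"
      using ld_chart[OF sm U(1) g(1), of Y X] g by (simp add: e_def g_def)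
    moreover have "ld Y (ld X c) g = frechet_derivative (e X) (at y) (e Y y)"
      using ld_chart[OF mfd_smooth_at_ld[OF mfd_smooth_at_chart[OF U(1) g(1)]] U(1) g(1), of Y X] g
      by (simp add: e_def[abs_def] g_def)
    ultimately show ?thesis by (simp add: g_def)
  qed
  \<comment> \<open>Antisymmetrising \<open>ldF\<close>, the second derivatives combine to the
    bracket and give \<open>F (br X Y)\<close>. By \<open>closed\<close> this cancels, and what
    remains is the symmetry of \<open>D\<close>.\<close>
  have sym: "D y u w = D y w u" if y: "y \<in> c ` U" for y u w
  proof -
    define g where "g = inv_into U c y"
    have g: "g \<in> U" "c g = y" using chart_inv_mem chart_apply_inv U(1) that by (auto simp: g_def)
    define X Y where "X = \<theta> y u" "Y = \<theta> y w"
    have "ld (br X Y) c g = ld X (ld Y c) g - ld Y (ld X c) g"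
      by (rule ld_bracket[OF chart_open[OF U(1)] g(1)]) (rule mfd_smooth_at_chart[OF U(1)])
    then have "\<omega> y (ld X (ld Y c) g) - \<omega> y (ld Y (ld X c) g) = F (br X Y) g"
      using \<omega>e[OF y, of "br X Y"] by (simp add: e_def g_def linear_diff[OF lin\<omega>[OF y]])
    with closed[of X Y g] ldF[OF y, of X Y] ldF[OF y, of Y X]
    show ?thesis by (simp add: X_Y_def esurj[OF y] g_def algebra_simps)
  qed
  obtain r where r: "r > 0" "ball (c g0) r \<subseteq> c ` U"
    using chart_image_open[OF U(1)] U(2) by (meson imageI openE)
  define S where "S = ball (c g0) r"
  have SU: "y \<in> c ` U" if "y \<in> S" for y using r that by (auto simp: S_def)
  have S: "open S" "convex S" by (auto simp: S_def)
  obtain f where f: "\<And>y. y \<in> S \<Longrightarrow> (f has_derivative \<omega> y) (at y)"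
  proof (rule poincare[OF S, of \<omega>])
    show "frechet_derivative (\<lambda>y. \<omega> y w) (at y) u = frechet_derivative (\<lambda>y. \<omega> y u) (at y) w" if "y \<in> S" for y u w
      using sym[OF SU[OF that], of u w] by (simp add: D_def)
  qed (use SU lin\<omega> sm\<omega> that in auto)
  have "Ck_on k S (\<lambda>y. \<omega> y w)" for k w
  proof -
    have "smooth_on S (\<lambda>y. \<omega> y w)"
      unfolding smooth_on_iff_smooth_at[OF S(1)] using sm\<omega>[OF SU] by blast
    then show ?thesis by (simp add: smooth_on_def)
  qed
  then have "Ck_on k S f" for k
    using Ck_on_SucD[OF Ck_on_SucI[OF S(1) f]] by blast
  then have sf: "smooth_at f y" if "y \<in> S" for y
    using S(1) that unfolding smooth_at_def smooth_on_def by blast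
  define U' where "U' = inv_into U c ` S"
  have hom: "homeomorphism U (c ` U) c (inv_into U c)" by (rule chart_homeomorphism[OF U(1)])
  have U'e: "U' = U \<inter> c -` S"
  proof
    show "U' \<subseteq> U \<inter> c -` S" using SU chart_inv_mem[OF U(1)] chart_apply_inv[OF U(1)] by (auto simp: U'_def)
    show "U \<inter> c -` S \<subseteq> U'"
    proof
      fix g assume "g \<in> U \<inter> c -` S"
      then show "g \<in> U'" using chart_inv[OF U(1), of g] unfolding U'_def by (metis IntD1 IntD2 imageI vimageD)
    qed
  qed
  show thesis
  proof (rule that[of U' "\<lambda>g. f (c g)"])
    show "open U'" unfolding U'e
      using chart_open[OF U(1)] homeomorphism_cont1[OF hom] S(1) by (simp add: continuous_open_preimage)
    show "g0 \<in> U'" using U r by (simp add: U'e S_def)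
    have "path_connected S" using convex_imp_path_connected S(2) by blast
    moreover have "continuous_on S (inv_into U c)"
      using homeomorphism_cont2[OF hom] SU continuous_on_subset by blast
    ultimately show "path_connected U'" unfolding U'_def by (rule path_connected_continuous_image[rotated])
    fix g assume "g \<in> U'"
    then have g: "g \<in> U" "c g \<in> S" by (auto simp: U'e)
    show s: "mfd_smooth_at M (\<lambda>g. f (c g)) g"
      by (rule mfd_smooth_at_compose[OF sf[OF g(2)] mfd_smooth_at_chart[OF U(1) g(1)]])
    fix X
    have "((\<lambda>x. f (c (g \<odot> \<eta> x))) has_derivative (\<lambda>X. \<omega> (c g) (ld X c g))) (at 0)"
      using has_derivative_compose[OF has_derivative_ld[OF mfd_smooth_at_chart[OF U(1) g(1)]], of f "\<omega> (c g)"] f[OF g(2)]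
      by simp
    then have "ld X (\<lambda>g. f (c g)) g = \<omega> (c g) (ld X c g)" by (rule ldI)
    also have "\<dots> = F X g" using \<omega>e[OF SU[OF g(2)], of X] by (simp add: e_def chart_inv[OF U(1) g(1)])
    finally show "ld X (\<lambda>g. f (c g)) g = F X g" .
  qed
qed

end

section \<open>Monodromy and gluing of local primitives\<close>

lemma simply_connected_path:
  assumes "simply_connected (UNIV :: 'x::topological_space set)"
  shows "\<exists>\<gamma>. path \<gamma> \<and> \<gamma> 0 = (x :: 'x) \<and> \<gamma> 1 = y"
proof -
  \<comment> \<open>Simple connectedness is stated as free homotopy of any two loops. Applied to two
    constant loops, the track of the base point is a path between them.\<close>
  have "homotopic_loops UNIV (\<lambda>_. x) (\<lambda>_. y)"
    using assms unfolding simply_connected_def by (auto simp: pathstart_def pathfinish_def path_def)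
  then obtain h where h: "continuous_on ({0..1::real} \<times> {0..1::real}) h" "\<forall>s\<in>{0..1}. h (0, s) = x"
    "\<forall>s\<in>{0..1}. h (1, s) = y"
    unfolding homotopic_loops by blast
  have "path (\<lambda>t. h (t, 0))" unfolding path_def
    by (rule continuous_on_compose2[OF h(1)]) (auto intro!: continuous_intros)
  then show ?thesis using h by (intro exI[of _ "\<lambda>t. h (t, 0)"]) auto
qed

text \<open>
  In the application \<open>P\<close> consists of the local primitives of a closed form. Lifts stand for path and
  homotopy lifting to the covering space of germs of primitives, which is not available as a type.
\<close>

locale local_system =
  fixes P :: "('x::topological_space set \<times> ('x \<Rightarrow> 'w::real_vector)) set"
  assumes P_open: "(U, f) \<in> P \<Longrightarrow> open U"
    and P_cover: "\<exists>(U, f)\<in>P. x \<in> U"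
    and P_compat: "(U, f) \<in> P \<Longrightarrow> (V, g) \<in> P \<Longrightarrow> x \<in> U \<Longrightarrow> x \<in> V \<Longrightarrow>
      \<exists>N. open N \<and> x \<in> N \<and> (\<forall>y\<in>N. f y - g y = f x - g x)"
begin

text \<open>A lift of \<open>H\<close> to germs of primitives is recorded by its values alone: over
  \<open>H p\<close>, primitives differ by constants, so their germs are told apart by the value
  there.\<close>

definition lifts :: "('p::topological_space \<Rightarrow> 'x) \<Rightarrow> 'p set \<Rightarrow> ('p \<Rightarrow> 'w) \<Rightarrow> bool" where
  "lifts H S \<phi> \<longleftrightarrow> (\<forall>p\<in>S. \<forall>U f. (U, f) \<in> P \<and> H p \<in> U \<longrightarrow>
     (\<exists>N. open N \<and> p \<in> N \<and> (\<forall>q\<in>S \<inter> N. \<phi> q - f (H q) = \<phi> p - f (H p))))"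

lemma liftsD:
  assumes "lifts H S \<phi>" "p \<in> S" "(U, f) \<in> P" "H p \<in> U"
  shows "\<exists>N. open N \<and> p \<in> N \<and> (\<forall>q\<in>S \<inter> N. \<phi> q - f (H q) = \<phi> p - f (H p))"
  using assms unfolding lifts_def by simp

lemma lifts_local:
  assumes "(U, f) \<in> P" "continuous_on S H" "\<And>p. p \<in> S \<Longrightarrow> H p \<in> U"
  shows "lifts H S (\<lambda>p. f (H p))"
  unfolding lifts_def
proof (intro ballI allI impI, elim conjE)
  fix p V g assume p: "p \<in> S" and V: "(V, g) \<in> P" "H p \<in> V"
  obtain N where N: "open N" "H p \<in> N" "\<forall>y\<in>N. f y - g y = f (H p) - g (H p)"
    using P_compat[OF assms(1) V(1) assms(3)[OF p] V(2)] by blast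
  obtain A where "open A" "p \<in> A" "\<forall>y\<in>S. y \<in> A \<longrightarrow> H y \<in> N"
    using assms(2) p N(1,2) unfolding continuous_on_topological by blast
  then show "\<exists>N. open N \<and> p \<in> N \<and> (\<forall>q\<in>S \<inter> N. f (H q) - g (H q) = f (H p) - g (H p))"
    using N(3) by (intro exI[of _ A]) auto
qed

lemma lifts_compose:
  assumes l: "lifts H S \<phi>" and k: "continuous_on T k" "\<And>p. p \<in> T \<Longrightarrow> k p \<in> S"
    and e: "\<And>p. p \<in> T \<Longrightarrow> H' p = H (k p)"
  shows "lifts H' T (\<lambda>p. \<phi> (k p))"
  unfolding lifts_def
proof (intro ballI allI impI, elim conjE)
  fix p V g assume p: "p \<in> T" and V: "(V, g) \<in> P" "H' p \<in> V"
  obtain N where N: "open N" "k p \<in> N" "\<forall>q\<in>S \<inter> N. \<phi> q - g (H q) = \<phi> (k p) - g (H (k p))"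
    using liftsD[OF l k(2)[OF p] V(1)] V(2) unfolding e[OF p] by blast
  obtain A where A: "open A" "p \<in> A" "\<forall>y\<in>T. y \<in> A \<longrightarrow> k y \<in> N"
    using k(1) p N(1,2) unfolding continuous_on_topological by blast
  have "\<phi> (k q) - g (H' q) = \<phi> (k p) - g (H' p)" if "q \<in> T" "q \<in> A" for q
    using bspec[OF N(3), of "k q"] A(3) that k(2)[OF that(1)] unfolding e[OF p] e[OF that(1)] by blast
  with A(1,2) show "\<exists>N. open N \<and> p \<in> N \<and> (\<forall>q\<in>T \<inter> N. \<phi> (k q) - g (H' q) = \<phi> (k p) - g (H' p))"
    by blast
qed

lemma lifts_subset: "lifts H S \<phi> \<Longrightarrow> T \<subseteq> S \<Longrightarrow> lifts H T \<phi>"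
  by (rule lifts_compose[of H S \<phi> T "\<lambda>p. p" H]) (auto simp: continuous_on_id)

text \<open>Uniqueness of lifts up to a deck transformation, which here is the addition of a
  constant.\<close>

lemma lifts_diff_const:
  assumes l: "lifts H S \<phi>" "lifts H S \<psi>" and "connected S" "p \<in> S" "q \<in> S"
  shows "\<phi> p - \<psi> p = \<phi> q - \<psi> q"
proof (rule connected_local_const[OF assms(3-5)], rule ballI)
  fix a assume a: "a \<in> S"
  obtain U f where U: "(U, f) \<in> P" "H a \<in> U" using P_cover[of "H a"] by blast
  obtain N where N: "open N" "a \<in> N" "\<forall>q\<in>S \<inter> N. \<phi> q - f (H q) = \<phi> a - f (H a)"
    using liftsD[OF l(1) a U] by blast
  obtain N' where N': "open N'" "a \<in> N'" "\<forall>q\<in>S \<inter> N'. \<psi> q - f (H q) = \<psi> a - f (H a)"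
    using liftsD[OF l(2) a U] by blast
  have "\<phi> a - \<psi> a = \<phi> b - \<psi> b" if "b \<in> N \<inter> N'" "b \<in> S" for b
  proof -
    have "(\<phi> b - f (H b)) - (\<psi> b - f (H b)) = (\<phi> a - f (H a)) - (\<psi> a - f (H a))"
      using N(3) N'(3) that by simp
    then show ?thesis by simp
  qed
  moreover have "open (N \<inter> N')" "a \<in> N \<inter> N'" using N N' by auto
  ultimately show "\<forall>\<^sub>F b in at a within S. \<phi> a - \<psi> a = \<phi> b - \<psi> b"
    unfolding eventually_at_topological by blast
qed

text \<open>Connectedness of the overlap makes the two lifts differ there by one constant, and
  shifting the second lift by it makes them agree.\<close>

lemma lifts_glue:
  assumes l: "lifts H S \<phi>" "lifts H T \<psi>" and cl: "closed S" "closed T" and con: "connected (S \<inter> T)"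
  obtains \<xi> where "lifts H (S \<union> T) \<xi>"
proof -
  obtain c where c: "\<And>p. p \<in> S \<inter> T \<Longrightarrow> \<phi> p = \<psi> p + c"
  proof (cases "S \<inter> T = {}")
    case False
    then obtain z where z: "z \<in> S \<inter> T" by blast
    show thesis
    proof (rule that[of "\<phi> z - \<psi> z"])
      fix p assume p: "p \<in> S \<inter> T"
      have "\<phi> p - \<psi> p = \<phi> z - \<psi> z"
        by (rule lifts_diff_const[OF lifts_subset[OF l(1)] lifts_subset[OF l(2)] con p z]) auto
      then show "\<phi> p = \<psi> p + (\<phi> z - \<psi> z)" by (simp add: algebra_simps)
    qed
  qed (use that in blast)
  define \<xi> where "\<xi> p = (if p \<in> S then \<phi> p else \<psi> p + c)" for p
  have \<xi>: "p \<in> S \<Longrightarrow> \<xi> p = \<phi> p" "p \<in> T \<Longrightarrow> \<xi> p = \<psi> p + c" for p using c by (auto simp: \<xi>_def)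
  have "lifts H (S \<union> T) \<xi>"
    unfolding lifts_def
  proof (intro ballI allI impI, elim conjE)
    fix p U f assume p: "p \<in> S \<union> T" and U: "(U, f) \<in> P" "H p \<in> U"
    obtain N where N: "open N" "p \<in> N" "\<And>q. q \<in> S \<Longrightarrow> q \<in> N \<Longrightarrow> \<xi> q - f (H q) = \<xi> p - f (H p)"
    proof (cases "p \<in> S")
      case True
      obtain N where N: "open N" "p \<in> N" "\<forall>q\<in>S \<inter> N. \<phi> q - f (H q) = \<phi> p - f (H p)"
        using liftsD[OF l(1) True U] by blast
      show thesis
      proof (rule that[OF N(1,2)])
        fix q assume q: "q \<in> S" "q \<in> N"
        have "\<phi> q - f (H q) = \<phi> p - f (H p)" using N(3) q by blast
        then show "\<xi> q - f (H q) = \<xi> p - f (H p)"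
          unfolding \<xi>(1)[OF True] \<xi>(1)[OF q(1)] by (simp add: algebra_simps)
      qed
    \<comment> \<open>Off the closed set \<open>S\<close> there is nothing to check near
      \<open>p\<close>, so its complement serves as neighbourhood.\<close>
    qed (use that[of "- S"] cl in auto)
    obtain N' where N': "open N'" "p \<in> N'" "\<And>q. q \<in> T \<Longrightarrow> q \<in> N' \<Longrightarrow> \<xi> q - f (H q) = \<xi> p - f (H p)"
    proof (cases "p \<in> T")
      case True
      obtain N where N: "open N" "p \<in> N" "\<forall>q\<in>T \<inter> N. \<psi> q - f (H q) = \<psi> p - f (H p)"
        using liftsD[OF l(2) True U] by blast
      show thesis
      proof (rule that[OF N(1,2)])
        fix q assume q: "q \<in> T" "q \<in> N"
        have "\<psi> q - f (H q) = \<psi> p - f (H p)" using N(3) q by blast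
        then show "\<xi> q - f (H q) = \<xi> p - f (H p)"
          unfolding \<xi>(2)[OF True] \<xi>(2)[OF q(1)] by (simp add: algebra_simps)
      qed
    qed (use that[of "- T"] cl in auto)
    show "\<exists>N. open N \<and> p \<in> N \<and> (\<forall>q\<in>(S \<union> T) \<inter> N. \<xi> q - f (H q) = \<xi> p - f (H p))"
      using N N' by (intro exI[of _ "N \<inter> N'"]) auto
  qed
  then show thesis by (rule that)
qed

text \<open>Bisection in place of a Lebesgue number, once in each direction: horizontal strips are
  assembled from short pieces that \<open>H\<close> maps into one member of \<open>P\<close>, then
  strips are stacked. All overlaps are segments or thin rectangles, hence connected.\<close>

lemma lifts_rectangle:
  fixes H :: "real \<times> real \<Rightarrow> 'x"
  assumes H: "continuous_on UNIV H" and "a \<le> b" "c \<le> d"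
  obtains \<phi> where "lifts H ({a..b} \<times> {c..d}) \<phi>"
proof -
  \<comment> \<open>The thickness of the strip is part of the bisected property: joining two pieces
    takes the smaller of the two thicknesses.\<close>
  have strip: "\<exists>e>0. \<exists>\<phi>. lifts H ({a..b} \<times> {t-e..t+e}) \<phi>" for t
    using \<open>a \<le> b\<close>
  proof (induction rule: Bolzano)
    case (trans a b c)
    obtain e1 \<phi> where 1: "e1 > 0" "lifts H ({a..b} \<times> {t-e1..t+e1}) \<phi>" using trans by blast
    obtain e2 \<psi> where 2: "e2 > 0" "lifts H ({b..c} \<times> {t-e2..t+e2}) \<psi>" using trans by blast
    define e where "e = min e1 e2"
    have e: "e > 0" "e \<le> e1" "e \<le> e2" using 1 2 by (auto simp: e_def)
    have "lifts H ({a..b} \<times> {t-e..t+e}) \<phi>" "lifts H ({b..c} \<times> {t-e..t+e}) \<psi>"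
      using e by (auto intro: lifts_subset[OF 1(2)] lifts_subset[OF 2(2)])
    moreover have "{a..b} \<times> {t-e..t+e} \<inter> {b..c} \<times> {t-e..t+e} = {b} \<times> {t-e..t+e}"
      using trans(3,4) by auto
    then have "connected ({a..b} \<times> {t-e..t+e} \<inter> {b..c} \<times> {t-e..t+e})"
      by (simp add: connected_Times)
    ultimately obtain \<xi> where "lifts H ({a..b} \<times> {t-e..t+e} \<union> {b..c} \<times> {t-e..t+e}) \<xi>"
      using lifts_glue[OF _ _ closed_Times[OF closed_atLeastAtMost closed_atLeastAtMost]
        closed_Times[OF closed_atLeastAtMost closed_atLeastAtMost]] by blast
    moreover have "{a..b} \<times> {t-e..t+e} \<union> {b..c} \<times> {t-e..t+e} = {a..c} \<times> {t-e..t+e}"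
      using trans(3,4) by auto
    ultimately show ?case using e by auto
  next
    case (local s)
    obtain U f where U: "(U, f) \<in> P" "H (s, t) \<in> U" using P_cover[of "H (s, t)"] by blast
    have "open (H -` U)" using H P_open[OF U(1)] by (simp add: open_vimage)
    moreover have "(s, t) \<in> H -` U" using U by simp
    ultimately obtain A B where AB: "open A" "open B" "s \<in> A" "t \<in> B" "A \<times> B \<subseteq> H -` U"
      by (elim open_prod_elim) auto
    obtain r where r: "r > 0" "ball s r \<subseteq> A" using AB openE by blast
    obtain e where e: "e > 0" "cball t e \<subseteq> B" using AB open_contains_cball by blast
    have "lifts H ({a..b} \<times> {t-e..t+e}) (\<lambda>p. f (H p))" if "a \<le> s" "s \<le> b" "b - a < r" for a b
    proof (rule lifts_local[OF U(1)])
      show "continuous_on ({a..b} \<times> {t-e..t+e}) H" using H continuous_on_subset by blast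
      fix p assume "p \<in> {a..b} \<times> {t-e..t+e}"
      then have "fst p \<in> ball s r" "snd p \<in> cball t e" using that by (auto simp: dist_real_def)
      then have "p \<in> A \<times> B" using r e by (cases p) auto
      then show "H p \<in> U" using AB by auto
    qed
    then show ?case using r(1) e(1) by blast
  qed
  have "\<exists>\<phi>. lifts H ({a..b} \<times> {c..d}) \<phi>"
    using \<open>c \<le> d\<close>
  proof (induction rule: Bolzano)
    case (trans c d e)
    obtain \<phi> \<psi> where "lifts H ({a..b} \<times> {c..d}) \<phi>" "lifts H ({a..b} \<times> {d..e}) \<psi>" using trans by blast
    moreover have "{a..b} \<times> {c..d} \<inter> {a..b} \<times> {d..e} = {a..b} \<times> {d}"
      using trans(3,4) by auto
    then have "connected ({a..b} \<times> {c..d} \<inter> {a..b} \<times> {d..e})"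
      by (simp add: connected_Times)
    ultimately obtain \<xi> where "lifts H ({a..b} \<times> {c..d} \<union> {a..b} \<times> {d..e}) \<xi>"
      using lifts_glue[OF _ _ closed_Times[OF closed_atLeastAtMost closed_atLeastAtMost]
        closed_Times[OF closed_atLeastAtMost closed_atLeastAtMost]] by blast
    moreover have "{a..b} \<times> {c..d} \<union> {a..b} \<times> {d..e} = {a..b} \<times> {c..e}"
      using trans(3,4) by auto
    ultimately show ?case by auto
  next
    case (local t)
    obtain e \<phi> where e: "e > 0" "lifts H ({a..b} \<times> {t-e..t+e}) \<phi>" using strip by blast
    have "lifts H ({a..b} \<times> {c..d}) \<phi>" if "c \<le> t" "t \<le> d" "d - c < e" for c d
      by (rule lifts_subset[OF e(2)]) (use that in auto)
    then show ?case using e(1) by blast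
  qed
  then show thesis using that by blast
qed

text \<open>Retracts the plane to the unit square coordinatewise, so that a homotopy extends
  continuously to the domain that \<open>lifts_rectangle\<close> expects.\<close>

definition clip :: "real \<Rightarrow> real" where "clip s = max 0 (min 1 s)"

lemma clip: "clip s \<in> {0..1}" "s \<in> {0..1} \<Longrightarrow> clip s = s" "continuous_on S clip"
  by (auto simp: clip_def[abs_def] intro!: continuous_intros)

lemma lifts_square:
  fixes h :: "real \<times> real \<Rightarrow> 'x"
  assumes "continuous_on ({0..1} \<times> {0..1}) h"
  obtains \<phi> where "lifts h ({0..1} \<times> {0..1}) \<phi>"
proof -
  have "continuous_on UNIV (\<lambda>p. h (clip (fst p), clip (snd p)))"
    by (rule continuous_on_compose2[OF assms])
      (use clip(1) in \<open>auto intro!: continuous_on_Pair continuous_on_compose2[OF clip(3)[of UNIV]] continuous_intros\<close>)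
  then obtain \<phi> where "lifts (\<lambda>p. h (clip (fst p), clip (snd p))) ({0..1} \<times> {0..1}) \<phi>"
    by (rule lifts_rectangle[of _ 0 1 0 1]) auto
  then have "lifts h ({0..1} \<times> {0..1}) (\<lambda>p. \<phi> p)"
    by (rule lifts_compose[where k="\<lambda>p. p"]) (auto simp: clip(2) continuous_on_id)
  then show thesis by (rule that)
qed

lemma lifts_path:
  assumes "path \<gamma>"
  obtains \<phi> where "lifts \<gamma> {0..1} \<phi>"
proof -
  have "continuous_on ({0..1} \<times> {0..1::real}) (\<lambda>p. \<gamma> (fst p))"
    using assms unfolding path_def
    by (rule continuous_on_compose2) (auto intro!: continuous_intros)
  then obtain \<phi> where "lifts (\<lambda>p. \<gamma> (fst p)) ({0..1} \<times> {0..1::real}) \<phi>"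
    by (rule lifts_square)
  then have "lifts \<gamma> {0..1} (\<lambda>s. \<phi> (s, 0))"
    by (rule lifts_compose) (auto intro!: continuous_intros)
  then show thesis by (rule that)
qed

text \<open>Lift a null homotopy of the loop to the square. The increment of the lift is the same
  along all the loops of the homotopy, and it vanishes along the constant one.\<close>

lemma lifts_loop:
  assumes sc: "simply_connected (UNIV :: 'x set)" and \<gamma>: "path \<gamma>" "\<gamma> 1 = \<gamma> 0" and l: "lifts \<gamma> {0..1} \<phi>"
  shows "\<phi> 1 = \<phi> 0"
proof -
  have "homotopic_loops UNIV \<gamma> (\<lambda>_. \<gamma> 0)"
    using sc \<gamma> unfolding simply_connected_def by (auto simp: pathstart_def pathfinish_def path_def)
  then obtain h where h: "continuous_on ({0..1} \<times> {0..1::real}) h" "\<And>x. x \<in> {0..1} \<Longrightarrow> h (0, x) = \<gamma> x"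
    "\<And>x. x \<in> {0..1} \<Longrightarrow> h (1, x) = \<gamma> 0" "\<And>t::real. t \<in> {0..1} \<Longrightarrow> h (t, 1) = h (t, 0)"
    unfolding homotopic_loops by (auto simp: pathstart_def pathfinish_def)
  obtain \<psi> where \<psi>: "lifts h ({0..1} \<times> {0..1}) \<psi>" by (rule lifts_square[OF h(1)])
  have con: "connected {0..1::real}" by simp
  have "lifts \<gamma> {0..1} (\<lambda>s. \<psi> (0, s))"
    by (rule lifts_compose[OF \<psi>]) (auto intro!: continuous_intros simp: h(2))
  from lifts_diff_const[OF l this con, of 0 1] have 1: "\<phi> 1 - \<phi> 0 = \<psi> (0, 1) - \<psi> (0, 0)"
    by (simp add: algebra_simps)
  have "lifts (\<lambda>t. h (t, 0)) {0..1} (\<lambda>t. \<psi> (t, 0))" "lifts (\<lambda>t. h (t, 0)) {0..1} (\<lambda>t. \<psi> (t, 1))"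
    by (rule lifts_compose[OF \<psi>]; auto intro!: continuous_intros simp: h(4))+
  \<comment> \<open>The edges with second coordinate \<open>0\<close> and \<open>1\<close> run over
    the same track of the base point, so the lift differs by a constant between them.\<close>
  from lifts_diff_const[OF this con, of 0 1] have 2: "\<psi> (0, 1) - \<psi> (0, 0) = \<psi> (1, 1) - \<psi> (1, 0)"
    by (simp add: algebra_simps)
  obtain U f where U: "(U, f) \<in> P" "\<gamma> 0 \<in> U" using P_cover[of "\<gamma> 0"] by blast
  have "lifts (\<lambda>_. \<gamma> 0) {0..1} (\<lambda>s. \<psi> (1, s))"
    by (rule lifts_compose[OF \<psi>]) (auto intro!: continuous_intros simp: h(3))
  from lifts_diff_const[OF this lifts_local[OF U(1), of "{0..1}" "\<lambda>_. \<gamma> 0"] con, of 0 1] U(2)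
  have 3: "\<psi> (1, 1) = \<psi> (1, 0)" by simp
  show ?thesis using 1 2 3 by simp
qed

lemma lifts_join:
  assumes "lifts (\<gamma> +++ \<delta>) {0..1} \<psi>" "\<gamma> 1 = \<delta> 0"
  shows "lifts \<gamma> {0..1} (\<lambda>s. \<psi> (s / 2))" "lifts \<delta> {0..1} (\<lambda>s. \<psi> ((s + 1) / 2))"
proof -
  show "lifts \<gamma> {0..1} (\<lambda>s. \<psi> (s / 2))"
    by (rule lifts_compose[OF assms(1)]) (auto intro!: continuous_intros simp: joinpaths_def)
  have "\<delta> s = (\<gamma> +++ \<delta>) ((s + 1) / 2)" if "s \<in> {0..1}" for s
  proof -
    have "2 * ((s + 1) / 2) - 1 = s" by (simp add: field_simps)
    then show ?thesis using that assms(2) unfolding joinpaths_def by (cases "s = 0") auto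
  qed
  then show "lifts \<delta> {0..1} (\<lambda>s. \<psi> ((s + 1) / 2))"
    by (intro lifts_compose[OF assms(1)]) (auto intro!: continuous_intros)
qed

text \<open>The glued function is the increment of a lift along any path from a base point. Two such
  paths form a loop, whose increment vanishes, so the choice of the path does not matter.\<close>

lemma glue_local_system:
  assumes sc: "simply_connected (UNIV :: 'x set)"
    and pc: "\<And>U f. (U, f) \<in> P \<Longrightarrow> path_connected U"
  obtains F where "\<And>U f x y. (U, f) \<in> P \<Longrightarrow> x \<in> U \<Longrightarrow> y \<in> U \<Longrightarrow> F y - F x = f y - f x"
proof -
  have con: "connected {0..1::real}" by simp
  \<comment> \<open>Any base point serves, since only differences of \<open>F\<close> are
    asserted.\<close>
  define b :: 'x where "b = undefined"
  define F where "F x = (SOME w. \<exists>\<gamma> \<phi>. path \<gamma> \<and> \<gamma> 0 = b \<and> \<gamma> 1 = x \<and> lifts \<gamma> {0..1} \<phi> \<and> w = \<phi> 1 - \<phi> 0)" for x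
  have same: "\<phi> 1 - \<phi> 0 = \<psi> 1 - \<psi> 0"
    if g: "path \<gamma>" "\<gamma> 0 = b" "\<gamma> 1 = x" "lifts \<gamma> {0..1} \<phi>" "path \<delta>" "\<delta> 0 = b" "\<delta> 1 = x" "lifts \<delta> {0..1} \<psi>"
    for \<gamma> \<phi> \<delta> \<psi> x
  proof -
    define l where "l = \<gamma> +++ reversepath \<delta>"
    have "path (reversepath \<delta>)" using g(5) by simp
    then have p: "path l" unfolding l_def
      using g by (intro path_join_imp) (simp_all add: pathfinish_def pathstart_def reversepath_def)
    obtain \<xi> where \<xi>: "lifts l {0..1} \<xi>" by (rule lifts_path[OF p])
    have "l 1 = l 0" using g by (simp add: l_def joinpaths_def reversepath_def)
    then have e: "\<xi> 1 = \<xi> 0" by (rule lifts_loop[OF sc p _ \<xi>])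
    have rd: "\<gamma> 1 = reversepath \<delta> 0" using g by (simp add: reversepath_def)
    have "lifts \<delta> {0..1} (\<lambda>s. \<xi> (((1 - s) + 1) / 2))"
      by (rule lifts_compose[OF lifts_join(2)[OF \<xi>[unfolded l_def] rd], where k="\<lambda>s. 1 - s"])
        (auto intro!: continuous_intros simp: reversepath_def)
    from lifts_diff_const[OF this g(8) con, of 0 1] have "\<xi> 1 - \<psi> 0 = \<xi> (1 / 2) - \<psi> 1" by simp
    moreover from lifts_diff_const[OF lifts_join(1)[OF \<xi>[unfolded l_def] rd] g(4) con, of 0 1]
    have "\<xi> 0 - \<phi> 0 = \<xi> (1 / 2) - \<phi> 1" by simp
    ultimately have "(\<xi> 0 - \<phi> 0) - (\<xi> 0 - \<psi> 0) = (\<xi> (1 / 2) - \<phi> 1) - (\<xi> (1 / 2) - \<psi> 1)"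
      unfolding e by simp
    then show ?thesis by (simp add: algebra_simps)
  qed
  have F: "F x = \<phi> 1 - \<phi> 0" if "path \<gamma>" "\<gamma> 0 = b" "\<gamma> 1 = x" "lifts \<gamma> {0..1} \<phi>" for \<gamma> \<phi> x
    unfolding F_def by (rule some_equality) (use that same in blast)+
  show thesis
  proof (rule that)
    fix U f x y assume U: "(U, f) \<in> P" "x \<in> U" "y \<in> U"
    obtain \<delta> where \<delta>: "path \<delta>" "path_image \<delta> \<subseteq> U" "\<delta> 0 = x" "\<delta> 1 = y"
      using pc[OF U(1)] U unfolding path_connected_def pathstart_def pathfinish_def by blast
    obtain \<gamma> where \<gamma>: "path \<gamma>" "\<gamma> 0 = b" "\<gamma> 1 = x" using simply_connected_path[OF sc] by blast
    have p: "path (\<gamma> +++ \<delta>)"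
      by (rule path_join_imp) (use \<gamma> \<delta> in \<open>auto simp: pathstart_def pathfinish_def\<close>)
    obtain \<psi> where \<psi>: "lifts (\<gamma> +++ \<delta>) {0..1} \<psi>" by (rule lifts_path[OF p])
    have e: "\<gamma> 1 = \<delta> 0" using \<gamma> \<delta> by simp
    have "F x = \<psi> (1 / 2) - \<psi> 0" using F[OF \<gamma> lifts_join(1)[OF \<psi> e]] by simp
    moreover have "F y = \<psi> 1 - \<psi> 0" using F[OF p _ _ \<psi>] \<gamma> \<delta> by (simp add: joinpaths_def)
    moreover have "lifts \<delta> {0..1} (\<lambda>s. f (\<delta> s))"
      using \<delta> by (intro lifts_local[OF U(1)]) (auto simp: path_def path_image_def)
    from lifts_diff_const[OF lifts_join(2)[OF \<psi> e] this con, of 0 1] \<delta>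
    have "\<psi> 1 - \<psi> (1 / 2) = f y - f x" by (simp add: algebra_simps)
    ultimately show "F y - F x = f y - f x" by simp
  qed
qed

end

lemma simply_connected_imp_connected_UNIV:
  assumes "simply_connected (UNIV :: 'x::topological_space set)"
  shows "connected (UNIV :: 'x set)"
proof -
  have "path_component UNIV x y" for x y :: 'x
    using simply_connected_path[OF assms, of x y] unfolding path_component_def
    by (auto simp: pathstart_def pathfinish_def)
  then show ?thesis by (intro path_connected_imp_connected) (simp add: path_connected_component)
qed

section \<open>Global primitives on a simply connected group\<close>

context lie_group_frame
begin

lemma ld_add: "mfd_smooth_at M f g \<Longrightarrow> mfd_smooth_at M h g \<Longrightarrow> ld X (\<lambda>x. f x + h x) g = ld X f g + ld X h g"
  by (rule ldI) (intro has_derivative_add has_derivative_ld)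

lemma ld_diff: "mfd_smooth_at M f g \<Longrightarrow> mfd_smooth_at M h g \<Longrightarrow> ld X (\<lambda>x. f x - h x) g = ld X f g - ld X h g"
  by (rule ldI) (intro has_derivative_diff has_derivative_ld)

lemma mfd_smooth_at_diff: "mfd_smooth_at M f g \<Longrightarrow> mfd_smooth_at M h g \<Longrightarrow> mfd_smooth_at M (\<lambda>x. f x - h x) g"
  unfolding mfd_smooth_at_def by (auto intro!: smooth_at_diff)

lemma mfd_smooth_at_add: "mfd_smooth_at M f g \<Longrightarrow> mfd_smooth_at M h g \<Longrightarrow> mfd_smooth_at M (\<lambda>x. f x + h x) g"
  unfolding mfd_smooth_at_def by (auto intro!: smooth_at_add)

lemma ld_const: "ld X (\<lambda>_. a) g = 0"
  by (rule ldI[where D="\<lambda>_. 0"]) (rule has_derivative_const)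

lemma global_primitive:
  fixes F :: "'l \<Rightarrow> 'g \<Rightarrow> 'w::euclidean_space"
  assumes sc: "simply_connected (UNIV :: 'g set)"
    and sm: "\<And>X g. mfd_smooth_at M (F X) g" and lin: "\<And>g. linear (\<lambda>X. F X g)"
    and closed: "\<And>X Y g. ld X (F Y) g - ld Y (F X) g = F (br X Y) g"
  obtains f where "\<And>g. mfd_smooth_at M f g" "\<And>g X. ld X f g = F X g" "f gone = 0"
proof -
  \<comment> \<open>Path connected domains let two points of a domain be joined inside it, where
    \<open>f\<close> itself is a lift. Compatibility holds since the difference of two primitives
    has zero derivative.\<close>
  define P where "P = {(U, f). open U \<and> path_connected U \<and> (\<forall>g\<in>U. mfd_smooth_at M f g \<and> (\<forall>X. ld X f g = F X g))}"
  have "local_system P"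
  proof
    show "open U" if "(U, f) \<in> P" for U f using that by (simp add: P_def)
    show "\<exists>(U, f)\<in>P. x \<in> U" for x
    proof -
      obtain U f where "open U" "x \<in> U" "path_connected U" "\<And>g. g \<in> U \<Longrightarrow> mfd_smooth_at M f g"
        "\<And>g X. g \<in> U \<Longrightarrow> ld X f g = F X g"
        using local_primitive[OF sm lin closed] by blast
      then have "(U, f) \<in> P" "x \<in> U" by (auto simp: P_def)
      then show ?thesis by blast
    qed
    show "\<exists>N. open N \<and> x \<in> N \<and> (\<forall>y\<in>N. f y - g y = f x - g x)"
      if "(U, f) \<in> P" "(V, g) \<in> P" "x \<in> U" "x \<in> V" for U f V g x
    proof -
      have *: "open (U \<inter> V)" "x \<in> U \<inter> V" using that by (auto simp: P_def)
      have s: "mfd_smooth_at M f y" "mfd_smooth_at M g y" "ld X f y = F X y" "ld X g y = F X y" if "y \<in> U \<inter> V" for X y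
        using that \<open>(U, f) \<in> P\<close> \<open>(V, g) \<in> P\<close> by (auto simp: P_def)
      have d: "mfd_smooth_at M (\<lambda>y. f y - g y) y" "ld X (\<lambda>y. f y - g y) y = 0" if "y \<in> U \<inter> V" for X y
        using mfd_smooth_at_diff[OF s(1,2)[OF that]] ld_diff[OF s(1,2)[OF that]] s(3,4)[OF that] by simp_all
      obtain T where "open T" "x \<in> T" "\<forall>h\<in>T. f x - g x = f h - g h"
        using ld_zero_locally_const[OF * d] by blast
      then show ?thesis by (intro exI[of _ T]) simp
    qed
  qed
  then interpret local_system P .
  obtain f where f: "\<And>U h x y. (U, h) \<in> P \<Longrightarrow> x \<in> U \<Longrightarrow> y \<in> U \<Longrightarrow> f y - f x = h y - h x"
    by (rule glue_local_system[OF sc]) (auto simp: P_def)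
  have fP: "mfd_smooth_at M f g \<and> (\<forall>X. ld X f g = F X g)" for g
  proof -
    obtain U h where U: "(U, h) \<in> P" "g \<in> U" using P_cover[of g] by blast
    have "open U" and h: "mfd_smooth_at M h g" "\<And>X. ld X h g = F X g" using U by (auto simp: P_def)
    then have ev: "\<forall>\<^sub>F x in nhds g. h x + (f g - h g) = f x"
      unfolding eventually_nhds using f[OF U] U(2) by (intro exI[of _ U]) (auto simp: algebra_simps)
    have "mfd_smooth_at M (\<lambda>x. h x + (f g - h g)) g"
      by (rule mfd_smooth_at_add[OF h(1) mfd_smooth_at_const])
    then show ?thesis
      using mfd_smooth_at_cong[OF ev] ld_cong[OF ev] h(2) by (simp add: ld_add[OF h(1) mfd_smooth_at_const] ld_const)
  qed
  show thesis
  proof (rule that[of "\<lambda>g. f g - f gone"])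
    show "mfd_smooth_at M (\<lambda>g. f g - f gone) g" for g
      using fP mfd_smooth_at_diff mfd_smooth_at_const by blast
    show "ld X (\<lambda>g. f g - f gone) g = F X g" for g X
      using fP ld_diff[OF _ mfd_smooth_at_const, of f g] by (simp add: ld_const)
  qed simp
qed

lemma mfd_smooth_at_translate:
  assumes "mfd_smooth_at M f (k \<odot> g)"
  shows "mfd_smooth_at M (\<lambda>h. f (k \<odot> h)) g"
proof -
  obtain U c where U: "(U, c) \<in> M" "g \<in> U" by (rule chart_ex)
  show ?thesis
  proof (rule mfd_smooth_atI[OF U], rule mfd_smooth_at_plot[where f=f and \<psi>="\<lambda>y. k \<odot> inv_into U c y"])
    show "plot_at M (\<lambda>y. k \<odot> inv_into U c y) (c g)"
      using U by (intro plot_mult plot_at_const plot_chart_inv[OF U(1)]) simp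
  qed (simp add: assms chart_inv[OF U])
qed

lemma ld_translate: "ld X (\<lambda>h. f (k \<odot> h)) g = ld X f (k \<odot> g)"
  unfolding left_deriv_def by (simp add: g_assoc)

end

section \<open>Coordinates on the double extension\<close>

locale abelian_metric =
  fixes B :: "'v::euclidean_space \<Rightarrow> 'v \<Rightarrow> real" and A :: "'v \<Rightarrow> 'v"
  assumes metric: "metric_lie_algebra_on UNIV (\<lambda>_ _. 0) B" and A_skew: "A \<in> so_algebra B"
begin

lemma bB: "bilinear B" and B_sym: "B x y = B y x" and B_nondeg: "(\<And>y. B x y = 0) \<Longrightarrow> x = 0"
  using metric unfolding metric_lie_algebra_on_def by auto

lemma lA: "linear A" and B_skew: "B (A x) y = - B x (A y)"
  using A_skew unfolding so_algebra_def by (auto simp: eq_neg_iff_add_eq_0)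

lemmas B_simps = bilinear_ladd[OF bB] bilinear_radd[OF bB] bilinear_lmul[OF bB] bilinear_rmul[OF bB]
  bilinear_lsub[OF bB] bilinear_rsub[OF bB] bilinear_lzero[OF bB] bilinear_rzero[OF bB]
  bilinear_lneg[OF bB] bilinear_rneg[OF bB]
lemmas A_simps = linear_add[OF lA] linear_cmul[OF lA] linear_diff[OF lA] linear_0[OF lA] linear_neg[OF lA]

lemma bbB: "bounded_bilinear B" using bB by (simp add: bilinear_conv_bounded_bilinear)

lemma blA: "bounded_linear A" using lA by (simp add: linear_conv_bounded_linear)

lemma flow_B [simp]: "B (flow A t x) (flow A t y) = B x y"
  by (rule flow_isometry[OF lA bB]) (simp add: B_skew)

abbreviation br where "br \<equiv> dext_bracket A B"
abbreviation Bf where "Bf \<equiv> dext_form B"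

lemma dext_metric: "metric_lie_algebra_on UNIV br Bf"
  by (rule dext_metric_lie_algebra[OF metric A_skew])

lemma bBf: "bilinear Bf" and Bf_sym: "Bf x y = Bf y x" and Bf_nondeg: "(\<And>y. Bf x y = 0) \<Longrightarrow> x = 0"
  and Bf_ad: "Bf (br x y) z + Bf y (br x z) = 0" and bbr: "bilinear br"
  using dext_metric unfolding metric_lie_algebra_on_def by blast+

lemma br_simp [simp]: "br (a, X, h) (b, Y, k) = (B (A X) Y, h *\<^sub>R A Y - k *\<^sub>R A X, 0)"
  and Bf_simp [simp]: "Bf (a, X, h) (b, Y, k) = a * k + h * b + B X Y"
  by (simp_all add: dext_bracket_def dext_form_def)

end

locale dext_group = abelian_metric B A + lie_group_frame G M \<eta> "dext_bracket A B"
  for B :: "'v::euclidean_space \<Rightarrow> 'v \<Rightarrow> real" and A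
    and G :: "('g::{t2_space,second_countable_topology}, 'r) monoid_scheme"
    and M :: "('g, 'e::euclidean_space) atlas"
    and \<eta> :: "real \<times> 'v \<times> real \<Rightarrow> 'g" +
  assumes sc: "simply_connected (UNIV :: 'g set)"
begin

lemma connected_G: "connected (UNIV :: 'g set)"
  by (rule simply_connected_imp_connected_UNIV[OF sc])

lemma ld_flow:
  assumes "mfd_smooth_at M s g" "mfd_smooth_at M f g"
  shows "ld X (\<lambda>h. flow A (s h) (f h)) g = ld X s g *\<^sub>R flow A (s g) (A (f g)) + flow A (s g) (ld X f g)"
  by (rule ldI[where D="\<lambda>X. ld X s g *\<^sub>R flow A (s g) (A (f g)) + flow A (s g) (ld X f g)"])
    (use has_derivative_flow[OF lA has_derivative_ld[OF assms(1)] has_derivative_ld[OF assms(2)]] in simp)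

lemma mfd_smooth_at_flow:
  assumes "mfd_smooth_at M s g" "mfd_smooth_at M f g" "linear T"
  shows "mfd_smooth_at M (\<lambda>h. flow T (s h) (f h)) g"
  using assms unfolding mfd_smooth_at_def by (auto intro!: smooth_at_flow)

lemma coordinates:
  obtains a :: "'g \<Rightarrow> real" and x :: "'g \<Rightarrow> 'v" and t :: "'g \<Rightarrow> real" where
    "\<And>g. mfd_smooth_at M a g" "\<And>g. mfd_smooth_at M x g" "\<And>g. mfd_smooth_at M t g"
    "\<And>g b Y k. ld (b, Y, k) t g = k" "\<And>g b Y k. ld (b, Y, k) x g = flow A (t g) Y"
    "\<And>g b Y k. ld (b, Y, k) a g = b + B (A (x g)) (flow A (t g) Y) / 2"
    "a gone = 0" "x gone = 0" "t gone = 0"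
proof -
  obtain t where t: "\<And>g. mfd_smooth_at M t g" "\<And>g X. ld X t g = snd (snd X)" "t gone = 0"
  proof (rule global_primitive[OF sc])
    show "linear (\<lambda>X. snd (snd X))" by (intro linearI) auto
    show "ld X (\<lambda>_. snd (snd Y)) g - ld Y (\<lambda>_. snd (snd X)) g = snd (snd (br X Y))" for g :: 'g and X Y
      by (cases X; cases Y) (simp add: ld_const)
  qed (auto intro: mfd_smooth_at_const)
  obtain x where x: "\<And>g. mfd_smooth_at M x g" "\<And>g X. ld X x g = flow A (t g) (fst (snd X))" "x gone = 0"
  proof (rule global_primitive[OF sc, of "\<lambda>X g. flow A (t g) (fst (snd X))"])
    show "mfd_smooth_at M (\<lambda>g. flow A (t g) (fst (snd X))) g" for X g
      by (rule mfd_smooth_at_flow[OF t(1) mfd_smooth_at_const lA])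
    show "linear (\<lambda>X. flow A (t g) (fst (snd X)))" for g
      by (intro linearI) (auto simp: linear_add[OF linear_flow[OF lA]] linear_cmul[OF linear_flow[OF lA]])
    \<comment> \<open>Differentiating the factor \<open>e^(tA)\<close> produces
      \<open>h A Y - k A X\<close>, which is exactly the \<open>g\<close>-component of the
      bracket.\<close>
    show "ld X (\<lambda>g. flow A (t g) (fst (snd Y))) g - ld Y (\<lambda>g. flow A (t g) (fst (snd X))) g = flow A (t g) (fst (snd (br X Y)))" for g X Y
      by (cases X; cases Y) (simp add: ld_flow[OF t(1) mfd_smooth_at_const] t ld_const
        linear_0[OF linear_flow[OF lA]] linear_diff[OF linear_flow[OF lA]] linear_cmul[OF linear_flow[OF lA]])
  qed auto
  \<comment> \<open>The central form alone is not closed, as \<open>[X, Y]\<close> has the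
    \<open>\<alpha>\<close>-component \<open>B (A X) Y\<close>. The derivative of
    \<open>B (A x)\<close> contributes this term once for each order of \<open>X\<close> and
    \<open>Y\<close> with opposite signs, hence the factor \<open>1/2\<close>.\<close>
  define F :: "real \<times> 'v \<times> real \<Rightarrow> 'g \<Rightarrow> real" where "F X g = fst X + B (A (x g)) (flow A (t g) (fst (snd X))) / 2" for X g
  have ldF: "ld X (F Y) g = (B (A (ld X x g)) (flow A (t g) (fst (snd Y)))
     + B (A (x g)) (ld X t g *\<^sub>R flow A (t g) (A (fst (snd Y))))) / 2" for X Y g
  proof (rule ldI)
    have 1: "((\<lambda>v. A (x (g \<odot> \<eta> v))) has_derivative (\<lambda>X. A (ld X x g))) (at 0)"
      by (rule bounded_linear.has_derivative[OF blA has_derivative_ld[OF x(1)]])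
    have 2: "((\<lambda>v. flow A (t (g \<odot> \<eta> v)) (fst (snd Y))) has_derivative (\<lambda>X. ld X t g *\<^sub>R flow A (t g) (A (fst (snd Y))))) (at 0)"
      using has_derivative_flow[OF lA has_derivative_ld[OF t(1)] has_derivative_const[of "fst (snd Y)"], of g]
      by (simp add: linear_0[OF linear_flow[OF lA]])
    from bounded_bilinear.FDERIV[OF bbB 1 2]
    have "((\<lambda>v. B (A (x (g \<odot> \<eta> v))) (flow A (t (g \<odot> \<eta> v)) (fst (snd Y)))) has_derivative (\<lambda>X.
      B (A (x g)) (ld X t g *\<^sub>R flow A (t g) (A (fst (snd Y)))) + B (A (ld X x g)) (flow A (t g) (fst (snd Y))))) (at 0)"
      by simp
    then show "((\<lambda>v. F Y (g \<odot> \<eta> v)) has_derivative (\<lambda>X. (B (A (ld X x g)) (flow A (t g) (fst (snd Y)))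
     + B (A (x g)) (ld X t g *\<^sub>R flow A (t g) (A (fst (snd Y))))) / 2)) (at 0)"
      unfolding F_def by (auto intro!: derivative_eq_intros simp: add.commute)
  qed
  obtain a where a: "\<And>g. mfd_smooth_at M a g" "\<And>g X. ld X a g = F X g" "a gone = 0"
  proof (rule global_primitive[OF sc, of F])
    show "mfd_smooth_at M (F X) g" for X g
    proof -
      have "mfd_smooth_at M (\<lambda>g. (x g, flow A (t g) (fst (snd X)))) g"
        by (intro mfd_smooth_at_Pair x mfd_smooth_at_flow[OF t(1) mfd_smooth_at_const lA])
      moreover have "smooth_at (\<lambda>z. fst X + (1/2) * B (A (fst z)) (snd z)) z" for z :: "'v \<times> 'v"
        by (intro smooth_at_add smooth_at_mult smooth_at_const smooth_at_bounded_bilinear[OF bbB]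
          smooth_at_bounded_linear[OF blA] smooth_at_fst smooth_at_snd smooth_at_id)
      ultimately have "mfd_smooth_at M (\<lambda>g. fst X + (1/2) * B (A (x g)) (flow A (t g) (fst (snd X)))) g"
        using mfd_smooth_at_compose[of "\<lambda>z. fst X + (1/2) * B (A (fst z)) (snd z)" "\<lambda>g. (x g, flow A (t g) (fst (snd X)))"] by simp
      then show ?thesis by (simp add: F_def[abs_def])
    qed
    show "linear (\<lambda>X. F X g)" for g
      by (intro linearI) (auto simp: F_def linear_add[OF linear_flow[OF lA]] linear_cmul[OF linear_flow[OF lA]] B_simps field_simps)
    show "ld X (F Y) g - ld Y (F X) g = F (br X Y) g" for X Y g
    proof -
      obtain b X' h where X: "X = (b, X', h)" by (cases X)
      obtain c Y' k where Y: "Y = (c, Y', k)" by (cases Y)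
      have "B (A (flow A (t g) X')) (flow A (t g) Y') = B (A X') Y'"
        "B (A (flow A (t g) Y')) (flow A (t g) X') = - B (A X') Y'"
        using B_skew[of Y' X'] B_sym[of "A X'" Y'] by (simp_all add: flow_commute[OF lA])
      then show ?thesis
        by (simp add: ldF X Y x(2) t(2) F_def B_simps linear_diff[OF linear_flow[OF lA]] linear_cmul[OF linear_flow[OF lA]] field_simps)
    qed
  qed auto
  show thesis by (rule that[of a x t]) (simp_all add: a x t F_def)
qed

end

locale dext_coords = dext_group B A G M \<eta>
  for B :: "'v::euclidean_space \<Rightarrow> 'v \<Rightarrow> real" and A
    and G :: "('g::{t2_space,second_countable_topology}, 'r) monoid_scheme"
    and M :: "('g, 'e::euclidean_space) atlas"
    and \<eta> :: "real \<times> 'v \<times> real \<Rightarrow> 'g" +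
  fixes ca :: "'g \<Rightarrow> real" and cx :: "'g \<Rightarrow> 'v" and ct :: "'g \<Rightarrow> real"
  assumes smooth_ca: "\<And>g. mfd_smooth_at M ca g" and smooth_cx: "\<And>g. mfd_smooth_at M cx g"
    and smooth_ct: "\<And>g. mfd_smooth_at M ct g"
    and ld_ct [simp]: "\<And>g b Y k. ld (b, Y, k) ct g = k" and ld_cx [simp]: "\<And>g b Y k. ld (b, Y, k) cx g = flow A (ct g) Y"
    and ld_ca [simp]: "\<And>g b Y k. ld (b, Y, k) ca g = b + B (A (cx g)) (flow A (ct g) Y) / 2"
    and ca_one [simp]: "ca gone = 0" and cx_one [simp]: "cx gone = 0" and ct_one [simp]: "ct gone = 0"
begin

section \<open>The group law in coordinates\<close>

lemma lflow: "linear (flow A s)" by (rule linear_flow[OF lA])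

lemma ld_bounded_linear:
  assumes "bounded_linear L" "mfd_smooth_at M f g"
  shows "ld X (\<lambda>h. L (f h)) g = L (ld X f g)"
  by (rule ldI[where D="\<lambda>X. L (ld X f g)"])
    (rule bounded_linear.has_derivative[OF assms(1) has_derivative_ld[OF assms(2)]])

text \<open>Left translation does not change left invariant derivatives, so as functions of
  \<open>h\<close> both sides have the same derivatives; they agree at the unit, and the group is
  connected. The laws for \<open>cx\<close> and \<open>ca\<close> follow in the same way.\<close>

lemma ct_mult [simp]: "ct (g \<odot> h) = ct g + ct h"
proof -
  have "ct (g \<odot> h) - ct h = ct (g \<odot> gone) - ct gone"
  proof (rule ld_zero_imp_const[OF connected_G, of "\<lambda>h. ct (g \<odot> h) - ct h"])
    show "ld X (\<lambda>h. ct (g \<odot> h) - ct h) h = 0" for X h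
      by (cases X) (simp add: ld_diff[OF mfd_smooth_at_translate[OF smooth_ct] smooth_ct] ld_translate)
  qed (intro mfd_smooth_at_diff mfd_smooth_at_translate smooth_ct)
  then show ?thesis by simp
qed

lemma cx_mult [simp]: "cx (g \<odot> h) = cx g + flow A (ct g) (cx h)"
proof -
  have bl: "bounded_linear (flow A (ct g))" using lflow by (simp add: linear_conv_bounded_linear)
  have s: "mfd_smooth_at M (\<lambda>h. flow A (ct g) (cx h)) h" for h
    by (rule mfd_smooth_at_bounded_linear[OF bl smooth_cx])
  have "cx (g \<odot> h) - flow A (ct g) (cx h) = cx (g \<odot> gone) - flow A (ct g) (cx gone)"
  proof (rule ld_zero_imp_const[OF connected_G, of "\<lambda>h. cx (g \<odot> h) - flow A (ct g) (cx h)"])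
    show "ld X (\<lambda>h. cx (g \<odot> h) - flow A (ct g) (cx h)) h = 0" for X h
      by (cases X) (simp add: ld_diff[OF mfd_smooth_at_translate[OF smooth_cx] s] ld_translate
         ld_bounded_linear[OF bl smooth_cx] flow_add[OF lA])
  qed (intro mfd_smooth_at_diff mfd_smooth_at_translate smooth_cx s)
  then show ?thesis by (simp add: linear_0[OF lflow] algebra_simps)
qed

text \<open>A Heisenberg cocycle twisted by the rotation \<open>e^(tA)\<close>: \<open>ca\<close> is
  additive only where \<open>cx\<close> vanishes, and \<open>cx\<close> only where \<open>ct\<close>
  vanishes.\<close>

lemma ca_mult: "ca (g \<odot> h) = ca g + ca h + B (A (cx g)) (flow A (ct g) (cx h)) / 2"
proof -
  have bl: "bounded_linear (\<lambda>y. B (A (cx g)) (flow A (ct g) y) / 2)"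
    unfolding linear_conv_bounded_linear[symmetric]
    by (intro linearI) (auto simp: linear_add[OF lflow] linear_cmul[OF lflow] B_simps field_simps)
  define f where "f h = ca h + B (A (cx g)) (flow A (ct g) (cx h)) / 2" for h
  have s1: "mfd_smooth_at M (\<lambda>h. B (A (cx g)) (flow A (ct g) (cx h)) / 2) h" for h
    by (rule mfd_smooth_at_bounded_linear[OF bl smooth_cx])
  have s: "mfd_smooth_at M f h" for h unfolding f_def by (intro mfd_smooth_at_add smooth_ca s1)
  have "ca (g \<odot> h) - f h = ca (g \<odot> gone) - f gone"
  proof (rule ld_zero_imp_const[OF connected_G, of "\<lambda>h. ca (g \<odot> h) - f h"])
    show "ld X (\<lambda>h. ca (g \<odot> h) - f h) h = 0" for X h
    proof -
      obtain b Y k where X: "X = (b, Y, k)" by (cases X)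
      have "ld X f h = b + B (A (cx h)) (flow A (ct h) Y) / 2 + B (A (cx g)) (flow A (ct g) (flow A (ct h) Y)) / 2"
        unfolding f_def[abs_def] by (simp add: X ld_add[OF smooth_ca s1] ld_bounded_linear[OF bl smooth_cx])
      moreover have "B (A (flow A (ct g) (cx h))) (flow A (ct g + ct h) Y) = B (A (cx h)) (flow A (ct h) Y)"
        by (simp add: flow_add[OF lA] flow_commute[OF lA])
      ultimately show ?thesis
        by (simp add: X ld_diff[OF mfd_smooth_at_translate[OF smooth_ca] s] ld_translate A_simps B_simps)
          (simp add: flow_add[OF lA] field_simps)
    qed
  qed (intro mfd_smooth_at_diff mfd_smooth_at_translate smooth_ca s)
  then show ?thesis by (simp add: f_def linear_0[OF lflow] B_simps algebra_simps)
qed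

definition \<Phi> :: "'g \<Rightarrow> real \<times> 'v \<times> real" where "\<Phi> g = (ca g, cx g, ct g)"

lemma smooth_\<Phi>: "mfd_smooth_at M \<Phi> g"
  unfolding \<Phi>_def[abs_def] by (intro mfd_smooth_at_Pair smooth_ca smooth_cx smooth_ct)

lemma ld_\<Phi>: "ld (b, Y, k) \<Phi> g = (b + B (A (cx g)) (flow A (ct g) Y) / 2, flow A (ct g) Y, k)"
proof -
  have "((\<lambda>x. \<Phi> (g \<odot> \<eta> x)) has_derivative (\<lambda>X. (ld X ca g, ld X cx g, ld X ct g))) (at 0)"
    unfolding \<Phi>_def by (intro has_derivative_Pair has_derivative_ld smooth_ca smooth_cx smooth_ct)
  from ldI[OF this] show ?thesis by simp
qed

text \<open>Inverse of the differential of \<open>\<Phi>\<close> in the left trivialisation, at a point with coordinates \<open>(a, x, s)\<close>.\<close>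

definition \<Theta> :: "real \<times> 'v \<times> real \<Rightarrow> real \<times> 'v \<times> real \<Rightarrow> real \<times> 'v \<times> real" where
  "\<Theta> p v = (fst v - B (A (fst (snd p))) (fst (snd v)) / 2, flow A (- snd (snd p)) (fst (snd v)), snd (snd v))"

lemma \<Theta>_ld: "\<Theta> (\<Phi> g) (ld X \<Phi> g) = X" "ld (\<Theta> (\<Phi> g) v) \<Phi> g = v"
proof -
  show "\<Theta> (\<Phi> g) (ld X \<Phi> g) = X" by (cases X) (simp add: ld_\<Phi>[unfolded prod.collapse] \<Theta>_def \<Phi>_def lA)
  show "ld (\<Theta> (\<Phi> g) v) \<Phi> g = v" by (cases v) (simp add: ld_\<Phi> \<Theta>_def \<Phi>_def lA)
qed

end

section \<open>Solvability\<close>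

text \<open>An additive map kills commutators. Additivity is asked on \<open>H\<close> alone, since
  \<open>cx\<close> and \<open>ca\<close> become additive only on the kernel of the previous
  coordinates.\<close>

lemma (in group) derived_subset_of_additive:
  fixes \<phi> :: "'a \<Rightarrow> 'w::real_vector"
  assumes H: "subgroup H G" and add: "\<And>g h. g \<in> H \<Longrightarrow> h \<in> H \<Longrightarrow> \<phi> (g \<otimes> h) = \<phi> g + \<phi> h"
  shows "subgroup {g \<in> H. \<phi> g = 0} G" "derived G H \<subseteq> {g \<in> H. \<phi> g = 0}"
proof -
  note sub = subgroup.subset[OF H] subgroup.one_closed[OF H] subgroup.m_closed[OF H] subgroup.m_inv_closed[OF H]
  have one: "\<phi> \<one> = 0" using add[of \<one> \<one>] sub(2) by simp
  have inv: "\<phi> (inv g) = - \<phi> g" if "g \<in> H" for g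
    using add[OF that sub(4)[OF that]] that sub(1) one by (simp add: subset_iff eq_neg_iff_add_eq_0 add.commute)
  show S: "subgroup {g \<in> H. \<phi> g = 0} G"
    by (rule subgroup.intro) (use sub one inv add in auto)
  show "derived G H \<subseteq> {g \<in> H. \<phi> g = 0}"
    unfolding derived_def
    by (rule generate_subgroup_incl[OF _ S]) (use sub inv add in auto)
qed

lemma has_derivative_inj_isolated:
  fixes f :: "'a::euclidean_space \<Rightarrow> 'b::euclidean_space"
  assumes f: "(f has_derivative D) (at x)" and D: "inj D"
  shows "\<forall>\<^sub>F y in nhds x. f y = f x \<longrightarrow> y = x"
proof -
  obtain c where c: "c > 0" "\<And>v. c * norm v \<le> norm (D v)"
    using linear_inj_bounded_below_pos[OF has_derivative_linear[OF f] D] by blast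
  obtain d where d: "d > 0" "\<And>y. norm (y - x) < d \<Longrightarrow> norm (f y - f x - D (y - x)) \<le> c / 2 * norm (y - x)"
    using f c(1) unfolding has_derivative_at_alt by (metis half_gt_zero)
  have "y = x" if "norm (y - x) < d" "f y = f x" for y
  proof -
    have "c * norm (y - x) \<le> c / 2 * norm (y - x)"
      using d(2)[OF that(1)] c(2)[of "y - x"] that(2) by simp
    then show ?thesis using c(1) by (simp add: field_simps)
  qed
  then show ?thesis unfolding eventually_nhds_metric using d(1) by (auto simp: dist_norm)
qed

context dext_coords
begin

text \<open>The differential of \<open>\<Phi>\<close> at the unit has the left inverse
  \<open>\<Theta>\<close>, so the unit is isolated in the kernel.\<close>

lemma \<Phi>_isolated: "\<forall>\<^sub>F g in nhds gone. \<Phi> g = 0 \<longrightarrow> g = gone"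
proof -
  obtain U c where U: "(U, c) \<in> M" "gone \<in> U" by (rule chart_ex)
  define D where "D = frechet_derivative (\<lambda>y. \<Phi> (inv_into U c y)) (at (c gone))"
  have d: "((\<lambda>y. \<Phi> (inv_into U c y)) has_derivative D) (at (c gone))"
    unfolding D_def by (rule smooth_at_has_derivative[OF mfd_smooth_atD[OF smooth_\<Phi> U]])
  have "inj D"
  proof (rule injI)
    fix v w assume e: "D v = D w"
    obtain X where X: "ld X c gone = v" by (rule ld_chart_surj[OF U])
    obtain Y where Y: "ld Y c gone = w" by (rule ld_chart_surj[OF U])
    have "ld X \<Phi> gone = D v" "ld Y \<Phi> gone = D w"
      unfolding D_def X[symmetric] Y[symmetric] by (rule ld_chart[OF smooth_\<Phi> U])+
    with e have "ld X \<Phi> gone = ld Y \<Phi> gone" by (simp only:)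
    then have "\<Theta> (\<Phi> gone) (ld X \<Phi> gone) = \<Theta> (\<Phi> gone) (ld Y \<Phi> gone)" by (rule arg_cong)
    then have "X = Y" unfolding \<Theta>_ld(1) .
    then show "v = w" using X Y by simp
  qed
  from has_derivative_inj_isolated[OF d this]
  have "\<forall>\<^sub>F y in nhds (c gone). \<Phi> (inv_into U c y) = \<Phi> (inv_into U c (c gone)) \<longrightarrow> y = c gone" .
  moreover have "(c \<longlongrightarrow> c gone) (nhds gone)"
    using chart_isCont[OF U] tendsto_at_iff_tendsto_nhds[of c gone] by (simp add: isCont_def)
  ultimately have "\<forall>\<^sub>F g in nhds gone. \<Phi> (inv_into U c (c g)) = \<Phi> (inv_into U c (c gone)) \<longrightarrow> c g = c gone"
    unfolding filterlim_iff by blast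
  moreover have "\<forall>\<^sub>F g in nhds gone. g \<in> U" using U chart_open eventually_nhds_in_open by blast
  ultimately show ?thesis
  proof eventually_elim
    case (elim g)
    have "\<Phi> gone = 0" by (simp add: \<Phi>_def zero_prod_def)
    then show ?case using elim chart_inv[OF U(1) elim(2)] chart_inv[OF U] by metis
  qed
qed

lemma continuous_conj: "continuous_on UNIV (\<lambda>g. ginv h \<odot> g \<odot> k \<odot> ginv g \<odot> h')"
proof -
  have "smooth_map_on (prod_atlas M M) M UNIV (\<lambda>(x, y). x \<odot> y)" "smooth_map_on M M UNIV ginv"
    using lie_group by (auto simp: lie_group_def)
  then have m: "continuous_on UNIV (\<lambda>(x, y). x \<odot> y)" and i: "continuous_on UNIV ginv"
    by (auto simp: smooth_map_on_def)
  have mm: "continuous_on UNIV (\<lambda>g. f1 g \<odot> f2 g)" if "continuous_on UNIV f1" "continuous_on UNIV f2" for f1 f2 :: "'g \<Rightarrow> 'g"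
    using continuous_on_compose2[OF m continuous_on_Pair[OF that]] by simp
  show ?thesis by (intro mm i continuous_on_const continuous_on_id)
qed

text \<open>A discrete normal subgroup of a connected group is central:
  \<open>g \<mapsto> g k g^-1\<close> is continuous with values in the kernel of
  \<open>\<Phi>\<close>, hence locally constant.\<close>

lemma kernel_central:
  assumes k: "\<Phi> k = 0"
  shows "g \<odot> k = k \<odot> g"
proof -
  obtain T where T: "open T" "gone \<in> T" "\<And>g. g \<in> T \<Longrightarrow> \<Phi> g = 0 \<Longrightarrow> g = gone"
    using \<Phi>_isolated unfolding eventually_nhds by blast
  have k0: "ca k = 0" "cx k = 0" "ct k = 0" using k by (auto simp: \<Phi>_def zero_prod_def)
  have ci: "ct (ginv g) = - ct g" for g using ct_mult[of g "ginv g"] by (simp del: ct_mult)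
  have xi: "cx (ginv g) = - flow A (- ct g) (cx g)" for g
  proof -
    have "flow A (- ct g) (cx g + flow A (ct g) (cx (ginv g))) = 0"
      using cx_mult[of g "ginv g"] by (simp add: linear_0[OF lflow] del: cx_mult)
    then show ?thesis by (simp add: linear_add[OF lflow] lA eq_neg_iff_add_eq_0 add.commute)
  qed
  have ker: "\<Phi> (g \<odot> h) = 0" if "\<Phi> g = 0" "\<Phi> h = 0" for g h
    using that by (simp add: \<Phi>_def zero_prod_def ca_mult A_simps B_simps lA)
  have conj: "\<Phi> (g \<odot> h \<odot> ginv g) = 0" if "\<Phi> h = 0" for g h
  proof -
    have h: "ca h = 0" "cx h = 0" "ct h = 0" using that by (auto simp: \<Phi>_def zero_prod_def)
    have "cx (g \<odot> h \<odot> ginv g) = 0" by (simp add: h xi linear_0[OF lflow] linear_neg[OF lflow] lA)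
    moreover have "ct (g \<odot> h \<odot> ginv g) = 0" by (simp add: h ci)
    \<comment> \<open>Conjugation by \<open>g\<close> leaves the same expression as the product of
      \<open>g\<close> with its inverse, so no formula for \<open>ca\<close> on inverses is
      required.\<close>
    moreover have "ca (g \<odot> h \<odot> ginv g) = ca g + ca (ginv g) + B (A (cx g)) (flow A (ct g) (cx (ginv g))) / 2"
      by (simp add: ca_mult h linear_0[OF lflow] B_simps)
    then have "ca (g \<odot> h \<odot> ginv g) = ca (g \<odot> ginv g)" by (simp only: ca_mult)
    then have "ca (g \<odot> h \<odot> ginv g) = 0" by simp
    ultimately show ?thesis by (simp add: \<Phi>_def zero_prod_def)
  qed
  have ik: "\<Phi> (ginv k) = 0"
    using ca_mult[of k "ginv k"] by (simp add: \<Phi>_def zero_prod_def ci xi k0 linear_0[OF lflow] A_simps B_simps)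
  have "g \<odot> k \<odot> ginv g = gone \<odot> k \<odot> ginv gone"
  proof (rule connected_local_const[OF connected_G UNIV_I UNIV_I, of "\<lambda>g. g \<odot> k \<odot> ginv g"], rule ballI)
    fix h
    \<comment> \<open>Then \<open>h^-1 g k g^-1 h'\<close> is \<open>h^-1 (g k g^-1) h k^-1\<close>.
      It lies in the kernel for every \<open>g\<close> and equals the unit at \<open>g = h\<close>,
      so isolation makes it the unit for \<open>g\<close> near \<open>h\<close>.\<close>
    define h' where "h' = h \<odot> ginv k"
    have "open ((\<lambda>g. ginv h \<odot> g \<odot> k \<odot> ginv g \<odot> h') -` T)"
      by (rule open_vimage[OF T(1) continuous_conj])
    moreover have "ginv h \<odot> h \<odot> k \<odot> ginv h \<odot> h' \<in> T" using T(2) by (simp add: h'_def g_assoc)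
    moreover have "h \<odot> k \<odot> ginv h = g \<odot> k \<odot> ginv g" if "ginv h \<odot> g \<odot> k \<odot> ginv g \<odot> h' \<in> T" for g
    proof -
      have e: "ginv h \<odot> g \<odot> k \<odot> ginv g \<odot> h' = (ginv h \<odot> (g \<odot> k \<odot> ginv g) \<odot> ginv (ginv h)) \<odot> ginv k"
        by (simp add: h'_def g_assoc)
      have "\<Phi> (ginv h \<odot> g \<odot> k \<odot> ginv g \<odot> h') = 0"
        unfolding e by (intro ker conj k ik)
      from T(3)[OF that this] have "ginv h \<odot> (g \<odot> k \<odot> ginv g) \<odot> h \<odot> ginv k = gone" by (simp add: h'_def g_assoc)
      then have "ginv h \<odot> (g \<odot> k \<odot> ginv g) \<odot> h = k"
        by (metis g_assoc g_inv(1) g_one)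
      then show ?thesis by (metis g_assoc g_inv(2) g_one g_inv_cancel(2))
    qed
    ultimately show "\<forall>\<^sub>F b in at h within UNIV. h \<odot> k \<odot> ginv h = b \<odot> k \<odot> ginv b"
      unfolding eventually_at_topological
      by (intro exI[of _ "(\<lambda>g. ginv h \<odot> g \<odot> k \<odot> ginv g \<odot> h') -` T"]) auto
  qed
  then show ?thesis by (metis g_assoc g_inv(1) g_one inv_one)
qed

lemma solvable_G: "solvable G"
proof -
  define N1 where "N1 = {g \<in> UNIV. ct g = 0}"
  define N2 where "N2 = {g \<in> N1. cx g = 0}"
  define N3 where "N3 = {g \<in> N2. ca g = 0}"
  have U: "subgroup UNIV G" using subgroup_self by simp
  have 1: "subgroup N1 G" "derived G UNIV \<subseteq> N1"
    unfolding N1_def by (rule derived_subset_of_additive[OF U], simp)+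
  have 2: "subgroup N2 G" "derived G N1 \<subseteq> N2"
    unfolding N2_def by (rule derived_subset_of_additive[OF 1(1)], simp add: N1_def lA)+
  have 3: "subgroup N3 G" "derived G N2 \<subseteq> N3"
    unfolding N3_def by (rule derived_subset_of_additive[OF 2(1)], simp add: N2_def N1_def ca_mult A_simps B_simps)+
  have "derived_set G N3 \<subseteq> {gone}"
  proof clarsimp
    fix h1 h2 assume "h1 \<in> N3"
    then have "h2 \<odot> h1 = h1 \<odot> h2" by (intro kernel_central) (auto simp: N3_def N2_def N1_def \<Phi>_def zero_prod_def)
    then show "h1 \<odot> h2 \<odot> ginv h1 \<odot> ginv h2 = gone" by (metis g_assoc g_inv(2) g_one)
  qed
  then have "derived G N3 \<subseteq> {gone}"
    unfolding derived_def by (rule generate_subgroup_incl[OF _ triv_subgroup])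
  \<comment> \<open>Three steps for the coordinates \<open>ct\<close>, \<open>cx\<close>,
    \<open>ca\<close>, and a fourth because their joint kernel is only known to be central, hence
    abelian.\<close>
  have "(derived G ^^ 4) UNIV = derived G (derived G (derived G (derived G UNIV)))"
    by (simp add: numeral_eq_Suc)
  also have "\<dots> \<subseteq> derived G (derived G (derived G N1))" by (intro mono_derived 1)
  also have "\<dots> \<subseteq> derived G (derived G N2)" by (intro mono_derived 2)
  also have "\<dots> \<subseteq> derived G N3" by (intro mono_derived 3)
  also have "\<dots> \<subseteq> {gone}" by fact
  finally have "(derived G ^^ 4) UNIV \<subseteq> {gone}" .
  moreover have "gone \<in> (derived G ^^ 4) UNIV"
    using subgroup.one_closed[OF exp_of_derived_is_subgroup[OF U]] .
  ultimately have "(derived G ^^ 4) (carrier G) = {gone}" by auto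
  then show ?thesis using solvable_iff_trivial_derived_seq by blast
qed

section \<open>A smooth local inverse of the coordinates\<close>

lemma smooth_\<Theta>: "smooth_at (\<lambda>p. \<Theta> p v) p"
proof -
  have "smooth_at (\<lambda>p :: real \<times> 'v \<times> real. (fst v - (1/2) * B (A (fst (snd p))) (fst (snd v)),
      flow A (- snd (snd p)) (fst (snd v)), snd (snd v))) p"
    by (intro smooth_at_Pair smooth_at_diff smooth_at_mult smooth_at_const smooth_at_bounded_bilinear[OF bbB]
       smooth_at_bounded_linear[OF blA] smooth_at_fst smooth_at_snd smooth_at_id smooth_at_flow[OF lA] smooth_at_minus)
  then show ?thesis by (simp add: \<Theta>_def[abs_def])
qed

text \<open>The inverse function theorem for \<open>\<Phi> \<circ> \<eta>\<close> at
  \<open>0\<close> supplies an inverse with a first derivative. Higher regularity comes from the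
  logarithmic derivative of the inverse, which is the explicit smooth
  \<open>\<Theta>\<close>.\<close>

lemma local_inverse:
  obtains V \<Psi> where "open V" "0 \<in> V" "\<Psi> 0 = gone" "\<And>p. p \<in> V \<Longrightarrow> plot_at M \<Psi> p" "\<And>p. p \<in> V \<Longrightarrow> \<Phi> (\<Psi> p) = p"
proof -
  define Q where "Q x = \<Phi> (\<eta> x)" for x
  obtain N where N: "open N" "0 \<in> N" "\<And>x. x \<in> N \<Longrightarrow> plot_at M \<eta> x"
    using eventually_plot_eta unfolding eventually_nhds by blast
  have sQ: "smooth_at Q x" if "x \<in> N" for x
    unfolding Q_def by (rule mfd_smooth_at_plot[OF smooth_\<Phi> N(3)[OF that]])
  define Q' where "Q' x = Blinfun (frechet_derivative Q (at x))" for x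
  have Q'a: "blinfun_apply (Q' x) = frechet_derivative Q (at x)" if "x \<in> N" for x
    unfolding Q'_def using bounded_linear_Blinfun_apply has_derivative_bounded_linear smooth_at_has_derivative[OF sQ[OF that]] by blast
  have Q0: "frechet_derivative Q (at 0) = (\<lambda>X. X)"
  proof
    fix X show "frechet_derivative Q (at 0) X = X"
      using ld_\<Phi>[of "fst X" "fst (snd X)" "snd (snd X)" gone]
      by (simp add: left_deriv_def Q_def[abs_def] lA A_simps B_simps)
  qed
  obtain U' V \<zeta> \<zeta>' where iv: "open U'" "U' \<subseteq> N" "0 \<in> U'" "open V" "Q 0 \<in> V" "homeomorphism U' V Q \<zeta>"
    "\<And>y. y \<in> V \<Longrightarrow> (\<zeta> has_derivative (\<zeta>' y)) (at y)"
  proof (rule inverse_function_theorem[OF N(1) _ _ N(2), of Q Q' id_blinfun])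
    show "(Q has_derivative blinfun_apply (Q' x)) (at x)" if "x \<in> N" for x
      unfolding Q'a[OF that] by (rule smooth_at_has_derivative[OF sQ[OF that]])
    show "continuous_on N Q'"
    proof (rule continuous_on_blinfun_componentwise)
      fix i :: "real \<times> 'v \<times> real"
      have "continuous_on N (\<lambda>x. frechet_derivative Q (at x) i)"
        by (rule continuous_at_imp_continuous_on) (use smooth_at_isCont[OF smooth_at_frechet_derivative[OF sQ]] in blast)
      then show "continuous_on N (\<lambda>x. blinfun_apply (Q' x) i)"
        by (rule continuous_on_eq) (simp add: Q'a)
    qed
    show "id_blinfun o\<^sub>L Q' 0 = id_blinfun"
      by (rule blinfun_eqI) (simp add: Q'a[OF N(2)] Q0)
  qed (rule that)
  have "\<Phi> gone = 0" by (simp add: \<Phi>_def zero_prod_def)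
  then have Q00: "Q 0 = 0" by (simp add: Q_def)
  define \<Psi> where "\<Psi> p = \<eta> (\<zeta> p)" for p
  have zU: "\<zeta> p \<in> U'" if "p \<in> V" for p using iv(6) that unfolding homeomorphism_def by blast
  have Qz: "Q (\<zeta> p) = p" if "p \<in> V" for p using iv(6) that unfolding homeomorphism_def by blast
  have pe: "plot_at M \<eta> (\<zeta> p)" if "p \<in> V" for p using N(3) iv(2) zU[OF that] by blast
  have cz: "isCont \<zeta> p" if "p \<in> V" for p using has_derivative_continuous[OF iv(7)[OF that]] .
  have cP: "isCont \<Psi> p" if "p \<in> V" for p
    unfolding \<Psi>_def by (rule isCont_o2[OF cz[OF that] plot_atD(1)[OF pe[OF that]]])
  have PP: "\<Phi> (\<Psi> p) = p" if "p \<in> V" for p using Qz[OF that] by (simp add: Q_def \<Psi>_def)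
  define mc where "mc p v = maurer_cartan \<eta> (\<zeta> p) (\<zeta>' p v)" for p v
  have der: "((\<lambda>p. f (\<Psi> p)) has_derivative (\<lambda>v. ld (mc p v) f (\<Psi> p))) (at p)"
    if "p \<in> V" "mfd_smooth_at M f (\<Psi> p)" for p and f :: "'g \<Rightarrow> 'z::euclidean_space"
  proof -
    have f: "mfd_smooth_at M f (\<eta> (\<zeta> p))" using that(2) by (simp add: \<Psi>_def)
    have "((\<lambda>p. f (\<eta> (\<zeta> p))) has_derivative (\<lambda>v. frechet_derivative (\<lambda>x. f (\<eta> x)) (at (\<zeta> p)) (\<zeta>' p v))) (at p)"
      by (rule has_derivative_compose[OF iv(7)[OF that(1)] smooth_at_has_derivative[OF mfd_smooth_at_plot[OF f pe[OF that(1)]]]])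
    then show ?thesis
      unfolding frechet_derivative_plot[OF f pe[OF that(1)]] by (simp add: \<Psi>_def mc_def)
  qed
  \<comment> \<open>Differentiating \<open>\<Phi> (\<Psi> p) = p\<close> determines the velocity of
    \<open>\<Psi>\<close>, since \<open>\<Theta>\<close> inverts the differential of
    \<open>\<Phi>\<close>.\<close>
  have mcT: "mc p v = \<Theta> p v" if "p \<in> V" for p v
  proof -
    have ev: "\<forall>\<^sub>F q in nhds p. \<Phi> (\<Psi> q) = q"
      using eventually_nhds_in_open[OF iv(4) that] by eventually_elim (rule PP)
    have "ld (mc p v) \<Phi> (\<Psi> p) = v"
      using fun_cong[OF frechet_derivative_at[OF der[OF that smooth_\<Phi>]], of v]
        fun_cong[OF frechet_derivative_cong[OF ev], of v] frechet_derivative_at[OF has_derivative_ident, of p] by metis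
    then show ?thesis using \<Theta>_ld(1)[of "\<Psi> p" "mc p v"] PP[OF that] by simp
  qed
  have pP: "plot_at M \<Psi> p" if p: "p \<in> V" for p
  proof -
    obtain U c where U: "(U, c) \<in> M" "\<Psi> p \<in> U" by (rule chart_ex)
    define V0 where "V0 = V \<inter> \<Psi> -` U"
    have "continuous_on V \<Psi>" using cP by (simp add: continuous_at_imp_continuous_on)
    then have o: "open V0" unfolding V0_def using iv(4) chart_open[OF U(1)] continuous_open_preimage by blast
    \<comment> \<open>The total differential equation satisfied by \<open>c \<circ> \<Psi>\<close>:
      its derivative is a smooth function of the point and of the value, as
      \<open>smooth_on_bootstrap\<close> requires.\<close>
    define D where "D v z = ld (\<Theta> (fst z) v) c (inv_into U c (snd z))" for v z
    have "smooth_on V0 (\<lambda>p. c (\<Psi> p))"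
    proof (rule smooth_on_bootstrap[OF o, where D=D and T="V0 \<times> c ` U"])
      show "open (V0 \<times> c ` U)" using o chart_image_open[OF U(1)] by (rule open_Times)
      show "((\<lambda>p. c (\<Psi> p)) has_derivative (\<lambda>v. D v (q, c (\<Psi> q)))) (at q)" if "q \<in> V0" for q
        using der[of q c] that mfd_smooth_at_chart[OF U(1)] mcT[of q] by (simp add: V0_def D_def chart_inv[OF U(1)])
      show "(q, c (\<Psi> q)) \<in> V0 \<times> c ` U" if "q \<in> V0" for q using that by (auto simp: V0_def)
      fix v
      have "smooth_at (D v) (q, y)" if "y \<in> c ` U" for q y
        unfolding D_def
      proof (rule smooth_at_linear_apply[where L="\<lambda>z X. ld X c (inv_into U c (snd z))" and f="\<lambda>z. \<Theta> (fst z) v"])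
        have cU: "mfd_smooth_at M c (inv_into U c y)" if "y \<in> c ` U" for y
          by (rule mfd_smooth_at_chart[OF U(1) chart_inv_mem[OF U(1) that]])
        have "open (UNIV \<times> c ` U)" using chart_image_open[OF U(1)] by (simp add: open_Times)
        then have "\<forall>\<^sub>F z in nhds (q, y). z \<in> UNIV \<times> c ` U" using that eventually_nhds_in_open by blast
        then show "\<forall>\<^sub>F z in nhds (q, y). linear (\<lambda>X. ld X c (inv_into U c (snd z)))"
          by eventually_elim (rule linear_ld[OF cU], auto)
        show "smooth_at (\<lambda>z. ld X c (inv_into U c (snd z))) (q, y)" for X
          by (rule smooth_at_compose[where f=snd and g="\<lambda>y. ld X c (inv_into U c y)"])
            (simp_all add: smooth_at_ld_plot[OF cU plot_chart_inv[OF U(1)]] that smooth_at_linear bounded_linear_snd)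
        show "smooth_at (\<lambda>z. \<Theta> (fst z) v) (q, y)"
          by (rule smooth_at_compose[where f=fst and g="\<lambda>p. \<Theta> p v"])
            (simp_all add: smooth_\<Theta> smooth_at_linear bounded_linear_fst)
      qed
      then show "smooth_on (V0 \<times> c ` U) (D v)"
        unfolding smooth_on_iff_smooth_at[OF \<open>open (V0 \<times> c ` U)\<close>] by blast
    qed
    then have "smooth_at (\<lambda>p. c (\<Psi> p)) p" by (rule smooth_atI[OF o, rotated]) (use p U in \<open>simp add: V0_def\<close>)
    then show ?thesis by (rule plot_atI[OF cP[OF p] U])
  qed
  show thesis
  proof (rule that[of V \<Psi>])
    show "0 \<in> V" using iv(5) Q00 by simp
    have "\<zeta> 0 = 0" using iv(3,6) Q00 unfolding homeomorphism_def by metis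
    then show "\<Psi> 0 = gone" by (simp add: \<Psi>_def)
  qed (use iv(4) pP PP in auto)
qed

end

section \<open>Curvature and indecomposability\<close>

lemma sum_Basis_Times:
  "sum f (Basis :: ('a::euclidean_space \<times> 'b::euclidean_space) set) = (\<Sum>b\<in>Basis. f (b, 0)) + (\<Sum>b\<in>Basis. f (0, b))"
proof -
  have "sum f (Basis :: ('a \<times> 'b) set) = sum f ((\<lambda>u. (u, 0)) ` Basis) + sum f ((\<lambda>v. (0, v)) ` Basis)"
    unfolding Basis_prod_def by (rule sum.union_disjoint) auto
  moreover have "sum f ((\<lambda>u::'a. (u, 0::'b)) ` Basis) = (\<Sum>b\<in>Basis. f (b, 0))"
    by (subst sum.reindex) (auto simp: inj_on_def)
  moreover have "sum f ((\<lambda>v::'b. (0::'a, v)) ` Basis) = (\<Sum>b\<in>Basis. f (0, b))"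
    by (subst sum.reindex) (auto simp: inj_on_def)
  ultimately show ?thesis by simp
qed

lemma lin_trace_prod3:
  fixes T :: "real \<times> 'v::euclidean_space \<times> real \<Rightarrow> real \<times> 'v \<times> real"
  shows "lin_trace T = fst (T (1, 0, 0)) + (\<Sum>b\<in>Basis. fst (snd (T (0, b, 0))) \<bullet> b) + snd (snd (T (0, 0, 1)))"
  unfolding lin_trace_def sum_Basis_Times by (simp add: inner_prod_def zero_prod_def)

locale dext_levi_civita = dext_group B A G M \<eta>
  for B :: "'v::euclidean_space \<Rightarrow> 'v \<Rightarrow> real" and A
    and G :: "('g::{t2_space,second_countable_topology}, 'r) monoid_scheme"
    and M :: "('g, 'e::euclidean_space) atlas"
    and \<eta> :: "real \<times> 'v \<times> real \<Rightarrow> 'g" +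
  fixes nabla :: "('g \<Rightarrow> real \<times> 'v \<times> real) \<Rightarrow> ('g \<Rightarrow> real \<times> 'v \<times> real) \<Rightarrow> 'g \<Rightarrow> real \<times> 'v \<times> real"
  assumes lc: "levi_civita G M \<eta> (dext_form B) nabla"
begin

lemma smooth_const: "smooth_fun_on M UNIV (\<lambda>_. X)"
  by (simp add: smooth_fun_on_iff mfd_smooth_at_const)

lemma nabla_metric: "Bf (nabla (\<lambda>_. x) (\<lambda>_. y) g) z + Bf y (nabla (\<lambda>_. x) (\<lambda>_. z) g) = 0"
proof -
  have "ld x (\<lambda>h. Bf y z) g = Bf (nabla (\<lambda>_. x) (\<lambda>_. y) g) z + Bf y (nabla (\<lambda>_. x) (\<lambda>_. z) g)"
    using lc smooth_const[of x] smooth_const[of y] smooth_const[of z]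
    unfolding levi_civita_def metric_connection_def by blast
  then show ?thesis by (simp add: ld_const)
qed

lemma nabla_torsion: "nabla (\<lambda>_. x) (\<lambda>_. y) g - nabla (\<lambda>_. y) (\<lambda>_. x) g = br x y"
proof (rule ld_injective[where g=g])
  have tf: "torsion_free G M \<eta> nabla" using lc by (simp add: levi_civita_def)
  fix f :: "'g \<Rightarrow> real" and W assume W: "open W" "g \<in> W" "\<And>h. h \<in> W \<Longrightarrow> mfd_smooth_at M f h"
  then have "smooth_fun_on M W f" by (simp add: smooth_fun_on_iff)
  then have "ld (nabla (\<lambda>_. x) (\<lambda>_. y) g - nabla (\<lambda>_. y) (\<lambda>_. x) g) f g = ld x (ld y f) g - ld y (ld x f) g"
    using tf[unfolded torsion_free_def, rule_format, of "\<lambda>_. x" "\<lambda>_. y" W f g] W(1,2) smooth_const[of x] smooth_const[of y]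
    by blast
  from this ld_bracket[OF W, of x y, symmetric]
  show "ld (nabla (\<lambda>_. x) (\<lambda>_. y) g - nabla (\<lambda>_. y) (\<lambda>_. x) g) f g = ld (br x y) f g" by (rule trans)
qed

text \<open>Koszul's formula. Derivatives of constant scalar products vanish, and ad-invariance
  makes \<open>Bf (br x y) z\<close> totally skew, so the three bracket terms collapse to
  one.\<close>

lemma nabla_const: "nabla (\<lambda>_. x) (\<lambda>_. y) = (\<lambda>_. (1/2) *\<^sub>R br x y)"
proof
  fix g
  define C where "C x y z = Bf (nabla (\<lambda>_. x) (\<lambda>_. y) g) z" for x y z
  define T where "T x y z = Bf (br x y) z" for x y z
  have 1: "C x y z = - C x z y" for x y z
    using nabla_metric[of x y g z] Bf_sym[of y "nabla (\<lambda>_. x) (\<lambda>_. z) g"] by (simp add: C_def)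
  have 2: "C x y z - C y x z = T x y z" for x y z
    using nabla_torsion[of x y g] by (simp add: C_def T_def flip: bilinear_lsub[OF bBf])
  have 3: "T x y z = - T y x z" for x y z
  proof -
    have "br x y = - br y x"
      using B_skew[of "fst (snd x)" "fst (snd y)"] B_sym[of "fst (snd x)" "A (fst (snd y))"]
      by (cases x; cases y) simp
    then show ?thesis by (simp only: T_def bilinear_lneg[OF bBf])
  qed
  have 4: "T x y z = - T x z y" for x y z
    using Bf_ad[of x y z] Bf_sym[of y "br x z"] by (simp add: T_def)
  have "Bf (nabla (\<lambda>_. x) (\<lambda>_. y) g - (1/2) *\<^sub>R br x y) z = 0" for z
  proof -
    \<comment> \<open>\<open>C\<close> is skew in its last two slots and its skew part in the first
      two is \<open>T\<close>; cycling through the three arguments solves for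
      \<open>C\<close>.\<close>
    have "2 * C x y z = T x y z"
      using 1[of y x z] 1[of z y x] 1[of x z y] 2[of x y z] 2[of y z x] 2[of z x y] 3[of z x y] 4[of x z y] 3[of y z x] 4[of z y x] 3[of z x y]
      by linarith
    then show ?thesis by (simp add: C_def T_def bilinear_lsub[OF bBf] bilinear_lmul[OF bBf])
  qed
  from Bf_nondeg[OF this] show "nabla (\<lambda>_. x) (\<lambda>_. y) g = (1/2) *\<^sub>R br x y" by simp
qed

text \<open>This is \<open>R(x, y) z = - [[x, y], z] / 4\<close>, which the Jacobi identity yields
  from \<open>\<nabla>_x y = [x, y] / 2\<close>.\<close>

lemma curvature_eq:
  "curvature br nabla g (a, X, h) (b, Y, k) (c, Z, l) =
     (- (h * B (A (A Y)) Z - k * B (A (A X)) Z) / 4, (l / 4) *\<^sub>R (h *\<^sub>R A (A Y) - k *\<^sub>R A (A X)), 0)"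
proof -
  have s: "B (A X) (A Z) = - B (A (A X)) Z" "B (A Y) (A Z) = - B (A (A Y)) Z"
    using B_skew[of "A X" Z] B_skew[of "A Y" Z] by simp_all
  have s': "B (A X) (A Y) = B (A Y) (A X)" by (rule B_sym)
  show ?thesis
    unfolding curvature_def nabla_const
    by (simp add: A_simps B_simps s s')
      (rule conjI, simp add: field_simps, simp add: algebra_simps flip: scaleR_left_distrib)
qed

lemma ricci_eq: "ricci br nabla g (b, Y, k) (c, Z, l) = - (k * l * lin_trace (A \<circ> A)) / 4"
  by (simp add: ricci_def lin_trace_prod3 curvature_eq A_simps B_simps)
    (simp add: lin_trace_def sum_distrib_left sum_negf mult.commute flip: sum_divide_distrib)

lemma ricci_op_eq: "ricci_op br Bf nabla g (b, Y, k) = (- (k * lin_trace (A \<circ> A)) / 4, 0, 0)"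
  unfolding ricci_op_def
proof (rule the_equality)
  show *: "\<forall>z. Bf (- (k * lin_trace (A \<circ> A)) / 4, 0, 0) z = ricci br nabla g (b, Y, k) z"
    by (auto simp: ricci_eq B_simps)
  fix u assume u: "\<forall>z. Bf u z = ricci br nabla g (b, Y, k) z"
  have "u - (- (k * lin_trace (A \<circ> A)) / 4, 0, 0) = 0"
    by (rule Bf_nondeg) (simp only: bilinear_lsub[OF bBf] spec[OF u] spec[OF *] diff_self)
  then show "u = (- (k * lin_trace (A \<circ> A)) / 4, 0, 0)" by simp
qed

lemma scalar_curvature_zero: "scalar_curvature br Bf nabla g = 0"
  by (simp add: scalar_curvature_def lin_trace_prod3 ricci_op_eq)

lemma ricci_op_nilpotent: "ricci_op br Bf nabla g \<circ> ricci_op br Bf nabla g = (\<lambda>_. 0)"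
  by (rule ext) (auto simp: ricci_op_eq zero_prod_def)

lemma ricci_flat_iff: "ricci_flat br nabla \<longleftrightarrow> lin_trace (A \<circ> A) = 0"
proof
  assume "ricci_flat br nabla"
  then have "ricci br nabla undefined (0, 0, 1) (0, 0, 1) = 0" by (simp add: ricci_flat_def)
  then show "lin_trace (A \<circ> A) = 0" by (simp add: ricci_eq)
qed (auto simp: ricci_flat_def ricci_eq)

lemma flat_iff: "flat br nabla \<longleftrightarrow> A \<circ> A = (\<lambda>_. 0)"
proof
  assume f: "flat br nabla"
  have "curvature br nabla undefined (0, 0, 1) (0, Y, 0) (0, 0, 1) = 0" for Y using f by (simp only: flat_def)
  then have "A (A Y) = 0" for Y by (simp add: curvature_eq zero_prod_def)
  then show "A \<circ> A = (\<lambda>_. 0)" by (simp add: fun_eq_iff)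
next
  assume "A \<circ> A = (\<lambda>_. 0)"
  then have "A (A Y) = 0" for Y by (simp add: fun_eq_iff)
  then show "flat br nabla" by (auto simp: flat_def curvature_eq B_simps zero_prod_def)
qed

end

section \<open>Orthogonal decompositions of the double extension\<close>

context abelian_metric
begin

text \<open>A kernel vector \<open>z\<close> with \<open>B z z \<noteq> 0\<close> is central and
  spans a non-degenerate line, which splits off together with its orthogonal complement.\<close>

lemma indecomposable_imp_isotropic:
  assumes "indecomposable br Bf"
  shows "totally_isotropic B {x. A x = 0}"
proof (rule ccontr)
  assume "\<not> totally_isotropic B {x. A x = 0}"
  then obtain x y where xy: "A x = 0" "A y = 0" "B x y \<noteq> 0" by (auto simp: totally_isotropic_def)
  \<comment> \<open>Polarisation: if both \<open>x\<close> and \<open>y\<close> are null, then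
    \<open>x + y\<close> is not.\<close>
  obtain z where z: "A z = 0" "B z z \<noteq> 0"
  proof (cases "B x x = 0 \<and> B y y = 0")
    case True
    then have "B (x + y) (x + y) = 2 * B x y" using B_sym[of x y] by (simp add: B_simps)
    with xy that[of "x + y"] show thesis by (simp add: A_simps)
  qed (use that xy in blast)
  \<comment> \<open>The image of \<open>A\<close> is orthogonal to its kernel; this is what closes
    \<open>V\<close> under the bracket.\<close>
  have Az: "B (A X) z = 0" for X using B_skew[of X z] z by (simp add: B_simps)
  define U where "U = {(0 :: real, s *\<^sub>R z, 0 :: real) | s. True}"
  define V where "V = {(a :: real, X, h :: real) | a X h. B X z = 0}"
  note ml = dext_metric[unfolded metric_lie_algebra_on_def]
  have sU: "subspace U"
    unfolding subspace_def U_def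
    by (auto simp: zero_prod_def simp flip: scaleR_left_distrib)
  have sV: "subspace V" unfolding subspace_def V_def by (auto simp: zero_prod_def B_simps)
  have "metric_lie_algebra_on U br Bf"
    unfolding metric_lie_algebra_on_def
  proof (intro conjI)
    show "\<forall>u\<in>U. \<forall>v\<in>U. br u v \<in> U"
      by (auto simp: U_def A_simps z B_simps)
    show "\<forall>u\<in>U. (\<forall>v\<in>U. Bf u v = 0) \<longrightarrow> u = 0"
    proof (intro ballI impI)
      fix u assume u: "u \<in> U" "\<forall>v\<in>U. Bf u v = 0"
      then obtain s where s: "u = (0, s *\<^sub>R z, 0)" by (auto simp: U_def)
      have "(0, 1 *\<^sub>R z, 0) \<in> U" unfolding U_def by blast
      then have "Bf u (0, 1 *\<^sub>R z, 0) = 0" using u by blast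
      then show "u = 0" using z by (simp add: s B_simps zero_prod_def)
    qed
  qed (use ml sU in blast)+
  moreover have "metric_lie_algebra_on V br Bf"
    unfolding metric_lie_algebra_on_def
  proof (intro conjI)
    show "\<forall>u\<in>V. \<forall>v\<in>V. br u v \<in> V"
      by (auto simp: V_def B_simps Az)
    show "\<forall>u\<in>V. (\<forall>v\<in>V. Bf u v = 0) \<longrightarrow> u = 0"
    proof (intro ballI impI)
      fix u assume u: "u \<in> V" "\<forall>v\<in>V. Bf u v = 0"
      then obtain a X h where s: "u = (a, X, h)" "B X z = 0" by (auto simp: V_def)
      have "Bf u (b, Y, k) = 0" for b Y k
      proof -
        define r where "r = B Y z / B z z"
        have "(b, Y - r *\<^sub>R z, k) \<in> V" using z by (simp add: V_def r_def B_simps)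
        then have "Bf u (b, Y - r *\<^sub>R z, k) = 0" using u by blast
        then show ?thesis using s by (simp add: B_simps)
      qed
      then show "u = 0" by (intro Bf_nondeg) auto
    qed
  qed (use ml sV in blast)+
  moreover have "U \<noteq> {0}"
  proof
    assume "U = {0}"
    moreover have "(0, 1 *\<^sub>R z, 0) \<in> U" unfolding U_def by blast
    ultimately show False using z by (auto simp: zero_prod_def B_simps)
  qed
  moreover have "V \<noteq> {0}"
  proof
    assume "V = {0}"
    moreover have "(1, 0, 0) \<in> V" by (simp add: V_def B_simps)
    ultimately show False by (auto simp: zero_prod_def)
  qed
  moreover have "U \<inter> V = {0}" using z by (auto simp: U_def V_def B_simps zero_prod_def)
  moreover have "{u + v | u v. u \<in> U \<and> v \<in> V} = UNIV"
  proof -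
    have "(a, X, h) \<in> {u + v | u v. u \<in> U \<and> v \<in> V}" for a X h
    proof -
      define r where "r = B X z / B z z"
      have "(0, r *\<^sub>R z, 0) \<in> U" unfolding U_def by blast
      moreover have "(a, X - r *\<^sub>R z, h) \<in> V" using z by (simp add: V_def r_def B_simps)
      moreover have "(a, X, h) = (0, r *\<^sub>R z, 0) + (a, X - r *\<^sub>R z, h)" by simp
      ultimately show ?thesis by blast
    qed
    then show ?thesis by auto
  qed
  moreover have "\<forall>u\<in>U. \<forall>v\<in>V. br u v = 0 \<and> Bf u v = 0"
    using B_sym[of z] by (auto simp: U_def V_def B_simps A_simps z zero_prod_def)
  ultimately show False using assms unfolding indecomposable_def by blast
qed

text \<open>If \<open>V\<close> also met elements with non-zero \<open>H\<close>-component,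
  vanishing brackets would force \<open>A Z\<close> to be the \<open>H\<close>-component times
  \<open>A X\<close> on both summands, so \<open>A = 0\<close> on \<open>g\<close>. Hence
  \<open>V\<close> has no \<open>H\<close>-component, its \<open>g\<close>-components lie in the
  kernel of \<open>A\<close>, and \<open>V\<close> is totally isotropic, which contradicts
  non-degeneracy.\<close>

lemma isotropic_no_complement:
  assumes iso: "totally_isotropic B {x. A x = 0}" and A0: "A \<noteq> (\<lambda>_. 0)"
    and U: "metric_lie_algebra_on U br Bf" and V: "metric_lie_algebra_on V br Bf" "V \<noteq> {0}"
    and span: "{u + v | u v. u \<in> U \<and> v \<in> V} = UNIV"
    and orth: "\<forall>u\<in>U. \<forall>v\<in>V. br u v = 0 \<and> Bf u v = 0"
    and u: "(a, X, 1) \<in> U"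
  shows False
proof -
  have sU: "subspace U" and sV: "subspace V" using U V by (auto simp: metric_lie_algebra_on_def)
  have comm: "A Y = k *\<^sub>R A X" if "(b, Y, k) \<in> V" for b Y k
    using orth u that by (auto simp: zero_prod_def dest!: bspec)
  have hV: "k = 0" if v: "(b, Y, k) \<in> V" for b Y k
  proof (rule ccontr)
    assume k: "k \<noteq> 0"
    have c: "A Z = l *\<^sub>R A X" if z: "(c, Z, l) \<in> U" for c Z l
    proof -
      have "l *\<^sub>R A Y - k *\<^sub>R A Z = 0" using orth z v by (auto simp: zero_prod_def dest!: bspec)
      then have "k *\<^sub>R A Z = k *\<^sub>R (l *\<^sub>R A X)" using comm[OF v] by (simp add: mult.commute)
      then show ?thesis using k by (simp only: scaleR_cancel_left simp_thms)
    qed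
    have "A Z = 0" for Z
    proof -
      have "(0, Z, 0) \<in> {u + v | u v. u \<in> U \<and> v \<in> V}" using span by simp
      then obtain c1 Z1 l1 c2 Z2 l2 where *: "(c1, Z1, l1) \<in> U" "(c2, Z2, l2) \<in> V"
        "(0, Z, 0) = (c1, Z1, l1) + (c2, Z2, l2)" by auto
      then have Z: "Z = Z1 + Z2" "l1 + l2 = 0" by auto
      have "A Z = (l1 + l2) *\<^sub>R A X"
        using c[OF *(1)] comm[OF *(2)] by (simp add: Z(1) A_simps scaleR_left_distrib)
      then show ?thesis by (simp add: Z)
    qed
    then show False using A0 by blast
  qed
  have "v = 0" if v: "v \<in> V" for v
  proof -
    have "Bf v w = 0" if "w \<in> V" for w
    proof -
      obtain b Y k where v': "v = (b, Y, k)" by (cases v)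
      obtain c Z l where w': "w = (c, Z, l)" by (cases w)
      have "k = 0" "l = 0" using hV v that by (auto simp: v' w')
      then have "A Y = 0" "A Z = 0" using comm v that by (auto simp: v' w')
      then show ?thesis using iso \<open>k = 0\<close> \<open>l = 0\<close> by (simp add: v' w' totally_isotropic_def)
    qed
    then show ?thesis using V(1) v unfolding metric_lie_algebra_on_def by blast
  qed
  moreover have "0 \<in> V" using sV by (simp add: subspace_0)
  ultimately show False using V(2) by blast
qed

lemma indecomposable_iff:
  assumes A0: "A \<noteq> (\<lambda>_. 0)"
  shows "indecomposable br Bf \<longleftrightarrow> totally_isotropic B {x. A x = 0}"
proof
  assume iso: "totally_isotropic B {x. A x = 0}"
  show "indecomposable br Bf"
    unfolding indecomposable_def
  proof (intro notI, elim exE conjE)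
    fix U V assume UV: "metric_lie_algebra_on U br Bf" "metric_lie_algebra_on V br Bf" "U \<noteq> {0}" "V \<noteq> {0}"
      "{u + v | u v. u \<in> U \<and> v \<in> V} = UNIV" "\<forall>u\<in>U. \<forall>v\<in>V. br u v = 0 \<and> Bf u v = 0"
    have sU: "subspace U" and sV: "subspace V" using UV by (auto simp: metric_lie_algebra_on_def)
    \<comment> \<open>Decomposing \<open>H\<close> itself shows that one of the two summands has an
      element with non-zero \<open>H\<close>-component; the other one is then excluded.\<close>
    have "(0, 0, 1) \<in> {u + v | u v. u \<in> U \<and> v \<in> V}" using UV(5) by simp
    then obtain a X h b Y k where *: "(a, X, h) \<in> U" "(b, Y, k) \<in> V" "h + k = (1::real)" by auto
    have br0: "br v u = 0 \<and> Bf v u = 0" if "u \<in> U" "v \<in> V" for u v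
    proof -
      have "br u v = 0" "Bf u v = 0" using UV(6) that by auto
      then show ?thesis using Bf_sym[of u v] B_skew[of "fst (snd u)" "fst (snd v)"] B_sym[of "fst (snd u)" "A (fst (snd v))"]
        by (cases u; cases v) (auto simp: zero_prod_def)
    qed
    show False
    proof (cases "h = 0")
      case False
      have "(1 / h) *\<^sub>R (a, X, h) \<in> U" using sU *(1) by (rule subspace_scale)
      then have "(a / h, (1 / h) *\<^sub>R X, 1) \<in> U" using False by simp
      from isotropic_no_complement[OF iso A0 UV(1,2,4,5,6) this] show False .
    next
      case True
      then have "(b, Y, 1) \<in> V" using * by simp
      moreover have "{u + v | u v. u \<in> V \<and> v \<in> U} = UNIV"
      proof -
        have "{u + v | u v. u \<in> V \<and> v \<in> U} = {u + v | u v. u \<in> U \<and> v \<in> V}"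
          by (auto simp: add.commute) (metis add.commute)+
        then show ?thesis using UV(5) by simp
      qed
      ultimately show False using isotropic_no_complement[OF iso A0 UV(2,1,3), of b Y] br0 by blast
    qed
  qed
qed (rule indecomposable_imp_isotropic)

end

section \<open>Holonomy\<close>

lemma flow_hvd:
  assumes "linear T" "(f has_vector_derivative f') (at s)" "(g has_vector_derivative g') (at s)"
  shows "((\<lambda>s. flow T (f s) (g s)) has_vector_derivative (f' *\<^sub>R flow T (f s) (T (g s)) + flow T (f s) g')) (at s)"
  using has_derivative_flow[OF assms(1) assms(2,3)[unfolded has_vector_derivative_def]]
  unfolding has_vector_derivative_def
  by (simp add: scaleR_add_right linear_cmul[OF linear_flow[OF assms(1)]])

lemma hvd_bounded_linear:
  "bounded_linear L \<Longrightarrow> (f has_vector_derivative f') (at s) \<Longrightarrow> ((\<lambda>s. L (f s)) has_vector_derivative L f') (at s)"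
  by (rule bounded_linear.has_vector_derivative)

lemma hvd_zero_const:
  fixes f :: "real \<Rightarrow> 'b::banach"
  assumes "finite S" "continuous_on {0..1} f" "\<And>s. s \<in> {0<..<1} - S \<Longrightarrow> (f has_vector_derivative 0) (at s)" "s \<in> {0..1}"
  shows "f s = f 0"
proof (rule has_derivative_zero_unique_strong_interval[of "insert 0 (insert 1 S)" 0 1])
  show "(f has_derivative (\<lambda>h. 0)) (at x within {0..1})" if "x \<in> {0..1} - insert 0 (insert 1 S)" for x
    using assms(3)[of x] that by (auto simp: has_vector_derivative_def intro: has_derivative_at_withinI)
qed (use assms in auto)

text \<open>The component of \<open>z\<close> orthogonal to \<open>W\<close> is itself an admissible
  test vector. Membership in \<open>W\<close> can thus be integrated along a curve one functional at
  a time.\<close>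

lemma subspace_memI:
  fixes W :: "'v::euclidean_space set"
  assumes W: "subspace W" and z: "\<And>c. (\<And>w. w \<in> W \<Longrightarrow> w \<bullet> c = 0) \<Longrightarrow> z \<bullet> c = 0"
  shows "z \<in> W"
proof -
  obtain y c where yc: "y \<in> span W" "\<And>w. w \<in> span W \<Longrightarrow> orthogonal c w" "z = y + c"
    using orthogonal_subspace_decomp_exists[of W z] by blast
  have "z \<bullet> c = 0" using yc(2) span_base by (intro z) (auto simp: orthogonal_def inner_commute)
  moreover have "y \<bullet> c = 0" using yc(1,2) by (simp add: orthogonal_def inner_commute[of y])
  ultimately have "c = 0" using yc(3) by (simp add: inner_add_left)
  then show ?thesis using yc W by (metis add.right_neutral span_eq_iff)
qed

locale dext_holonomy = dext_coords B A G M \<eta> ca cx ct + dext_levi_civita B A G M \<eta> nabla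
  for B :: "'v::euclidean_space \<Rightarrow> 'v \<Rightarrow> real" and A
    and G :: "('g::{t2_space,second_countable_topology}, 'r) monoid_scheme"
    and M :: "('g, 'e::euclidean_space) atlas"
    and \<eta> :: "real \<times> 'v \<times> real \<Rightarrow> 'g" and ca cx ct nabla
begin

abbreviation W where "W \<equiv> range (\<lambda>X. A (A X))"

lemma subspace_W: "subspace W"
proof -
  have "linear (\<lambda>X. A (A X))" using linear_compose[OF lA lA] by (simp add: o_def)
  then show ?thesis by (rule linear_subspace_image) (rule subspace_UNIV)
qed

lemma has_velocity_vector:
  fixes f :: "'g \<Rightarrow> 'z::euclidean_space"
  assumes "has_velocity G M \<eta> \<gamma> s X" and f: "\<And>g. mfd_smooth_at M f g"
  shows "((\<lambda>s. f (\<gamma> s)) has_vector_derivative ld X f (\<gamma> s)) (at s)"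
  unfolding has_vector_derivative_def
proof (subst has_derivative_componentwise_within, rule ballI)
  fix b :: 'z
  have "smooth_fun_on M UNIV (\<lambda>g. f g \<bullet> b)" using mfd_smooth_at_inner[OF f] by (simp add: smooth_fun_on_iff)
  then have "((\<lambda>s. f (\<gamma> s) \<bullet> b) has_real_derivative ld X (\<lambda>g. f g \<bullet> b) (\<gamma> s)) (at s)"
    using assms(1) unfolding has_velocity_def by blast
  then show "((\<lambda>s. f (\<gamma> s) \<bullet> b) has_derivative (\<lambda>x. (x *\<^sub>R ld X f (\<gamma> s)) \<bullet> b)) (at s)"
    by (simp add: ld_inner[OF f] has_field_derivative_def mult_commute_abs)
qed

lemma continuous_on_path:
  fixes f :: "'g \<Rightarrow> 'z::euclidean_space"
  assumes "path \<gamma>" and f: "\<And>g. mfd_smooth_at M f g"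
  shows "continuous_on {0..1} (\<lambda>s. f (\<gamma> s))"
proof -
  have "continuous_on UNIV f" using mfd_smooth_at_isCont[OF f] by (simp add: continuous_at_imp_continuous_on)
  then show ?thesis using assms(1) unfolding path_def by (rule continuous_on_compose2) auto
qed

text \<open>Each field brings its own exceptional set and its own witness for the velocity;
  hypothesis \<open>V\<close> identifies the two velocities.\<close>

lemma parallel_isometry:
  assumes v: "parallel_along G M \<eta> nabla \<gamma> v" and w: "parallel_along G M \<eta> nabla \<gamma> w"
    and V: "\<And>s X Y. has_velocity G M \<eta> \<gamma> s X \<Longrightarrow> has_velocity G M \<eta> \<gamma> s Y \<Longrightarrow> X = Y"
  shows "Bf (v 1) (w 1) = Bf (v 0) (w 0)"
proof -
  have bb: "bounded_bilinear Bf" using bBf by (simp add: bilinear_conv_bounded_bilinear)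
  obtain S where S: "finite S" "\<And>s. s \<in> {0<..<1} - S \<Longrightarrow> \<exists>X. has_velocity G M \<eta> \<gamma> s X \<and>
        (v has_vector_derivative - nabla (\<lambda>_. X) (\<lambda>_. v s) (\<gamma> s)) (at s)"
    using v unfolding parallel_along_def by blast
  obtain S' where S': "finite S'" "\<And>s. s \<in> {0<..<1} - S' \<Longrightarrow> \<exists>X. has_velocity G M \<eta> \<gamma> s X \<and>
        (w has_vector_derivative - nabla (\<lambda>_. X) (\<lambda>_. w s) (\<gamma> s)) (at s)"
    using w unfolding parallel_along_def by blast
  show ?thesis
  proof (rule hvd_zero_const[of "S \<union> S'" "\<lambda>s. Bf (v s) (w s)"])
    show "continuous_on {0..1} (\<lambda>s. Bf (v s) (w s))"
      using v w unfolding parallel_along_def by (intro bounded_bilinear.continuous_on[OF bb]) auto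
    fix s assume s: "s \<in> {0<..<1::real} - (S \<union> S')"
    obtain X where X: "has_velocity G M \<eta> \<gamma> s X" "(v has_vector_derivative - nabla (\<lambda>_. X) (\<lambda>_. v s) (\<gamma> s)) (at s)"
      using S(2)[of s] s by blast
    obtain Y where Y: "has_velocity G M \<eta> \<gamma> s Y" "(w has_vector_derivative - nabla (\<lambda>_. Y) (\<lambda>_. w s) (\<gamma> s)) (at s)"
      using S'(2)[of s] s by blast
    have e: "Y = X" using V X Y by blast
    have "Bf (v s) (- nabla (\<lambda>_. X) (\<lambda>_. w s) (\<gamma> s)) + Bf (- nabla (\<lambda>_. X) (\<lambda>_. v s) (\<gamma> s)) (w s) = 0"
      using Bf_ad[of X "v s" "w s"]
      by (simp add: nabla_const bilinear_lneg[OF bBf] bilinear_rneg[OF bBf] bilinear_lmul[OF bBf] bilinear_rmul[OF bBf])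
    with bounded_bilinear.has_vector_derivative[OF bb X(2) Y(2)[unfolded e]]
    show "((\<lambda>s. Bf (v s) (w s)) has_vector_derivative 0) (at s)" by simp
  qed (use S S' in auto)
qed

lemma velocity_unique:
  assumes "has_velocity G M \<eta> \<gamma> s X" "has_velocity G M \<eta> \<gamma> s Y"
  shows "X = Y"
proof (rule ld_injective[where g="\<gamma> s"])
  fix f :: "'g \<Rightarrow> real" and W assume W: "open W" "\<gamma> s \<in> W" "\<And>h. h \<in> W \<Longrightarrow> mfd_smooth_at M f h"
  then have "smooth_fun_on M W f" by (simp add: smooth_fun_on_iff)
  then have "((\<lambda>s. f (\<gamma> s)) has_real_derivative ld X f (\<gamma> s)) (at s)"
     "((\<lambda>s. f (\<gamma> s)) has_real_derivative ld Y f (\<gamma> s)) (at s)"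
    using assms W unfolding has_velocity_def by blast+
  then show "ld X f (\<gamma> s) = ld Y f (\<gamma> s)" by (rule DERIV_unique)
qed

text \<open>The two alternatives for \<open>c\<close> are the two ways in which the derivative of
  the twisted component pairs to zero: its coefficient vanishes with the \<open>H\<close>-component
  of the field, and its direction lies in \<open>W\<close>.\<close>

lemma parallel_transport:
  assumes v: "parallel_along G M \<eta> nabla \<gamma> v" and \<gamma>: "path \<gamma>" "\<gamma> 0 = gone" "\<gamma> 1 = gone"
  shows "snd (snd (v 1)) = snd (snd (v 0))"
    and "snd (snd (v 0)) = 0 \<or> (\<forall>z\<in>W. z \<bullet> c = 0) \<Longrightarrow> fst (snd (v 1)) \<bullet> c = fst (snd (v 0)) \<bullet> c"
proof -
  obtain S where S: "finite S" "\<And>s. s \<in> {0<..<1} - S \<Longrightarrow> \<exists>X. has_velocity G M \<eta> \<gamma> s X \<and>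
        (v has_vector_derivative - nabla (\<lambda>_. X) (\<lambda>_. v s) (\<gamma> s)) (at s)"
    using v unfolding parallel_along_def by blast
  have cv: "continuous_on {0..1} v" using v by (simp add: parallel_along_def)
  define vh where "vh = snd (snd (v 0))"
  have bl2: "bounded_linear (\<lambda>p :: real \<times> 'v \<times> real. snd (snd p))"
    by (rule bounded_linear_compose[OF bounded_linear_snd bounded_linear_snd])
  have bl1: "bounded_linear (\<lambda>p :: real \<times> 'v \<times> real. fst (snd p))"
    by (rule bounded_linear_compose[OF bounded_linear_fst bounded_linear_snd])
  have vh: "snd (snd (v s)) = vh" if "s \<in> {0..1}" for s
    unfolding vh_def
  proof (rule hvd_zero_const[OF S(1) _ _ that])
    show "continuous_on {0..1} (\<lambda>s. snd (snd (v s)))" using cv by (intro continuous_intros)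
    fix s assume "s \<in> {0<..<1} - S"
    then obtain X where X: "(v has_vector_derivative - nabla (\<lambda>_. X) (\<lambda>_. v s) (\<gamma> s)) (at s)" using S(2) by blast
    have "snd (snd (- nabla (\<lambda>_. X) (\<lambda>_. v s) (\<gamma> s))) = 0"
      by (cases X; cases "v s") (simp add: nabla_const)
    with hvd_bounded_linear[OF bl2 X] show "((\<lambda>s. snd (snd (v s))) has_vector_derivative 0) (at s)" by simp
  qed
  show "snd (snd (v 1)) = snd (snd (v 0))" using vh[of 1] by (simp add: vh_def)
  \<comment> \<open>The twist absorbs the rotation caused by \<open>t'\<close>, and the subtracted
    term cancels the contribution of the \<open>g\<close>-velocity. On loops at the unit both
    corrections vanish at the ends, as \<open>ct\<close> and \<open>cx\<close> do.\<close>
  define u where "u s = flow A (ct (\<gamma> s) / 2) (fst (snd (v s))) - (vh / 2) *\<^sub>R flow A (- ct (\<gamma> s) / 2) (A (cx (\<gamma> s)))" for s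
  have cf: "continuous_on {0..1} (\<lambda>s. flow A (f s) (g s))" if "continuous_on {0..1} f" "continuous_on {0..1} g"
    for f :: "real \<Rightarrow> real" and g
  proof -
    have "smooth_at (\<lambda>z :: real \<times> 'v. flow A (fst z) (snd z)) z" for z
      by (intro smooth_at_flow[OF lA] smooth_at_fst smooth_at_snd smooth_at_id)
    then have "continuous_on UNIV (\<lambda>z :: real \<times> 'v. flow A (fst z) (snd z))"
      by (simp add: continuous_at_imp_continuous_on smooth_at_isCont)
    from continuous_on_compose2[OF this continuous_on_Pair[OF that]] show ?thesis by simp
  qed
  have cu: "continuous_on {0..1} u"
    unfolding u_def using cv continuous_on_path[OF \<gamma>(1) smooth_ct] continuous_on_path[OF \<gamma>(1) smooth_cx]
    by (intro continuous_on_diff cf continuous_on_scaleR continuous_intros bounded_linear.continuous_on[OF blA]) auto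
  have du: "(u has_vector_derivative (vh / 4 * ld X ct (\<gamma> s)) *\<^sub>R A (A (flow A (- ct (\<gamma> s) / 2) (cx (\<gamma> s))))) (at s)"
    if s: "s \<in> {0..1}" and X: "has_velocity G M \<eta> \<gamma> s X" "(v has_vector_derivative - nabla (\<lambda>_. X) (\<lambda>_. v s) (\<gamma> s)) (at s)" for s X
  proof -
    obtain b X' k where X': "X = (b, X', k)" by (cases X)
    define \<tau> where "\<tau> = ct (\<gamma> s)"
    have dt: "((\<lambda>s. ct (\<gamma> s)) has_vector_derivative k) (at s)"
      using has_velocity_vector[OF X(1) smooth_ct] by (simp add: X')
    have dx: "((\<lambda>s. cx (\<gamma> s)) has_vector_derivative flow A \<tau> X') (at s)"
      using has_velocity_vector[OF X(1) smooth_cx] by (simp add: X' \<tau>_def)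
    define Y where "Y = fst (snd (v s))"
    have "fst (snd (- nabla (\<lambda>_. X) (\<lambda>_. v s) (\<gamma> s))) = - (1/2) *\<^sub>R (k *\<^sub>R A Y - vh *\<^sub>R A X')"
      using vh[OF s] by (cases "v s") (simp add: nabla_const X' Y_def)
    with hvd_bounded_linear[OF bl1 X(2)]
    have dY: "((\<lambda>s. fst (snd (v s))) has_vector_derivative - (1/2) *\<^sub>R (k *\<^sub>R A Y - vh *\<^sub>R A X')) (at s)" by simp
    have d1: "((\<lambda>s. ct (\<gamma> s) / 2) has_vector_derivative k / 2) (at s)"
      using hvd_bounded_linear[OF bounded_linear_divide dt] .
    have d2: "((\<lambda>s. - ct (\<gamma> s) / 2) has_vector_derivative - k / 2) (at s)"
      using hvd_bounded_linear[OF bounded_linear_divide has_vector_derivative_minus[OF dt]] .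
    have dw: "((\<lambda>s. flow A (ct (\<gamma> s) / 2) (fst (snd (v s)))) has_vector_derivative (vh / 2) *\<^sub>R flow A (\<tau> / 2) (A X')) (at s)"
      using flow_hvd[OF lA d1 dY]
      by (simp add: \<tau>_def Y_def linear_cmul[OF lflow] linear_diff[OF lflow] linear_neg[OF lflow] linear_add[OF lflow] scaleR_diff_right)
    have "flow A (- \<tau> / 2) (A (flow A \<tau> X')) = flow A (\<tau> / 2) (A X')"
      using flow_add[OF lA, of "- \<tau> / 2" \<tau> "A X'"] by (simp add: flow_commute[OF lA])
    then have dy: "((\<lambda>s. flow A (- ct (\<gamma> s) / 2) (A (cx (\<gamma> s)))) has_vector_derivative
      (- k / 2) *\<^sub>R flow A (- \<tau> / 2) (A (A (cx (\<gamma> s)))) + flow A (\<tau> / 2) (A X')) (at s)"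
      using flow_hvd[OF lA d2 hvd_bounded_linear[OF blA dx]] by (simp add: \<tau>_def)
    have "(u has_vector_derivative (vh / 2) *\<^sub>R flow A (\<tau> / 2) (A X') -
      (vh / 2) *\<^sub>R ((- k / 2) *\<^sub>R flow A (- \<tau> / 2) (A (A (cx (\<gamma> s)))) + flow A (\<tau> / 2) (A X'))) (at s)"
      unfolding u_def
      by (rule has_vector_derivative_diff[OF dw hvd_bounded_linear[OF bounded_linear_scaleR_right dy]])
    moreover have "(vh / 2) *\<^sub>R flow A (\<tau> / 2) (A X') -
      (vh / 2) *\<^sub>R ((- k / 2) *\<^sub>R flow A (- \<tau> / 2) (A (A (cx (\<gamma> s)))) + flow A (\<tau> / 2) (A X'))
      = (vh / 4 * ld X ct (\<gamma> s)) *\<^sub>R A (A (flow A (- ct (\<gamma> s) / 2) (cx (\<gamma> s))))"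
      by (simp add: X' \<tau>_def flow_commute[OF lA] scaleR_diff_right)
    ultimately show ?thesis by simp
  qed
  have ends: "u 0 = fst (snd (v 0))" "u 1 = fst (snd (v 1))"
    using \<gamma> by (simp_all add: u_def lA A_simps linear_0[OF lflow])
  show "fst (snd (v 1)) \<bullet> c = fst (snd (v 0)) \<bullet> c" if c: "snd (snd (v 0)) = 0 \<or> (\<forall>z\<in>W. z \<bullet> c = 0)"
    unfolding ends[symmetric]
  proof (rule hvd_zero_const[OF S(1), of "\<lambda>s. u s \<bullet> c" 1])
    show "continuous_on {0..1} (\<lambda>s. u s \<bullet> c)" using cu by (intro continuous_intros)
    fix s assume s: "s \<in> {0<..<1} - S"
    then obtain X where X: "has_velocity G M \<eta> \<gamma> s X" "(v has_vector_derivative - nabla (\<lambda>_. X) (\<lambda>_. v s) (\<gamma> s)) (at s)"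
      using S(2) by blast
    have "((vh / 4 * ld X ct (\<gamma> s)) *\<^sub>R A (A (flow A (- ct (\<gamma> s) / 2) (cx (\<gamma> s))))) \<bullet> c = 0"
      using c by (auto simp: vh_def)
    moreover have "s \<in> {0..1}" using s by simp
    ultimately show "((\<lambda>s. u s \<bullet> c) has_vector_derivative 0) (at s)"
      using hvd_bounded_linear[OF bounded_linear_inner_left du[OF _ X], of c] by (simp only:)
  qed simp
qed

section \<open>Upper bound for the holonomy algebra\<close>

lemma holonomy_group_props:
  assumes K: "K \<in> holonomy_group G M \<eta> nabla"
  shows "Bf (K x) (K y) = Bf x y" "snd (snd (K x)) = snd (snd x)"
    "snd (snd x) = 0 \<or> (\<forall>z\<in>W. z \<bullet> c = 0) \<Longrightarrow> fst (snd (K x)) \<bullet> c = fst (snd x) \<bullet> c"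
proof -
  obtain \<gamma> where \<gamma>: "piecewise_smooth_path M \<gamma>" "\<gamma> 0 = gone" "\<gamma> 1 = gone"
    "\<And>x. \<exists>v. parallel_along G M \<eta> nabla \<gamma> v \<and> v 0 = x \<and> v 1 = K x"
    using K unfolding holonomy_group_def by blast
  have p: "path \<gamma>" using \<gamma>(1) by (simp add: piecewise_smooth_path_def)
  obtain v where v: "parallel_along G M \<eta> nabla \<gamma> v" "v 0 = x" "v 1 = K x" using \<gamma>(4) by blast
  obtain w where w: "parallel_along G M \<eta> nabla \<gamma> w" "w 0 = y" "w 1 = K y" using \<gamma>(4) by blast
  show "Bf (K x) (K y) = Bf x y" using parallel_isometry[OF v(1) w(1) velocity_unique] v w by simp
  show "snd (snd (K x)) = snd (snd x)" using parallel_transport(1)[OF v(1) p \<gamma>(2,3)] v by simp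
  show "fst (snd (K x)) \<bullet> c = fst (snd x) \<bullet> c" if "snd (snd x) = 0 \<or> (\<forall>z\<in>W. z \<bullet> c = 0)"
    using parallel_transport(2)[OF v(1) p \<gamma>(2,3), of c] v that by simp
qed

text \<open>The skew endomorphism \<open>A^2 X \<and> \<alpha>\<close>, the block matrix of the
  statement.\<close>

definition nilp :: "'v \<Rightarrow> real \<times> 'v \<times> real \<Rightarrow> real \<times> 'v \<times> real" where
  "nilp X = (\<lambda>(a, Y, h). (B (A (A X)) Y, - (h *\<^sub>R A (A X)), 0))"

text \<open>The properties of the holonomy group, differentiated at time \<open>0\<close> along
  \<open>flow T\<close>, fix \<open>T\<close> on \<open>H\<close> up to a vector of
  \<open>W\<close>; skewness fixes the rest.\<close>

lemma holonomy_algebra_subset: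
  assumes T: "T \<in> holonomy_algebra G M \<eta> nabla"
  shows "\<exists>X. T = nilp X"
proof -
  have lT: "linear T" and K: "\<And>t. flow T t \<in> holonomy_group G M \<eta> nabla"
    using T by (auto simp: holonomy_algebra_def linear_group_lie_algebra_def flow_def)
  have d: "((\<lambda>t. flow T t x) has_vector_derivative T x) (at 0)" for x
    using flow_has_vector_derivative[OF lT, of x 0] by (simp add: lT)
  have bl2: "bounded_linear (\<lambda>p :: real \<times> 'v \<times> real. snd (snd p))"
    by (rule bounded_linear_compose[OF bounded_linear_snd bounded_linear_snd])
  have bl1: "bounded_linear (\<lambda>p :: real \<times> 'v \<times> real. fst (snd p) \<bullet> c)" for c
    by (rule bounded_linear_compose[OF bounded_linear_inner_left bounded_linear_compose[OF bounded_linear_fst bounded_linear_snd]])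
  have bb: "bounded_bilinear Bf" using bBf by (simp add: bilinear_conv_bounded_bilinear)
  have h0: "snd (snd (T x)) = 0" for x
    using vector_derivative_unique_at[OF hvd_bounded_linear[OF bl2 d[of x]], of 0] holonomy_group_props(2)[OF K] by simp
  have Y0: "fst (snd (T x)) \<bullet> c = 0" if "snd (snd x) = 0 \<or> (\<forall>z\<in>W. z \<bullet> c = 0)" for x c
    using vector_derivative_unique_at[OF hvd_bounded_linear[OF bl1[of c] d[of x]], of 0] holonomy_group_props(3)[OF K that] by simp
  have skew: "Bf x (T y) + Bf (T x) y = 0" for x y
    using vector_derivative_unique_at[OF bounded_bilinear.has_vector_derivative[OF bb d[of x] d[of y]], of 0]
      holonomy_group_props(1)[OF K] by (simp add: lT)
  obtain f Z l where TH: "T (0, 0, 1) = (f, Z, l)" by (cases "T (0, 0, 1)")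
  have "Z \<in> W"
    by (rule subspace_memI[OF subspace_W]) (use Y0[of "(0, 0, 1)"] TH in auto)
  then obtain X where X: "Z = A (A X)" by auto
  have l: "l = 0" using h0[of "(0, 0, 1)"] TH by simp
  have f: "f = 0" using skew[of "(0, 0, 1)" "(0, 0, 1)"] by (simp add: TH B_simps)
  have "T (a, Y, h) = nilp (- X) (a, Y, h)" for a Y h
  proof -
    have "(a, Y, h) = (a, Y, 0) + h *\<^sub>R (0, 0, 1)" by simp
    then have e: "T (a, Y, h) = T (a, Y, 0) + h *\<^sub>R T (0, 0, 1)"
      using linear_add[OF lT] linear_cmul[OF lT] by metis
    \<comment> \<open>Without \<open>H\<close>-component every test vector is allowed, in particular
      the vector itself, which is therefore zero.\<close>
    have "fst (snd (T (a, Y, 0))) \<bullet> fst (snd (T (a, Y, 0))) = 0" by (rule Y0) simp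
    then have "fst (snd (T (a, Y, h))) = h *\<^sub>R Z" by (simp add: e TH)
    moreover have "fst (T (a, Y, h)) = - B Z Y"
      using skew[of "(a, Y, h)" "(0, 0, 1)"] B_sym[of Y Z] h0[of "(a, Y, h)"]
      by (cases "T (a, Y, h)") (simp add: TH f l B_simps)
    ultimately show ?thesis using h0[of "(a, Y, h)"]
      by (cases "T (a, Y, h)") (simp add: nilp_def X A_simps B_simps)
  qed
  then show ?thesis by (intro exI[of _ "- X"]) auto
qed

section \<open>Explicit loops and their holonomy\<close>

lemma linear_nilp: "linear (nilp X)"
  by (rule linearI) (auto simp: nilp_def B_simps algebra_simps)

text \<open>\<open>nilp X\<close> maps \<open>H\<close> into \<open>g\<close>, \<open>g\<close> into
  the line of \<open>\<alpha>\<close>, and \<open>\<alpha>\<close> to \<open>0\<close>, so the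
  exponential series stops after the quadratic term.\<close>

lemma flow_nilp:
  "flow (nilp X) r (a, Y, h) = (a + B (A (A (r *\<^sub>R X))) Y - h / 2 * B (A (A (r *\<^sub>R X))) (A (A (r *\<^sub>R X))), Y - h *\<^sub>R A (A (r *\<^sub>R X)), h)"
proof -
  have n2: "(nilp X ^^ 2) p = (- (snd (snd p) * B (A (A X)) (A (A X))), 0, 0)" for p
    by (cases p) (simp add: numeral_2_eq_2 nilp_def B_simps)
  have "(nilp X ^^ (n + 3)) p = 0" for n p
  proof -
    have "(nilp X ^^ (n + 3)) p = (nilp X ^^ n) ((nilp X ^^ 3) p)" by (simp add: funpow_add)
    also have "(nilp X ^^ 3) p = nilp X ((nilp X ^^ 2) p)" by (simp add: numeral_3_eq_3 numeral_2_eq_2)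
    also have "\<dots> = 0" by (simp add: n2) (simp add: nilp_def B_simps zero_prod_def)
    finally show ?thesis by (simp add: linear_0[OF linear_funpow[OF linear_nilp]])
  qed
  note n3 = this
  have "(nilp X ^^ n) p = 0" if "n \<notin> {0, 1, 2}" for n p
  proof -
    have "n = (n - 3) + 3" using that by auto
    then show ?thesis using n3[of "n - 3" p] by simp
  qed
  then have "flow (nilp X) r (a, Y, h) = (\<Sum>n\<in>{0, 1, 2}. r ^ n *\<^sub>R (nilp X ^^ n) (a, Y, h) /\<^sub>R fact n)"
    unfolding flow_eq(1)[OF linear_nilp] by (intro suminf_finite) auto
  then show ?thesis by (simp add: n2) (simp add: nilp_def A_simps B_simps power2_eq_square field_simps)
qed

text \<open>
  The loop has the coordinates \<open>(0, \<xi> e\<^sup>\<tau>\<^sup>A\<^sup>/\<^sup>2 X, \<tau>)\<close>, where \<open>(\<xi>, \<tau>)\<close> runs \<open>n\<close> times through a circle of radius \<open>e\<close>.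
  Its holonomy is determined by the enclosed area \<open>n \<pi> e\<^sup>2\<close>; many turns of a small circle keep the loop
  in the domain of the local inverse of \<open>\<Phi>\<close>.
\<close>

lemma transport_in_holonomy_group:
  "(\<lambda>(a, Y, h). (a - B (A (A X)) Y - h / 2 * B (A (A X)) (A (A X)), Y + h *\<^sub>R A (A X), h)) \<in> holonomy_group G M \<eta> nabla"
proof -
  obtain V \<Psi> where V: "open V" "0 \<in> V" "\<Psi> 0 = gone" "\<And>p. p \<in> V \<Longrightarrow> plot_at M \<Psi> p" "\<And>p. p \<in> V \<Longrightarrow> \<Phi> (\<Psi> p) = p"
    by (rule local_inverse) (rule that)
  obtain r where r: "r > 0" "ball 0 r \<subseteq> V" using V(1,2) openE by blast
  have "continuous_on {-1..1} (\<lambda>s. flow A s X)"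
    using flow_has_vector_derivative[OF lA] by (auto intro!: continuous_at_imp_continuous_on has_vector_derivative_continuous)
  then have "bounded ((\<lambda>s. flow A s X) ` {-1..1})" by (intro compact_imp_bounded compact_continuous_image) auto
  then obtain C where C: "C > 0" "\<And>s. s \<in> {-1..1} \<Longrightarrow> norm (flow A s X) \<le> C" unfolding bounded_pos by auto
  \<comment> \<open>The bound \<open>1\<close> keeps \<open>\<tau> / 2\<close> in the interval where
    \<open>C\<close> bounds the flow; the second bound gives \<open>e (1 + 2 C) \<le> r / 2\<close>,
    so the loop stays in the ball of radius \<open>r\<close>.\<close>
  define e0 where "e0 = min 1 (r / (2 * (1 + 2 * C)))"
  have e0: "e0 > 0" using r C by (simp add: e0_def)
  obtain n' :: nat where n': "4 / (pi * e0\<^sup>2) < real n'" using reals_Archimedean2 by blast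
  define n where "n = Suc n'"
  have n: "n > 0" "4 / (pi * e0\<^sup>2) < real n" using n' by (simp_all add: n_def)
  \<comment> \<open>This radius gives total area \<open>n \<pi> e^2 = 4\<close>, which compensates
    the factor \<open>1/4\<close> in \<open>z\<close> below; \<open>n\<close> is large only to make
    \<open>e\<close> small.\<close>
  define e where "e = sqrt (4 / (pi * real n))"
  have e: "e > 0" using n by (simp add: e_def)
  have e2: "e\<^sup>2 * (pi * real n) = 4" using n by (simp add: e_def)
  have "0 < pi * e0\<^sup>2" "0 < pi * real n" using e0 n(1) by simp_all
  then have "4 < real n * (pi * e0\<^sup>2)" using n(2) by (simp only: pos_divide_less_eq)
  then have "e\<^sup>2 * (pi * real n) \<le> e0\<^sup>2 * (pi * real n)" unfolding e2 by (simp add: mult_ac)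
  then have "e\<^sup>2 \<le> e0\<^sup>2" using \<open>0 < pi * real n\<close> by (rule mult_right_le_imp_le)
  then have "e \<le> e0" by (rule power2_le_imp_le) (use e0 in simp)
  then have "e \<le> 1" "e \<le> r / (2 * (1 + 2 * C))" by (simp_all add: e0_def)
  then have "e * (2 * (1 + 2 * C)) \<le> r" using C(1) by (simp add: pos_le_divide_eq)
  moreover have "e * (2 * (1 + 2 * C)) = 2 * (e * (1 + 2 * C))" by simp
  ultimately have e1: "e \<le> 1" "e * (1 + 2 * C) < r" using r(1) \<open>e \<le> 1\<close> by linarith+
  define \<theta> where "\<theta> s = 2 * pi * real n * s" for s
  define \<tau> where "\<tau> s = e * sin (\<theta> s)" for s
  define \<xi> where "\<xi> s = e * (cos (\<theta> s) - 1)" for s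
  \<comment> \<open>The primitive of \<open>\<tau>' \<xi>\<close> that vanishes at \<open>0\<close>,
    that is, the area swept by the planar curve.\<close>
  define J where "J s = e\<^sup>2 * (\<theta> s / 2 + sin (2 * \<theta> s) / 4 - sin (\<theta> s))" for s
  define k where "k s = e * (2 * pi * real n) * cos (\<theta> s)" for s
  define \<xi>' where "\<xi>' s = - (e * (2 * pi * real n) * sin (\<theta> s))" for s
  have d\<tau>: "(\<tau> has_vector_derivative k s) (at s)" for s
    unfolding \<tau>_def k_def \<theta>_def has_real_derivative_iff_has_vector_derivative[symmetric]
    by (auto intro!: derivative_eq_intros)
  have d\<xi>: "(\<xi> has_vector_derivative \<xi>' s) (at s)" for s
    unfolding \<xi>_def \<xi>'_def \<theta>_def has_real_derivative_iff_has_vector_derivative[symmetric]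
    by (auto intro!: derivative_eq_intros)
  have dJ: "(J has_vector_derivative k s * \<xi> s) (at s)" for s
  proof -
    have c2: "cos (2 * \<theta> s) = 2 * (cos (\<theta> s))\<^sup>2 - 1" by (rule cos_double_cos)
    have "(J has_real_derivative e\<^sup>2 * (2 * pi * real n / 2 + cos (2 * \<theta> s) * (2 * (2 * pi * real n)) / 4 - cos (\<theta> s) * (2 * pi * real n))) (at s)"
      unfolding J_def \<theta>_def by (auto intro!: derivative_eq_intros)
    then show ?thesis
      unfolding has_real_derivative_iff_has_vector_derivative[symmetric] c2
      by (rule back_subst[where P="\<lambda>d. (J has_real_derivative d) (at s)"])
        (simp add: k_def \<xi>_def power2_eq_square field_simps)
  qed
  \<comment> \<open>With this twist, \<open>e^(-\<tau>A/2) A x'\<close> becomes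
    \<open>\<xi>' A X + (\<xi> \<tau>' / 2) A^2 X\<close>, free of exponentials, so the transport
    equation can be integrated explicitly.\<close>
  define x where "x s = \<xi> s *\<^sub>R flow A (\<tau> s / 2) X" for s
  define x' where "x' s = \<xi>' s *\<^sub>R flow A (\<tau> s / 2) X + (\<xi> s * k s / 2) *\<^sub>R flow A (\<tau> s / 2) (A X)" for s
  have d\<tau>2: "((\<lambda>s. \<tau> s / 2) has_vector_derivative k s / 2) (at s)"
     "((\<lambda>s. - \<tau> s / 2) has_vector_derivative - k s / 2) (at s)" for s
    using hvd_bounded_linear[OF bounded_linear_divide d\<tau>] hvd_bounded_linear[OF bounded_linear_divide has_vector_derivative_minus[OF d\<tau>]] .
  have dx: "(x has_vector_derivative x' s) (at s)" for s
    using bounded_bilinear.has_vector_derivative[OF bounded_bilinear_scaleR d\<xi> flow_hvd[OF lA d\<tau>2(1) has_vector_derivative_const]]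
    unfolding x_def x'_def by (simp add: linear_0[OF lflow] add.commute)
  define p where "p s = (0 :: real, x s, \<tau> s)" for s
  have sp: "smooth_at p s" for s
  proof -
    have "smooth_on UNIV (sin :: real \<Rightarrow> real)" "smooth_on UNIV (cos :: real \<Rightarrow> real)"
    proof -
      have "Ck_on k UNIV (\<lambda>s. a * sin s + b * cos s :: real)" for k and a b :: real
      proof (induction k arbitrary: a b)
        case 0
        then show ?case by (auto intro!: continuous_intros)
      next
        case (Suc k)
        have d: "((\<lambda>s. a * sin s + b * cos s) has_derivative (\<lambda>v. v * (a * cos s - b * sin s))) (at s)" for s :: real
          by (auto intro!: derivative_eq_intros simp: algebra_simps)
        have "Ck_on k UNIV (\<lambda>s. v * (a * cos s - b * sin s))" for v
          using Suc[of "- v * b" "v * a"] by (simp add: algebra_simps)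
        from Ck_on_SucI[OF open_UNIV d this] show ?case .
      qed
      from this[of _ 1 0] this[of _ 0 1] show "smooth_on UNIV (sin :: real \<Rightarrow> real)" "smooth_on UNIV (cos :: real \<Rightarrow> real)"
        unfolding smooth_on_def by simp_all
    qed
    then have sc: "smooth_at (\<lambda>s. sin (\<theta> s)) s" "smooth_at (\<lambda>s. cos (\<theta> s)) s" for s
    proof -
      have th: "smooth_at \<theta> s" for s unfolding \<theta>_def by (rule smooth_at_mult[OF smooth_at_const smooth_at_id])
      show "smooth_at (\<lambda>s. sin (\<theta> s)) s" "smooth_at (\<lambda>s. cos (\<theta> s)) s" for s
        using smooth_at_compose[OF smooth_atI[OF open_UNIV UNIV_I \<open>smooth_on UNIV sin\<close>] th]
          smooth_at_compose[OF smooth_atI[OF open_UNIV UNIV_I \<open>smooth_on UNIV cos\<close>] th] by auto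
    qed
    have "smooth_at \<tau> s" "smooth_at \<xi> s"
      unfolding \<tau>_def \<xi>_def by (intro smooth_at_mult smooth_at_diff smooth_at_const sc)+
    moreover from this have "smooth_at (\<lambda>s. \<tau> s / 2) s"
      using smooth_at_bounded_linear[OF bounded_linear_divide] by blast
    ultimately show ?thesis
      unfolding p_def x_def by (intro smooth_at_Pair smooth_at_scaleR smooth_at_flow[OF lA] smooth_at_const)
  qed
  have pV: "p s \<in> V" for s
  proof -
    have t: "\<bar>\<tau> s\<bar> \<le> e" using e abs_sin_le_one[of "\<theta> s"] by (simp add: \<tau>_def abs_mult mult_left_le)
    have "\<bar>cos (\<theta> s) - 1\<bar> \<le> 2" using abs_cos_le_one[of "\<theta> s"] by linarith
    then have xi: "\<bar>\<xi> s\<bar> \<le> e * 2" using e by (simp add: \<xi>_def abs_mult)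
    have "norm (flow A (\<tau> s / 2) X) \<le> C" using t e1(1) by (intro C(2)) auto
    then have "norm (x s) \<le> (e * 2) * C" unfolding x_def using xi e C(1) by (auto intro!: mult_mono)
    moreover have "norm (p s) \<le> norm (x s) + norm (\<tau> s)"
      unfolding p_def using norm_Pair_le[of 0 "(x s, \<tau> s)"] norm_Pair_le[of "x s" "\<tau> s"] by simp
    ultimately have "norm (p s) \<le> e * (1 + 2 * C)" using t by (simp add: algebra_simps)
    then show ?thesis using e1(2) r(2) by auto
  qed
  define \<gamma> where "\<gamma> s = \<Psi> (p s)" for s
  have pg: "plot_at M \<gamma> s" for s
    unfolding \<gamma>_def by (rule plot_at_compose[OF V(4)[OF pV] sp])
  have co: "cx (\<gamma> s) = x s" "ct (\<gamma> s) = \<tau> s" for s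
    using V(5)[OF pV[of s]] by (auto simp: \<gamma>_def \<Phi>_def p_def)
  have th: "sin (2 * pi * real n) = 0" "cos (2 * pi * real n) = 1" "sin (4 * pi * real n) = 0"
    using sin_int_2pin[of "int n"] cos_int_2pin[of "int n"] sin_int_2pin[of "2 * int n"] by (simp_all add: mult.assoc)
  have end0: "\<tau> 0 = 0" "\<xi> 0 = 0" "J 0 = 0" by (simp_all add: \<tau>_def \<xi>_def J_def \<theta>_def)
  have "e\<^sup>2 * (pi * real n) = 4" by fact
  then have end1: "\<tau> 1 = 0" "\<xi> 1 = 0" "J 1 = 4" using th by (simp_all add: \<tau>_def \<xi>_def J_def \<theta>_def mult.assoc)
  have g01: "\<gamma> 0 = gone" "\<gamma> 1 = gone"
    using V(3) by (simp_all add: \<gamma>_def p_def x_def end0 end1 zero_prod_def)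
  have psp: "piecewise_smooth_path M \<gamma>"
    unfolding piecewise_smooth_path_def
  proof (rule conjI, goal_cases)
    case 1
    show "path \<gamma>" unfolding path_def using plot_atD(1)[OF pg] by (simp add: continuous_at_imp_continuous_on)
  next
    case 2
    have "\<exists>I \<delta>. open I \<and> {a..b} \<subseteq> I \<and> smooth_map_on eucl_atlas M I \<delta> \<and> (\<forall>t\<in>{a..b}. \<gamma> t = \<delta> t)" for a b :: real
      using smooth_map_on_of_plot_at[OF open_UNIV pg] by (intro exI[of _ UNIV] exI[of _ \<gamma>]) auto
    then show ?case by (intro exI[of _ "{0, 1 :: real}"]) auto
  qed
  define Xv where "Xv s = maurer_cartan \<gamma> s 1" for s
  have hd: "((\<lambda>s. f (\<gamma> s)) has_vector_derivative ld (Xv s) f (\<gamma> s)) (at s)" if "mfd_smooth_at M f (\<gamma> s)"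
    for f :: "'g \<Rightarrow> 'z::euclidean_space" and s
  proof -
    have d: "((\<lambda>s. f (\<gamma> s)) has_derivative frechet_derivative (\<lambda>s. f (\<gamma> s)) (at s)) (at s)"
      by (rule smooth_at_has_derivative[OF mfd_smooth_at_plot[OF that pg]])
    have "frechet_derivative (\<lambda>s. f (\<gamma> s)) (at s) v = v *\<^sub>R ld (Xv s) f (\<gamma> s)" for v
      using linear_cmul[OF has_derivative_linear[OF d], of v 1] frechet_derivative_plot[OF that pg, of 1] by (simp add: Xv_def)
    then have "frechet_derivative (\<lambda>s. f (\<gamma> s)) (at s) = (\<lambda>v. v *\<^sub>R ld (Xv s) f (\<gamma> s))" by blast
    then show ?thesis using d by (simp add: has_vector_derivative_def)
  qed
  have vel: "has_velocity G M \<eta> \<gamma> s (Xv s)" for s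
    unfolding has_velocity_def
  proof (intro allI impI, elim conjE)
    fix W and f :: "'g \<Rightarrow> real" assume "open W" "\<gamma> s \<in> W" "smooth_fun_on M W f"
    then have "mfd_smooth_at M f (\<gamma> s)" by (simp add: smooth_fun_on_iff)
    from hd[OF this] show "((\<lambda>s. f (\<gamma> s)) has_real_derivative ld (Xv s) f (\<gamma> s)) (at s)"
      by (simp add: has_real_derivative_iff_has_vector_derivative)
  qed
  define X' where "X' s = fst (snd (Xv s))" for s
  have Xv: "snd (snd (Xv s)) = k s" "flow A (\<tau> s) (X' s) = x' s" for s
  proof -
    have "(\<tau> has_vector_derivative ld (Xv s) ct (\<gamma> s)) (at s)" using hd[OF smooth_ct, of s] unfolding co .
    then have "ld (Xv s) ct (\<gamma> s) = k s" by (rule vector_derivative_unique_at[OF _ d\<tau>])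
    then show "snd (snd (Xv s)) = k s" by (cases "Xv s") simp
    have "(x has_vector_derivative ld (Xv s) cx (\<gamma> s)) (at s)" using hd[OF smooth_cx, of s] unfolding co .
    then have "ld (Xv s) cx (\<gamma> s) = x' s" by (rule vector_derivative_unique_at[OF _ dx])
    then show "flow A (\<tau> s) (X' s) = x' s" by (cases "Xv s") (simp add: X'_def co)
  qed
  \<comment> \<open>The primitive of half of \<open>e^(-\<tau>A/2) A x'\<close>. At the end of the
    loop \<open>\<xi> = 0\<close> and \<open>J = 4\<close> leave exactly
    \<open>A^2 X\<close>.\<close>
  define z where "z s = (\<xi> s / 2) *\<^sub>R A X + (J s / 4) *\<^sub>R A (A X)" for s
  define z' where "z' s = (1/2) *\<^sub>R flow A (\<tau> s / 2) (A (X' s))" for s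
  have dz: "(z has_vector_derivative z' s) (at s)" for s
  proof -
    have "(z has_vector_derivative (\<xi>' s / 2) *\<^sub>R A X + (k s * \<xi> s / 4) *\<^sub>R A (A X)) (at s)"
      unfolding z_def
      by (intro has_vector_derivative_add hvd_bounded_linear[OF bounded_linear_scaleR_left]
         hvd_bounded_linear[OF bounded_linear_divide] d\<xi> dJ)
    moreover have "flow A (\<tau> s / 2) (A (X' s)) = flow A (- \<tau> s / 2) (A (x' s))"
      using flow_add[OF lA, of "- \<tau> s / 2" "\<tau> s" "A (X' s)"] by (simp add: Xv(2)[symmetric] flow_commute[OF lA])
    moreover have "flow A (- \<tau> s / 2) (A (x' s)) = \<xi>' s *\<^sub>R A X + (\<xi> s * k s / 2) *\<^sub>R A (A X)"
      using flow_minus_cancel(2)[OF lA, of "\<tau> s / 2"]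
      by (simp add: x'_def A_simps linear_add[OF lflow] linear_cmul[OF lflow] flow_commute[OF lA])
    ultimately show ?thesis by (simp add: z'_def scaleR_add_right mult.commute)
  qed
  have par: "\<exists>v. parallel_along G M \<eta> nabla \<gamma> v \<and> v 0 = (a, Y, h) \<and>
      v 1 = (a - B (A (A X)) Y - h / 2 * B (A (A X)) (A (A X)), Y + h *\<^sub>R A (A X), h)" for a Y h
  proof -
    \<comment> \<open>In the rotating frame the \<open>g\<close>-component has derivative
      \<open>h z'\<close>; the \<open>\<alpha>\<close>-component is the one that keeps
      \<open>Bf (v s) (v s)\<close> constant.\<close>
    define v where "v s = (a - B (z s) Y - h / 2 * B (z s) (z s), flow A (- \<tau> s / 2) (Y + h *\<^sub>R z s), h)" for s
    have dv: "(v has_vector_derivative - nabla (\<lambda>_. Xv s) (\<lambda>_. v s) (\<gamma> s)) (at s)" for s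
    proof -
      have 1: "((\<lambda>s. a - B (z s) Y - h / 2 * B (z s) (z s)) has_vector_derivative
        - B (z' s) Y - h / 2 * (B (z s) (z' s) + B (z' s) (z s))) (at s)"
        using has_vector_derivative_diff[OF has_vector_derivative_diff[OF has_vector_derivative_const[of a]
            hvd_bounded_linear[OF bounded_bilinear.bounded_linear_left[OF bbB, of Y] dz]]
          hvd_bounded_linear[OF bounded_linear_mult_right[of "h / 2"] bounded_bilinear.has_vector_derivative[OF bbB dz dz]], of s]
        by simp
      have 2: "((\<lambda>s. Y + h *\<^sub>R z s) has_vector_derivative h *\<^sub>R z' s) (at s)"
        using has_vector_derivative_add[OF has_vector_derivative_const[of Y] hvd_bounded_linear[OF bounded_linear_scaleR_right[of h] dz], of s]
        by simp
      have "(v has_vector_derivative (- B (z' s) Y - h / 2 * (B (z s) (z' s) + B (z' s) (z s)),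
         (- k s / 2) *\<^sub>R flow A (- \<tau> s / 2) (A (Y + h *\<^sub>R z s)) + flow A (- \<tau> s / 2) (h *\<^sub>R z' s), 0)) (at s)"
        unfolding v_def
        by (intro has_vector_derivative_Pair 1 flow_hvd[OF lA d\<tau>2(2) 2] has_vector_derivative_const)
      moreover have "- nabla (\<lambda>_. Xv s) (\<lambda>_. v s) (\<gamma> s) = (- B (z' s) Y - h / 2 * (B (z s) (z' s) + B (z' s) (z s)),
         (- k s / 2) *\<^sub>R flow A (- \<tau> s / 2) (A (Y + h *\<^sub>R z s)) + flow A (- \<tau> s / 2) (h *\<^sub>R z' s), 0)"
      proof -
        obtain b where b: "Xv s = (b, X' s, k s)" using Xv(1)[of s] unfolding X'_def by (metis prod.collapse)
        have "B (A (X' s)) (flow A (- \<tau> s / 2) w) = 2 * B (z' s) w" for w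
          using flow_B[of "\<tau> s / 2" "A (X' s)" "flow A (- \<tau> s / 2) w"] flow_minus_cancel(1)[OF lA, of "\<tau> s / 2" w]
          by (simp add: z'_def B_simps)
        moreover have "flow A (- \<tau> s / 2) (z' s) = (1/2) *\<^sub>R A (X' s)"
          using flow_minus_cancel(2)[OF lA, of "\<tau> s / 2" "A (X' s)"] by (simp add: z'_def linear_cmul[OF lflow])
        ultimately show ?thesis
          using B_sym[of "z s" "z' s"]
          by (simp add: nabla_const b v_def B_simps linear_cmul[OF lflow] flow_commute[OF lA] scaleR_diff_right)
            (simp add: field_simps)
      qed
      ultimately show ?thesis by simp
    qed
    have "continuous_on {0..1} v"
      using has_vector_derivative_continuous[OF dv] by (simp add: continuous_at_imp_continuous_on)
    then have "parallel_along G M \<eta> nabla \<gamma> v"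
      unfolding parallel_along_def using vel dv by blast
    moreover have "v 0 = (a, Y, h)" by (simp add: v_def z_def end0 B_simps lA)
    moreover have "v 1 = (a - B (A (A X)) Y - h / 2 * B (A (A X)) (A (A X)), Y + h *\<^sub>R A (A X), h)"
      by (simp add: v_def z_def end1 B_simps lA)
    ultimately show ?thesis by blast
  qed
  show ?thesis
    unfolding holonomy_group_def
  proof (intro CollectI exI[of _ \<gamma>] conjI allI psp g01)
    show "\<exists>v. parallel_along G M \<eta> nabla \<gamma> v \<and> v 0 = w \<and>
      v 1 = (case w of (a, Y, h) \<Rightarrow> (a - B (A (A X)) Y - h / 2 * B (A (A X)) (A (A X)), Y + h *\<^sub>R A (A X), h))" for w
      using par[of "fst w" "fst (snd w)" "snd (snd w)"] by (cases w) simp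
  qed
qed

lemma nilp_in_holonomy_algebra: "nilp X \<in> holonomy_algebra G M \<eta> nabla"
  unfolding holonomy_algebra_def linear_group_lie_algebra_def
proof (intro CollectI conjI allI linear_nilp)
  fix r :: real
  \<comment> \<open>The loop built for \<open>X\<close> transports by the exponential of
    \<open>nilp (- X)\<close>, hence the sign.\<close>
  have "flow (nilp X) r = (\<lambda>(a, Y, h). (a - B (A (A (- r *\<^sub>R X))) Y - h / 2 * B (A (A (- r *\<^sub>R X))) (A (A (- r *\<^sub>R X))), Y + h *\<^sub>R A (A (- r *\<^sub>R X)), h))"
    by (rule ext) (auto simp: flow_nilp A_simps B_simps)
  then show "endo_exp (\<lambda>x. r *\<^sub>R nilp X x) \<in> holonomy_group G M \<eta> nabla"
    using transport_in_holonomy_group[of "- r *\<^sub>R X"] by (simp add: flow_def)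
qed

lemma holonomy_algebra_eq: "holonomy_algebra G M \<eta> nabla = {nilp X | X. True}"
  using holonomy_algebra_subset nilp_in_holonomy_algebra by blast

lemma nilp_commute: "nilp X \<circ> nilp Y = nilp Y \<circ> nilp X"
  using B_sym[of "A (A X)" "A (A Y)"] by (auto simp: nilp_def B_simps)

lemma nilp_so: "nilp X \<in> so_algebra Bf"
proof -
  have "Bf (nilp X u) w + Bf u (nilp X w) = 0" for u w
    by (cases u; cases w) (auto simp: nilp_def B_simps B_sym algebra_simps)
  then show ?thesis using linear_nilp by (simp add: so_algebra_def)
qed

end

section \<open>Clifford modules\<close>

lemma scaleR_matrix_vector: "(r *\<^sub>R M) *v \<psi> = r *\<^sub>R (M *v \<psi>)" for M :: "complex^'n^'m"
  by (simp add: vec_eq_iff matrix_vector_mult_def scaleR_sum_right)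

lemma matrix_vector_scaleR: "M *v (r *\<^sub>R \<psi>) = r *\<^sub>R (M *v \<psi>)" for M :: "complex^'n^'m"
  by (simp add: vec_eq_iff matrix_vector_mult_def scaleR_sum_right)

lemma bilinear_matrix_vector: "bilinear (\<lambda>(M :: complex^'n^'m) \<psi>. M *v \<psi>)"
  unfolding bilinear_def
  by (auto intro!: linearI simp: matrix_vector_mult_add_rdistrib matrix_vector_right_distrib scaleR_matrix_vector matrix_vector_scaleR)

lemma scaleR_eq_scale_vec: "r *\<^sub>R \<psi> = complex_of_real r *s \<psi>" for \<psi> :: "complex^'n"
proof (rule vec_eq_iff[THEN iffD2], rule allI)
  fix i
  show "(r *\<^sub>R \<psi>) $ i = (complex_of_real r *s \<psi>) $ i"
    unfolding vector_scaleR_component vector_smult_component by (rule scaleR_conv_of_real)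
qed

text \<open>Two nilpotency-type relations as in a Clifford algebra split \<open>K\<close> into two copies of the kernel of \<open>U\<close>;
  the sum below is direct because \<open>U\<close> maps \<open>U' \<phi>\<close> to \<open>c \<phi>\<close> for \<open>\<phi>\<close> in this kernel.\<close>

lemma dim_preimage_nilpotent:
  fixes K L :: "(complex^'n) set" and U U' :: "complex^'n^'n"
  assumes K: "vec.subspace K" and U: "\<And>\<psi>. \<psi> \<in> K \<Longrightarrow> U *v \<psi> \<in> K" "\<And>\<psi>. \<psi> \<in> K \<Longrightarrow> U' *v \<psi> \<in> K"
    and UU: "\<And>\<psi>. \<psi> \<in> K \<Longrightarrow> U *v (U *v \<psi>) = 0"
    and UU': "\<And>\<psi>. \<psi> \<in> K \<Longrightarrow> U *v (U' *v \<psi>) + U' *v (U *v \<psi>) = c *\<^sub>R \<psi>" and c: "c \<noteq> 0"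
    and L: "vec.subspace L" "L \<subseteq> {\<psi> \<in> K. U *v \<psi> = 0}"
  shows "vec.dim {\<psi> \<in> K. U *v \<psi> \<in> L} = vec.dim {\<psi> \<in> K. U *v \<psi> = 0} + vec.dim L"
proof -
  define K0 where "K0 = {\<psi> \<in> K. U *v \<psi> = 0}"
  have sK0: "vec.subspace K0"
    using K unfolding K0_def vec.subspace_def
    by (auto simp: matrix_vector_right_distrib vector_scalar_commute)
  have scale: "r *\<^sub>R \<psi> \<in> S" if "vec.subspace S" "\<psi> \<in> S" for r \<psi> and S :: "(complex^'n) set"
    using vec.subspace_scale[OF that] by (simp add: scaleR_eq_scale_vec)
  have UL: "U *v (U' *v \<phi>) = c *\<^sub>R \<phi>" if "\<phi> \<in> L" for \<phi>
    using UU'[of \<phi>] L(2) that by auto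
  have sUL: "vec.subspace ((*v) U' ` L)" by (rule vec.subspace_image[OF L(1)])
  have inj: "inj_on ((*v) U') (vec.span L)"
    unfolding vec.span_eq_iff[THEN iffD2, OF L(1)]
  proof (rule inj_onI)
    fix x y assume xy: "x \<in> L" "y \<in> L" "U' *v x = U' *v y"
    have "c *\<^sub>R x = c *\<^sub>R y" unfolding UL[OF xy(1), symmetric] UL[OF xy(2), symmetric] xy(3) ..
    then show "x = y" using c by (simp only: scaleR_cancel_left simp_thms)
  qed
  have "{\<psi> \<in> K. U *v \<psi> \<in> L} = {x + y | x y. x \<in> K0 \<and> y \<in> (*v) U' ` L}"
  proof (intro equalityI subsetI)
    fix \<psi> assume "\<psi> \<in> {\<psi> \<in> K. U *v \<psi> \<in> L}"
    then have \<psi>: "\<psi> \<in> K" "U *v \<psi> \<in> L" by auto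
    have "\<psi> = (1/c) *\<^sub>R (U *v (U' *v \<psi>)) + U' *v ((1/c) *\<^sub>R (U *v \<psi>))"
      using arg_cong[OF UU'[OF \<psi>(1)], of "\<lambda>x. (1/c) *\<^sub>R x"] c
      by (simp add: matrix_vector_scaleR scaleR_add_right)
    moreover have "U *v (U' *v \<psi>) \<in> K0" using U UU[OF U(2)[OF \<psi>(1)]] \<psi>(1) by (simp add: K0_def)
    then have "(1/c) *\<^sub>R (U *v (U' *v \<psi>)) \<in> K0" by (rule scale[OF sK0])
    moreover have "U' *v ((1/c) *\<^sub>R (U *v \<psi>)) \<in> (*v) U' ` L" using scale[OF L(1) \<psi>(2)] by blast
    ultimately show "\<psi> \<in> {x + y | x y. x \<in> K0 \<and> y \<in> (*v) U' ` L}" by blast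
  next
    fix \<psi> assume "\<psi> \<in> {x + y | x y. x \<in> K0 \<and> y \<in> (*v) U' ` L}"
    then obtain x \<phi> where x: "x \<in> K0" "\<phi> \<in> L" "\<psi> = x + U' *v \<phi>" by blast
    have "\<phi> \<in> K" using x L(2) by auto
    then have "\<psi> \<in> K" using x U vec.subspace_add[OF K] by (simp add: K0_def)
    moreover have "U *v \<psi> = c *\<^sub>R \<phi>" using x UL[OF x(2)] by (simp add: matrix_vector_right_distrib K0_def)
    ultimately show "\<psi> \<in> {\<psi> \<in> K. U *v \<psi> \<in> L}" using scale[OF L(1) x(2)] by simp
  qed
  moreover have "K0 \<inter> (*v) U' ` L = {0}"
  proof (intro equalityI subsetI)
    fix x assume "x \<in> K0 \<inter> (*v) U' ` L"
    then obtain \<phi> where "\<phi> \<in> L" "x = U' *v \<phi>" "U *v x = 0" by (auto simp: K0_def)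
    then show "x \<in> {0}" using UL c by auto
  qed (use vec.subspace_0[OF sK0] vec.subspace_0[OF sUL] in auto)
  ultimately show ?thesis
    using vec.dim_sums_Int[OF sK0 sUL] vec.dim_image_eq[OF matrix_vector_mul_linear_gen inj] by (simp add: K0_def)
qed

locale clifford =
  fixes b :: "'l::euclidean_space \<Rightarrow> 'l \<Rightarrow> real" and cl :: "'l \<Rightarrow> complex^'s^'s"
  assumes b_bilinear: "bilinear b" and b_sym: "b x y = b y x" and cl_linear: "linear cl"
    and clifford: "cl x ** cl y + cl y ** cl x = (- 2 * b x y) *\<^sub>R mat 1"
begin

definition cm :: "'l \<Rightarrow> complex^'s \<Rightarrow> complex^'s" where "cm x \<psi> = cl x *v \<psi>"

lemma cm_bilinear: "bilinear cm"
  unfolding bilinear_def cm_def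
  by (auto intro!: linearI simp: linear_add[OF cl_linear] linear_cmul[OF cl_linear] matrix_vector_mult_add_rdistrib
      matrix_vector_right_distrib scaleR_matrix_vector matrix_vector_scaleR)

lemmas cm_simps = bilinear_ladd[OF cm_bilinear] bilinear_radd[OF cm_bilinear] bilinear_lmul[OF cm_bilinear]
  bilinear_rmul[OF cm_bilinear] bilinear_lsub[OF cm_bilinear] bilinear_rsub[OF cm_bilinear]
  bilinear_lzero[OF cm_bilinear] bilinear_rzero[OF cm_bilinear] bilinear_lneg[OF cm_bilinear] bilinear_rneg[OF cm_bilinear]

lemmas b_simps = bilinear_ladd[OF b_bilinear] bilinear_radd[OF b_bilinear] bilinear_lmul[OF b_bilinear]
  bilinear_rmul[OF b_bilinear] bilinear_lsub[OF b_bilinear] bilinear_rsub[OF b_bilinear]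
  bilinear_lzero[OF b_bilinear] bilinear_rzero[OF b_bilinear] bilinear_lneg[OF b_bilinear] bilinear_rneg[OF b_bilinear]

lemma cm_anticommute: "cm x (cm y \<psi>) = - cm y (cm x \<psi>) - (2 * b x y) *\<^sub>R \<psi>"
proof -
  have "(cl x ** cl y + cl y ** cl x) *v \<psi> = (- 2 * b x y) *\<^sub>R \<psi>"
    unfolding clifford scaleR_matrix_vector by simp
  then have "cm x (cm y \<psi>) + cm y (cm x \<psi>) = (- 2 * b x y) *\<^sub>R \<psi>"
    by (simp add: cm_def matrix_vector_mult_add_rdistrib matrix_vector_mul_assoc)
  then show ?thesis by (simp add: algebra_simps eq_neg_iff_add_eq_0)
qed

lemma cm_square: "cm x (cm x \<psi>) = - b x x *\<^sub>R \<psi>"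
proof -
  have "2 *\<^sub>R cm x (cm x \<psi>) = 2 *\<^sub>R (- b x x *\<^sub>R \<psi>)"
    using cm_anticommute[of x x \<psi>] by (simp add: scaleR_2 eq_neg_iff_add_eq_0 algebra_simps)
  then show ?thesis by (simp only: scaleR_cancel_left) simp
qed

lemma subspace_cm_kernel: "vec.subspace {\<psi>. \<forall>x\<in>S. cm x \<psi> = 0}"
  unfolding vec.subspace_def cm_def
  by (auto simp: matrix_vector_right_distrib vector_scalar_commute)

text \<open>\<open>dim_preimage_nilpotent\<close> on the joint kernel of \<open>S\<close>. The null
  vector \<open>w\<close> squares to zero, the dual vector \<open>w'\<close> gives the constant
  \<open>c\<close>, and both preserve the joint kernel because they are orthogonal to
  \<open>S\<close>.\<close>

lemma dim_cm_kernel_insert: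
  assumes S: "\<And>v. v \<in> S \<Longrightarrow> b v w = 0" "\<And>v. v \<in> S \<Longrightarrow> b v w' = 0" and w: "b w w = 0" "b w w' \<noteq> 0"
    and L: "vec.subspace L" "L \<subseteq> {\<psi>. \<forall>x\<in>insert w S. cm x \<psi> = 0}"
  shows "vec.dim {\<psi>. (\<forall>x\<in>S. cm x \<psi> = 0) \<and> cm w \<psi> \<in> L} = vec.dim {\<psi>. \<forall>x\<in>insert w S. cm x \<psi> = 0} + vec.dim L"
proof -
  define K where "K = {\<psi>. \<forall>x\<in>S. cm x \<psi> = 0}"
  have pres: "cm z \<psi> \<in> K" if "\<psi> \<in> K" "\<And>v. v \<in> S \<Longrightarrow> b v z = 0" for z \<psi>
    using that cm_anticommute[of _ z \<psi>] by (auto simp: K_def cm_simps)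
  have "vec.dim {\<psi> \<in> K. cl w *v \<psi> \<in> L} = vec.dim {\<psi> \<in> K. cl w *v \<psi> = 0} + vec.dim L"
  proof (rule dim_preimage_nilpotent[where U'="cl w'" and c="- 2 * b w w'"])
    show "vec.subspace K" unfolding K_def by (rule subspace_cm_kernel)
    fix \<psi>
    show "cl w *v (cl w' *v \<psi>) + cl w' *v (cl w *v \<psi>) = (- 2 * b w w') *\<^sub>R \<psi>"
      using cm_anticommute[of w w' \<psi>] by (simp add: cm_def)
    show "cl w *v (cl w *v \<psi>) = 0" using cm_square[of w \<psi>] w(1) by (simp add: cm_def)
  qed (use pres S w L in \<open>auto simp: cm_def K_def\<close>)
  moreover have "{\<psi> \<in> K. cl w *v \<psi> \<in> L} = {\<psi>. (\<forall>x\<in>S. cm x \<psi> = 0) \<and> cm w \<psi> \<in> L}"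
    "{\<psi> \<in> K. cl w *v \<psi> = 0} = {\<psi>. \<forall>x\<in>insert w S. cm x \<psi> = 0}" by (auto simp: K_def cm_def)
  ultimately show ?thesis by simp
qed

text \<open>Take for \<open>L\<close> the whole smaller kernel: multiplication by \<open>w\<close>
  always lands in it, so the condition on \<open>cm w \<psi>\<close> holds automatically.\<close>

lemma dim_cm_kernel_half:
  assumes S: "\<And>v. v \<in> S \<Longrightarrow> b v w = 0" "\<And>v. v \<in> S \<Longrightarrow> b v w' = 0" and w: "b w w = 0" "b w w' \<noteq> 0"
  shows "vec.dim {\<psi>. \<forall>x\<in>S. cm x \<psi> = 0} = 2 * vec.dim {\<psi>. \<forall>x\<in>insert w S. cm x \<psi> = 0}"
proof -
  let ?L = "{\<psi>. \<forall>x\<in>insert w S. cm x \<psi> = 0}"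
  have "cm x (cm w \<psi>) = 0" if "x \<in> insert w S" "\<forall>x\<in>S. cm x \<psi> = 0" for x \<psi>
    using that cm_anticommute[of x w \<psi>] cm_square[of w \<psi>] S(1) w(1) by (auto simp: cm_simps)
  then have e: "{\<psi>. (\<forall>x\<in>S. cm x \<psi> = 0) \<and> cm w \<psi> \<in> ?L} = {\<psi>. \<forall>x\<in>S. cm x \<psi> = 0}" by blast
  have "vec.dim {\<psi>. (\<forall>x\<in>S. cm x \<psi> = 0) \<and> cm w \<psi> \<in> ?L} = vec.dim ?L + vec.dim ?L"
    by (rule dim_cm_kernel_insert[OF assms subspace_cm_kernel order_refl])
  then show ?thesis unfolding e by simp
qed

lemma dim_cm_kernel_isotropic:
  assumes nondeg: "\<And>x. (\<And>y. b x y = 0) \<Longrightarrow> x = 0"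
    and "finite S" "independent S" "totally_isotropic b S"
  shows "vec.dim {\<psi>. \<forall>x\<in>S. cm x \<psi> = 0} * 2 ^ card S = CARD('s)"
  using assms(2-4)
proof (induction S rule: finite_induct)
  case empty
  show ?case using vec_dim_card[where 'a=complex and 'n='s] by (simp del: vec.dim_UNIV)
next
  case (insert w S)
  have indep: "independent S" "w \<notin> span S"
    using insert.prems(1) insert.hyps(2) by (auto simp: independent_insert)
  have iso: "b v w = 0" "b w w = 0" "totally_isotropic b S" if "v \<in> S" for v
    using insert.prems(2) that by (auto simp: totally_isotropic_def)
  have iso': "b w w = 0" "totally_isotropic b S" using insert.prems(2) by (auto simp: totally_isotropic_def)
  \<comment> \<open>A dual vector for \<open>w\<close> relative to \<open>S\<close>. Without one,
    \<open>b w _\<close> would vanish wherever all \<open>b v _\<close> with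
    \<open>v \<in> S\<close> do, and would be a combination of them; non-degeneracy would then put
    \<open>w\<close> into the span of \<open>S\<close>.\<close>
  have "\<exists>w'. (\<forall>v\<in>S. b v w' = 0) \<and> b w w' \<noteq> 0"
  proof (rule ccontr)
    assume "\<not> ?thesis"
    then have no: "b w c = 0" if "\<And>v. v \<in> S \<Longrightarrow> b v c = 0" for c using that by blast
    \<comment> \<open>Represents the functional \<open>b v _\<close> by a Euclidean vector, so that
      \<open>subspace_memI\<close> applies.\<close>
    define L where "L v = (\<Sum>i\<in>Basis. b v i *\<^sub>R i)" for v
    have Lb: "L v \<bullet> c = b v c" for v c
    proof -
      have "b v c = b v (\<Sum>i\<in>Basis. (c \<bullet> i) *\<^sub>R i)" by (simp add: euclidean_representation)
      also have "\<dots> = (\<Sum>i\<in>Basis. (c \<bullet> i) * b v i)"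
        using b_bilinear by (simp add: bilinear_def linear_sum linear_cmul)
      finally show ?thesis by (simp add: L_def inner_sum_left) (simp add: inner_commute mult.commute)
    qed
    have lL: "linear L"
      by (rule linearI) (auto simp: L_def b_simps sum.distrib scaleR_left_distrib scaleR_sum_right)
    have "L w \<in> span (L ` S)"
    proof (rule subspace_memI[OF subspace_span])
      fix c assume c: "\<And>z. z \<in> span (L ` S) \<Longrightarrow> z \<bullet> c = 0"
      have "b v c = 0" if "v \<in> S" for v using c[OF span_base[OF imageI[OF that]]] by (simp add: Lb)
      then show "L w \<bullet> c = 0" using no by (simp add: Lb)
    qed
    then obtain s where s: "s \<in> span S" "L w = L s" by (auto simp: linear_span_image[OF lL])
    have "b (w - s) y = 0" for y using arg_cong[OF s(2), of "\<lambda>x. x \<bullet> y"] by (simp add: Lb b_simps)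
    then have "w - s = 0" by (rule nondeg)
    then show False using s(1) indep(2) by simp
  qed
  then obtain w' where w': "\<And>v. v \<in> S \<Longrightarrow> b v w' = 0" "b w w' \<noteq> 0" by blast
  have "vec.dim {\<psi>. \<forall>x\<in>S. cm x \<psi> = 0} = 2 * vec.dim {\<psi>. \<forall>x\<in>insert w S. cm x \<psi> = 0}"
    by (rule dim_cm_kernel_half[OF iso(1) w'(1) iso'(1) w'(2)])
  then show ?case using insert.IH[OF indep(1) iso'(2)] insert.hyps by simp
qed

lemma cm_kernel_span: "{\<psi>. \<forall>x\<in>span S. cm x \<psi> = 0} = {\<psi>. \<forall>x\<in>S. cm x \<psi> = 0}"
proof -
  have "cm x \<psi> = 0" if "\<forall>x\<in>S. cm x \<psi> = 0" "x \<in> span S" for x \<psi>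
  proof -
    have l: "linear (\<lambda>x. cm x \<psi>)" using cm_bilinear by (simp add: bilinear_def)
    show ?thesis using linear_eq_0_on_span[OF l _ that(2)] that(1) by blast
  qed
  then show ?thesis using span_base by blast
qed

end

section \<open>The spin representation in a pseudo-orthonormal frame\<close>

locale clifford_frame = clifford b cl for b :: "'l::euclidean_space \<Rightarrow> 'l \<Rightarrow> real" and cl :: "'l \<Rightarrow> complex^'s^'s" +
  fixes E assumes onb: "pseudo_onb b E"
begin

lemma finite_E: "finite E"
  using onb by (simp add: pseudo_onb_def independent_imp_finite)

lemma expansion: "x = (\<Sum>e\<in>E. (b e e * b x e) *\<^sub>R e)"
proof -
  have "linear (\<lambda>x. \<Sum>e\<in>E. (b e e * b x e) *\<^sub>R e)"
    by (rule linearI) (auto simp: b_simps sum.distrib scaleR_left_distrib scaleR_sum_right algebra_simps)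
  moreover have "x \<in> span E" using onb by (simp add: pseudo_onb_def)
  moreover have "(\<Sum>e\<in>E. (b e e * b f e) *\<^sub>R e) = f" if f: "f \<in> E" for f
  proof -
    have "(\<Sum>e\<in>E. (b e e * b f e) *\<^sub>R e) = (\<Sum>e\<in>{f}. (b e e * b f e) *\<^sub>R e)"
      using onb f finite_E unfolding pseudo_onb_def by (intro sum.mono_neutral_right) auto
    moreover have "b f f * b f f = 1" using onb f unfolding pseudo_onb_def by force
    ultimately show ?thesis by simp
  qed
  ultimately show ?thesis using linear_eq_on_span[OF linear_ident, of "\<lambda>x. \<Sum>e\<in>E. (b e e * b x e) *\<^sub>R e" E x] by simp
qed

lemma linear_expansion: "linear L \<Longrightarrow> (\<Sum>e\<in>E. (b e e * b x e) *\<^sub>R L e) = L x"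
  using arg_cong[OF expansion[of x], of L] by (simp add: linear_sum linear_cmul)

definition spin :: "('l \<Rightarrow> 'l) \<Rightarrow> complex^'s \<Rightarrow> complex^'s" where
  "spin D \<psi> = spin_action b cl E D *v \<psi>"

lemma spin_eq: "spin D \<psi> = (\<Sum>e\<in>E. \<Sum>f\<in>E. (1/4 * b e e * b f f * b (D e) f) *\<^sub>R cm e (cm f \<psi>))"
proof -
  have "bilinear (\<lambda>(M :: complex^'s^'s) \<psi>. M *v \<psi>)" by (rule bilinear_matrix_vector)
  then have l: "linear (\<lambda>M :: complex^'s^'s. M *v \<psi>)" by (simp add: bilinear_def)
  show ?thesis
    unfolding spin_def spin_action_def linear_sum[OF l] linear_cmul[OF l] by (simp add: cm_def matrix_vector_mul_assoc)
qed

lemma linear_spin: "linear (spin D)"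
  using bilinear_matrix_vector by (simp add: bilinear_def spin_def[abs_def])

lemma spin_scale_vec: "spin D (z *s \<psi>) = z *s spin D \<psi>"
  by (simp add: spin_def vector_scalar_commute)

lemma spin_add: "spin (\<lambda>y. D y + D' y) \<psi> = spin D \<psi> + spin D' \<psi>"
  by (simp add: spin_eq b_simps distrib_left scaleR_left_distrib sum.distrib)

lemma spin_scale: "spin (\<lambda>y. r *\<^sub>R D y) \<psi> = r *\<^sub>R spin D \<psi>"
  by (simp add: spin_eq b_simps scaleR_sum_right mult_ac)

text \<open>On the decomposable endomorphism \<open>u \<and> w\<close> the sum over the frame
  collapses to a Clifford commutator. This frees the connection from the choice of
  \<open>E\<close>.\<close>

lemma spin_wedge: "spin (\<lambda>y. b u y *\<^sub>R w - b w y *\<^sub>R u) \<psi> = (1/4) *\<^sub>R (cm u (cm w \<psi>) - cm w (cm u \<psi>))"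
proof -
  have cc: "cm u (cm w \<psi>) = (\<Sum>e\<in>E. \<Sum>f\<in>E. (b e e * b u e * (b f f * b w f)) *\<^sub>R cm e (cm f \<psi>))" for u w
  proof -
    have l1: "linear (\<lambda>x. cm x \<phi>)" "linear (cm x)" for x \<phi> using cm_bilinear by (simp_all add: bilinear_def)
    have "cm u (cm w \<psi>) = (\<Sum>e\<in>E. (b e e * b u e) *\<^sub>R cm e (cm w \<psi>))" by (rule linear_expansion[OF l1(1), symmetric])
    also have "\<dots> = (\<Sum>e\<in>E. (b e e * b u e) *\<^sub>R cm e (\<Sum>f\<in>E. (b f f * b w f) *\<^sub>R cm f \<psi>))"
      by (simp only: linear_expansion[OF l1(1)])
    also have "\<dots> = (\<Sum>e\<in>E. \<Sum>f\<in>E. (b e e * b u e * (b f f * b w f)) *\<^sub>R cm e (cm f \<psi>))"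
      by (simp add: linear_sum[OF l1(2)] linear_cmul[OF l1(2)] scaleR_sum_right)
    finally show ?thesis .
  qed
  show ?thesis
    unfolding spin_eq cc[of u w] cc[of w u] sum_subtractf[symmetric] scaleR_sum_right
    by (intro sum.cong refl) (simp add: b_simps b_sym[of _ u] algebra_simps b_sym[of w] flip: scaleR_left_diff_distrib)
qed

text \<open>The commutator of the spin action of \<open>D\<close> with Clifford multiplication by
  \<open>v\<close> is multiplication by \<open>D v\<close>. Moving \<open>v\<close> past two frame
  vectors leaves two contractions, which skewness makes equal.\<close>

lemma spin_cm:
  assumes D: "linear D" and skew: "\<And>x y. b (D x) y = - b x (D y)"
  shows "spin D (cm v \<psi>) = cm v (spin D \<psi>) + cm (D v) \<psi>"
proof -
  have l1: "linear (\<lambda>x. cm x \<phi>)" "linear (cm x)" for x \<phi> using cm_bilinear by (simp_all add: bilinear_def)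
  define k where "k e f = b e e * b f f * b (D e) f" for e f
  have e3: "cm e (cm f (cm v \<psi>)) = cm v (cm e (cm f \<psi>)) + (2 * b e v) *\<^sub>R cm f \<psi> - (2 * b f v) *\<^sub>R cm e \<psi>" for e f
    by (simp add: cm_anticommute[of f v \<psi>] cm_anticommute[of e v "cm f \<psi>"] cm_simps)
  have s1: "(\<Sum>e\<in>E. \<Sum>f\<in>E. (k e f * b e v) *\<^sub>R cm f \<psi>) = cm (D v) \<psi>"
  proof -
    have "(\<Sum>e\<in>E. \<Sum>f\<in>E. (k e f * b e v) *\<^sub>R cm f \<psi>) = (\<Sum>e\<in>E. (b e e * b v e) *\<^sub>R (\<Sum>f\<in>E. (b f f * b (D e) f) *\<^sub>R cm f \<psi>))"
      by (simp add: k_def scaleR_sum_right b_sym[of v] mult_ac)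
    also have "\<dots> = (\<Sum>e\<in>E. (b e e * b v e) *\<^sub>R cm (D e) \<psi>)" by (simp only: linear_expansion[OF l1(1)])
    also have "\<dots> = cm (D v) \<psi>"
      using linear_expansion[OF linear_compose[OF D l1(1)]] by (simp add: o_def)
    finally show ?thesis .
  qed
  have "k e f = - k f e" for e f using skew[of e f] b_sym[of e "D f"] by (simp add: k_def)
  then have "(\<Sum>e\<in>E. \<Sum>f\<in>E. (k e f * b f v) *\<^sub>R cm e \<psi>) = (\<Sum>e\<in>E. \<Sum>f\<in>E. - ((k f e * b f v) *\<^sub>R cm e \<psi>))"
    by (intro sum.cong refl) (metis mult_minus_left scaleR_minus_left)
  also have "\<dots> = - (\<Sum>f\<in>E. \<Sum>e\<in>E. (k f e * b f v) *\<^sub>R cm e \<psi>)"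
    by (subst sum.swap) (simp add: sum_negf)
  finally have s2: "(\<Sum>e\<in>E. \<Sum>f\<in>E. (k e f * b f v) *\<^sub>R cm e \<psi>) = - cm (D v) \<psi>" by (simp add: s1)
  have "spin D (cm v \<psi>) = (\<Sum>e\<in>E. \<Sum>f\<in>E. (k e f / 4) *\<^sub>R cm v (cm e (cm f \<psi>))
     + ((1/2) *\<^sub>R ((k e f * b e v) *\<^sub>R cm f \<psi>) - (1/2) *\<^sub>R ((k e f * b f v) *\<^sub>R cm e \<psi>)))"
    unfolding spin_eq e3 by (intro sum.cong refl) (simp add: k_def scaleR_add_right scaleR_diff_right field_simps)
  also have "\<dots> = cm v (spin D \<psi>) + ((1/2) *\<^sub>R (\<Sum>e\<in>E. \<Sum>f\<in>E. (k e f * b e v) *\<^sub>R cm f \<psi>)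
      - (1/2) *\<^sub>R (\<Sum>e\<in>E. \<Sum>f\<in>E. (k e f * b f v) *\<^sub>R cm e \<psi>))"
    unfolding spin_eq linear_sum[OF l1(2)] linear_cmul[OF l1(2)] scaleR_sum_right
    by (simp add: sum.distrib sum_subtractf k_def)
  also have "\<dots> = cm v (spin D \<psi>) + cm (D v) \<psi>"
    unfolding s1 s2 by (simp flip: scaleR_left_distrib)
  finally show ?thesis .
qed

end

section \<open>Parallel spinors\<close>

locale dext_spinors = dext_holonomy B A G M \<eta> ca cx ct nabla + clifford_frame "dext_form B" cl E
  for B :: "'v::euclidean_space \<Rightarrow> 'v \<Rightarrow> real" and A
    and G :: "('g::{t2_space,second_countable_topology}, 'r) monoid_scheme"
    and M :: "('g, 'e::euclidean_space) atlas"
    and \<eta> :: "real \<times> 'v \<times> real \<Rightarrow> 'g" and ca cx ct nabla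
    and cl :: "real \<times> 'v \<times> real \<Rightarrow> complex^'s^'s" and E
begin

abbreviation \<alpha> :: "real \<times> 'v \<times> real" where "\<alpha> \<equiv> (1, 0, 0)"
abbreviation \<iota> :: "'v \<Rightarrow> real \<times> 'v \<times> real" where "\<iota> Z \<equiv> (0, Z, 0)"

definition P :: "'v \<Rightarrow> complex^'s \<Rightarrow> complex^'s" where "P Z \<psi> = cm \<alpha> (cm (\<iota> Z) \<psi>)"

definition ad_H :: "real \<times> 'v \<times> real \<Rightarrow> real \<times> 'v \<times> real" where "ad_H = (\<lambda>(a, Y, h). (0, A Y, 0))"

definition \<sigma> :: "complex^'s \<Rightarrow> complex^'s" where "\<sigma> = spin ad_H"

lemma linear_\<sigma>: "linear \<sigma>" unfolding \<sigma>_def by (rule linear_spin)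

lemma P_bilinear: "bilinear P"
proof -
  have "cm (\<iota> (Y + Z)) \<psi> = cm (\<iota> Y) \<psi> + cm (\<iota> Z) \<psi>" "cm (\<iota> (r *\<^sub>R Y)) \<psi> = r *\<^sub>R cm (\<iota> Y) \<psi>" for Y Z r \<psi>
    using cm_simps(1)[of "\<iota> Y" "\<iota> Z" \<psi>] cm_simps(3)[of r "\<iota> Y" \<psi>] by simp_all
  then show ?thesis unfolding bilinear_def P_def by (auto intro!: linearI simp: cm_simps)
qed

lemmas P_simps = bilinear_ladd[OF P_bilinear] bilinear_radd[OF P_bilinear] bilinear_lmul[OF P_bilinear]
  bilinear_rmul[OF P_bilinear] bilinear_lsub[OF P_bilinear] bilinear_rsub[OF P_bilinear]
  bilinear_lzero[OF P_bilinear] bilinear_rzero[OF P_bilinear] bilinear_lneg[OF P_bilinear] bilinear_rneg[OF P_bilinear]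

lemma bbP: "bounded_bilinear P" using P_bilinear by (simp add: bilinear_conv_bounded_bilinear)

lemma cm_alpha_iota: "cm (\<iota> Z) (cm \<alpha> \<psi>) = - P Z \<psi>"
  using cm_anticommute[of "\<iota> Z" \<alpha> \<psi>] by (simp add: P_def B_simps)

lemma cm_alpha_square: "cm \<alpha> (cm \<alpha> \<psi>) = 0"
  using cm_square[of \<alpha> \<psi>] by (simp add: B_simps)

text \<open>The null vector \<open>\<alpha>\<close> anticommutes with the vectors of
  \<open>g\<close>, so two factors \<open>\<alpha>\<close> meet and annihilate each other.\<close>

lemma PP: "P Y (P Z \<psi>) = 0"
  by (simp add: P_def[of Y] P_def[of Z \<psi>] cm_alpha_iota) (simp add: P_def cm_alpha_square cm_simps)

lemma \<sigma>_cm: "\<sigma> (cm v \<psi>) = cm v (\<sigma> \<psi>) + cm (ad_H v) \<psi>"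
  unfolding \<sigma>_def
proof (rule spin_cm)
  show "linear ad_H" by (rule linearI) (auto simp: ad_H_def A_simps)
  show "Bf (ad_H x) y = - Bf x (ad_H y)" for x y by (cases x; cases y) (simp add: ad_H_def B_skew)
qed

lemma \<sigma>_P: "\<sigma> (P Z \<psi>) = P Z (\<sigma> \<psi>) + P (A Z) \<psi>"
proof -
  have "ad_H \<alpha> = 0" "ad_H (\<iota> Z) = \<iota> (A Z)" by (simp_all add: ad_H_def A_simps zero_prod_def)
  then show ?thesis by (simp add: P_def \<sigma>_cm cm_simps)
qed

text \<open>The flow of \<open>\<sigma>\<close> covers the rotation \<open>e^(sA)\<close>: undoing
  it on the right side gives a function of \<open>s\<close> with zero derivative by
  \<open>\<sigma>_P\<close>.\<close>

lemma flow_P: "flow \<sigma> s (P Z \<psi>) = P (flow A s Z) (flow \<sigma> s \<psi>)"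
proof -
  define F where "F s = flow \<sigma> (- s) (P (flow A s Z) (flow \<sigma> s \<psi>))" for s
  have "(F has_vector_derivative 0) (at s)" for s
  proof -
    have 1: "((\<lambda>s. P (flow A s Z) (flow \<sigma> s \<psi>)) has_vector_derivative
       P (flow A s Z) (flow \<sigma> s (\<sigma> \<psi>)) + P (flow A s (A Z)) (flow \<sigma> s \<psi>)) (at s)"
      by (rule bounded_bilinear.has_vector_derivative[OF bbP flow_has_vector_derivative[OF lA] flow_has_vector_derivative[OF linear_\<sigma>]])
    have 2: "((\<lambda>s. - s) has_vector_derivative - 1) (at s)"
      by (auto intro!: derivative_eq_intros)
    show ?thesis
      using flow_hvd[OF linear_\<sigma> 2 1] unfolding F_def
      by (simp add: \<sigma>_P flow_commute[OF lA] flow_commute[OF linear_\<sigma>])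
  qed
  then have "F s = F 0" by (intro has_derivative_zero_imp_const) (simp add: has_vector_derivative_def)
  then have "flow \<sigma> s (F s) = flow \<sigma> s (P Z \<psi>)" by (simp add: F_def lA linear_\<sigma>)
  then show ?thesis by (simp add: F_def linear_\<sigma>)
qed

text \<open>The endomorphism \<open>y \<mapsto> \<nabla>_X y\<close> splits into a multiple of
  \<open>ad_H\<close> and a wedge with \<open>\<alpha>\<close>; the central component
  \<open>b\<close> drops out.\<close>

lemma spin_connection:
  "spin (\<lambda>y. nabla (\<lambda>_. (b, X, k)) (\<lambda>_. y) g) \<psi> = (k / 2) *\<^sub>R \<sigma> \<psi> - (1/4) *\<^sub>R P (A X) \<psi>"
proof -
  have "nabla (\<lambda>_. (b, X, k)) (\<lambda>_. y) g = (k / 2) *\<^sub>R ad_H y + (1/2) *\<^sub>R (Bf (\<iota> (A X)) y *\<^sub>R \<alpha> - Bf \<alpha> y *\<^sub>R \<iota> (A X))" for y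
    by (cases y) (simp add: nabla_const ad_H_def B_simps scaleR_diff_right)
  then have "spin (\<lambda>y. nabla (\<lambda>_. (b, X, k)) (\<lambda>_. y) g) \<psi> =
     spin (\<lambda>y. (k / 2) *\<^sub>R ad_H y + (1/2) *\<^sub>R (Bf (\<iota> (A X)) y *\<^sub>R \<alpha> - Bf \<alpha> y *\<^sub>R \<iota> (A X))) \<psi>" by simp
  also have "\<dots> = (k / 2) *\<^sub>R \<sigma> \<psi> + (1/2) *\<^sub>R ((1/4) *\<^sub>R (cm (\<iota> (A X)) (cm \<alpha> \<psi>) - cm \<alpha> (cm (\<iota> (A X)) \<psi>)))"
    by (simp only: spin_add spin_scale spin_wedge \<sigma>_def)
  also have "\<dots> = (k / 2) *\<^sub>R \<sigma> \<psi> - (1/4) *\<^sub>R P (A X) \<psi>"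
    by (simp add: cm_alpha_iota scaleR_diff_right flip: P_def scaleR_left_distrib)
  finally show ?thesis .
qed

section \<open>The parallel spinor equation and its solutions\<close>

abbreviation "PS \<equiv> parallel_spinors G M \<eta> Bf nabla cl E"

lemma parallel_iff:
  "\<psi> \<in> PS \<longleftrightarrow> (\<forall>g. mfd_smooth_at M \<psi> g) \<and>
     (\<forall>b X k g. ld (b, X, k) \<psi> g = (1/4) *\<^sub>R P (A X) (\<psi> g) - (k / 2) *\<^sub>R \<sigma> (\<psi> g))"
proof -
  have "ld (b, X, k) \<psi> g + spin_action Bf cl E (\<lambda>y. nabla (\<lambda>_. (b, X, k)) (\<lambda>_. y) g) *v \<psi> g = 0 \<longleftrightarrow>
     ld (b, X, k) \<psi> g = (1/4) *\<^sub>R P (A X) (\<psi> g) - (k / 2) *\<^sub>R \<sigma> (\<psi> g)" for b X k g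
    using spin_connection[of b X k g "\<psi> g"] unfolding spin_def
    by (simp add: eq_neg_iff_add_eq_0[symmetric] minus_diff_eq)
  then show ?thesis
    unfolding parallel_spinors_def by (simp add: smooth_fun_on_iff split_paired_all)
qed

text \<open>The spinors annihilated by the holonomy algebra: by \<open>spin_wedge\<close>,
  \<open>nilp Z\<close> acts as \<open>- P (A (A Z)) / 2\<close>.\<close>

definition inv_spinors :: "(complex^'s) set" where "inv_spinors = {\<psi>. \<forall>Z. P (A (A Z)) \<psi> = 0}"

lemma flow_inv_spinors:
  assumes "\<psi> \<in> inv_spinors"
  shows "flow \<sigma> s \<psi> \<in> inv_spinors"
proof -
  have "P (A (A Z)) (flow \<sigma> s \<psi>) = flow \<sigma> s (P (A (A (flow A (- s) Z))) \<psi>)" for Z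
    by (simp add: flow_P flow_commute[OF lA] lA)
  then show ?thesis using assms by (simp add: inv_spinors_def linear_0[OF linear_flow[OF linear_\<sigma>]])
qed

text \<open>Integrability for the bracket of \<open>H\<close> and \<open>Z\<close>. The equation in
  direction \<open>[H, Z] = A Z\<close> gives \<open>P (A (A Z)) / 4\<close>, while the commutator
  of the two derivatives gives \<open>P (A (A Z)) / 8\<close>.\<close>

lemma parallel_inv_spinors:
  assumes \<psi>: "\<psi> \<in> PS"
  shows "\<psi> g \<in> inv_spinors"
proof -
  have sm: "mfd_smooth_at M \<psi> g" and ld: "ld (b, X, k) \<psi> = (\<lambda>g. (1/4) *\<^sub>R P (A X) (\<psi> g) - (k / 2) *\<^sub>R \<sigma> (\<psi> g))" for b X k g
    using \<psi> by (auto simp: parallel_iff)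
  have bl: "bounded_linear (P Y)" "bounded_linear \<sigma>" for Y
    using P_bilinear linear_\<sigma> by (simp_all add: bilinear_def linear_conv_bounded_linear)
  have "P (A (A Z)) (\<psi> g) = 0" for Z
  proof -
    have 1: "ld (\<iota> Z) \<psi> = (\<lambda>g. (1/4) *\<^sub>R P (A Z) (\<psi> g))" and 2: "ld (0, 0, 1) \<psi> = (\<lambda>g. (-1/2) *\<^sub>R \<sigma> (\<psi> g))"
      using ld[of 0 Z 0] ld[of 0 0 1] by (simp_all add: A_simps P_simps)
    have "ld (br (0, 0, 1) (\<iota> Z)) \<psi> g = ld (0, 0, 1) (ld (\<iota> Z) \<psi>) g - ld (\<iota> Z) (ld (0, 0, 1) \<psi>) g"
      by (rule ld_bracket[OF open_UNIV UNIV_I sm])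
    moreover have "ld (0, 0, 1) (ld (\<iota> Z) \<psi>) g = (1/4) *\<^sub>R P (A Z) ((-1/2) *\<^sub>R \<sigma> (\<psi> g))"
      unfolding 1 using ld_bounded_linear[OF bounded_linear_const_scaleR[OF bl(1)] sm] by (simp add: 2)
    moreover have "ld (\<iota> Z) (ld (0, 0, 1) \<psi>) g = (-1/2) *\<^sub>R \<sigma> ((1/4) *\<^sub>R P (A Z) (\<psi> g))"
      unfolding 2 by (subst ld_bounded_linear[OF bounded_linear_const_scaleR[OF bl(2)] sm]) (simp add: 1)
    moreover have "ld (br (0, 0, 1) (\<iota> Z)) \<psi> g = (1/4) *\<^sub>R P (A (A Z)) (\<psi> g)"
      by (simp add: ld B_simps A_simps)
    ultimately have "(1/4) *\<^sub>R P (A (A Z)) (\<psi> g) = (1/8) *\<^sub>R P (A (A Z)) (\<psi> g)"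
      by (simp add: P_simps linear_cmul[OF linear_\<sigma>] \<sigma>_P scaleR_add_right)
    then show ?thesis by simp
  qed
  then show ?thesis by (simp add: inv_spinors_def)
qed

text \<open>The correction term from \<open>parallel_transport\<close>: modulo the image of
  \<open>A^2\<close>, its derivative in direction \<open>X\<close> is
  \<open>e^(tA/2) A X\<close>.\<close>

definition cy :: "'g \<Rightarrow> 'v" where "cy g = flow A (- ct g / 2) (A (cx g))"

lemma has_derivative_cy:
  "((\<lambda>v. cy (g \<odot> \<eta> v)) has_derivative (\<lambda>X. (- snd (snd X) / 2) *\<^sub>R A (A (flow A (- ct g / 2) (cx g))) + flow A (ct g / 2) (A (fst (snd X))))) (at 0)"
proof -
  have "((\<lambda>v. - ct (g \<odot> \<eta> v) / 2) has_derivative (\<lambda>X. - ld X ct g / 2)) (at 0)"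
    by (intro bounded_linear.has_derivative[OF bounded_linear_divide] has_derivative_minus has_derivative_ld smooth_ct)
  from has_derivative_flow[OF lA this bounded_linear.has_derivative[OF blA has_derivative_ld[OF smooth_cx]]]
  have "((\<lambda>v. cy (g \<odot> \<eta> v)) has_derivative (\<lambda>X. (- ld X ct g / 2) *\<^sub>R flow A (- ct g / 2) (A (A (cx g))) + flow A (- ct g / 2) (A (ld X cx g)))) (at 0)"
    unfolding cy_def by simp
  moreover have "(\<lambda>X. (- ld X ct g / 2) *\<^sub>R flow A (- ct g / 2) (A (A (cx g))) + flow A (- ct g / 2) (A (ld X cx g)))
    = (\<lambda>X. (- snd (snd X) / 2) *\<^sub>R A (A (flow A (- ct g / 2) (cx g))) + flow A (ct g / 2) (A (fst (snd X))))"
  proof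
    fix X :: "real \<times> 'v \<times> real"
    show "(- ld X ct g / 2) *\<^sub>R flow A (- ct g / 2) (A (A (cx g))) + flow A (- ct g / 2) (A (ld X cx g))
      = (- snd (snd X) / 2) *\<^sub>R A (A (flow A (- ct g / 2) (cx g))) + flow A (ct g / 2) (A (fst (snd X)))"
      using flow_add[OF lA, of "- ct g / 2" "ct g" "A (fst (snd X))"] by (cases X) (simp add: flow_commute[OF lA])
  qed
  ultimately show ?thesis by simp
qed

lemma smooth_cy: "mfd_smooth_at M cy g"
proof -
  have "mfd_smooth_at M (\<lambda>g. - ct g / 2) g"
    using mfd_smooth_at_bounded_linear[OF bounded_linear_compose[OF bounded_linear_divide bounded_linear_minus[OF bounded_linear_ident]] smooth_ct] .
  then show ?thesis
    unfolding cy_def[abs_def] by (intro mfd_smooth_at_flow mfd_smooth_at_bounded_linear[OF blA] smooth_cx lA)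
qed

text \<open>
  The factor \<open>e\<^sup>-\<^sup>t\<^sup>\<sigma>\<^sup>/\<^sup>2\<close> removes the \<open>H\<close>-component of the spin connection. The remaining equation has the
  right-hand side \<open>P (e\<^sup>t\<^sup>A\<^sup>/\<^sup>2 A X) / 4\<close>, which is the derivative of \<open>P (cy g) / 4\<close> on spinors annihilated by
  \<open>P\<close> on the image of \<open>A\<^sup>2\<close>, and products of two operators \<open>P\<close> vanish.
\<close>

definition spinor_of :: "complex^'s \<Rightarrow> 'g \<Rightarrow> complex^'s" where
  "spinor_of \<phi> g = flow \<sigma> (- ct g / 2) (\<phi> + (1/4) *\<^sub>R P (cy g) \<phi>)"

lemma spinor_of_parallel:
  assumes \<phi>: "\<phi> \<in> inv_spinors"
  shows "spinor_of \<phi> \<in> PS"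
  unfolding parallel_iff
proof (intro conjI allI)
  have blP: "bounded_linear (\<lambda>y. (1/4) *\<^sub>R P y \<phi>)"
    using P_bilinear by (intro bounded_linear_const_scaleR) (simp add: bilinear_def linear_conv_bounded_linear)
  show "mfd_smooth_at M (spinor_of \<phi>) g" for g
  proof -
    have "mfd_smooth_at M (\<lambda>g. - ct g / 2) g"
      using mfd_smooth_at_bounded_linear[OF bounded_linear_compose[OF bounded_linear_divide bounded_linear_minus[OF bounded_linear_ident]] smooth_ct] .
    then show ?thesis
      unfolding spinor_of_def[abs_def]
      by (intro mfd_smooth_at_flow mfd_smooth_at_add mfd_smooth_at_const mfd_smooth_at_bounded_linear[OF blP] smooth_cy linear_\<sigma>)
  qed
  fix b X k g
  define s where "s = - ct g / 2"
  have "((\<lambda>v. - ct (g \<odot> \<eta> v) / 2) has_derivative (\<lambda>X. - ld X ct g / 2)) (at 0)"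
    by (intro bounded_linear.has_derivative[OF bounded_linear_divide] has_derivative_minus has_derivative_ld smooth_ct)
  from has_derivative_flow[OF linear_\<sigma> this has_derivative_add[OF has_derivative_const[of \<phi>] bounded_linear.has_derivative[OF blP has_derivative_cy[of g]]]]
  have "((\<lambda>v. spinor_of \<phi> (g \<odot> \<eta> v)) has_derivative (\<lambda>X. (- ld X ct g / 2) *\<^sub>R flow \<sigma> s (\<sigma> (\<phi> + (1/4) *\<^sub>R P (cy g) \<phi>))
     + flow \<sigma> s ((1/4) *\<^sub>R P ((- snd (snd X) / 2) *\<^sub>R A (A (flow A s (cx g))) + flow A (ct g / 2) (A (fst (snd X)))) \<phi>))) (at 0)"
    unfolding spinor_of_def by (simp add: s_def)
  from ldI[OF this] have "ld (b, X, k) (spinor_of \<phi>) g = (- k / 2) *\<^sub>R flow \<sigma> s (\<sigma> (\<phi> + (1/4) *\<^sub>R P (cy g) \<phi>))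
     + flow \<sigma> s ((1/4) *\<^sub>R P (flow A (ct g / 2) (A X)) \<phi>)"
    using \<phi> by (simp add: P_simps inv_spinors_def)
  moreover have "flow \<sigma> s (\<sigma> (\<phi> + (1/4) *\<^sub>R P (cy g) \<phi>)) = \<sigma> (spinor_of \<phi> g)"
    by (simp add: spinor_of_def flow_commute[OF linear_\<sigma>] s_def)
  moreover have "flow \<sigma> s (P (flow A (ct g / 2) (A X)) \<phi>) = P (A X) (flow \<sigma> s \<phi>)"
    by (simp add: flow_P s_def lA flow_minus_cancel(2)[OF lA, of "ct g / 2", simplified])
  moreover have "P (A X) (spinor_of \<phi> g) = P (A X) (flow \<sigma> s \<phi>)"
    by (simp add: spinor_of_def s_def linear_add[OF linear_flow[OF linear_\<sigma>]] linear_cmul[OF linear_flow[OF linear_\<sigma>]] flow_P P_simps PP)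
  ultimately show "ld (b, X, k) (spinor_of \<phi>) g = (1/4) *\<^sub>R P (A X) (spinor_of \<phi> g) - (k / 2) *\<^sub>R \<sigma> (spinor_of \<phi> g)"
    by (simp add: linear_cmul[OF linear_flow[OF linear_\<sigma>]])
qed

text \<open>The construction is undone. After removing the \<open>\<sigma>\<close>-part,
  \<open>(1 - P (cy g) / 4)\<close> applied to the spinor is constant, and
  \<open>1 + P (cy g) / 4\<close> inverts this operator because products of two \<open>P\<close>
  vanish.\<close>

lemma parallel_eq_spinor_of:
  assumes \<psi>: "\<psi> \<in> PS"
  shows "\<psi> = spinor_of (\<psi> gone)"
proof -
  have sm: "mfd_smooth_at M \<psi> g" and ld: "ld (b, X, k) \<psi> g = (1/4) *\<^sub>R P (A X) (\<psi> g) - (k / 2) *\<^sub>R \<sigma> (\<psi> g)" for b X k g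
    using \<psi> by (auto simp: parallel_iff)
  define \<chi>' where "\<chi>' g = flow \<sigma> (ct g / 2) (\<psi> g)" for g
  define F where "F g = \<chi>' g - (1/4) *\<^sub>R P (cy g) (\<chi>' g)" for g
  have inv: "\<chi>' g \<in> inv_spinors" for g unfolding \<chi>'_def by (rule flow_inv_spinors[OF parallel_inv_spinors[OF \<psi>]])
  have smt: "mfd_smooth_at M (\<lambda>g. ct g / 2) g" for g
    by (rule mfd_smooth_at_bounded_linear[OF bounded_linear_divide smooth_ct])
  have smc: "mfd_smooth_at M \<chi>' g" for g
    unfolding \<chi>'_def[abs_def] by (intro mfd_smooth_at_flow smt sm linear_\<sigma>)
  have ldc: "ld (b, X, k) \<chi>' g = (1/4) *\<^sub>R P (flow A (ct g / 2) (A X)) (\<chi>' g)" for b X k g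
  proof -
    have "((\<lambda>v. ct (g \<odot> \<eta> v) / 2) has_derivative (\<lambda>X. ld X ct g / 2)) (at 0)"
      by (intro bounded_linear.has_derivative[OF bounded_linear_divide] has_derivative_ld smooth_ct)
    from has_derivative_flow[OF linear_\<sigma> this has_derivative_ld[OF sm]]
    have "((\<lambda>v. \<chi>' (g \<odot> \<eta> v)) has_derivative (\<lambda>X. (ld X ct g / 2) *\<^sub>R flow \<sigma> (ct g / 2) (\<sigma> (\<psi> g)) + flow \<sigma> (ct g / 2) (ld X \<psi> g))) (at 0)"
      unfolding \<chi>'_def by simp
    from ldI[where f=\<chi>', OF this] show ?thesis
      by (simp add: ld linear_diff[OF linear_flow[OF linear_\<sigma>]] linear_cmul[OF linear_flow[OF linear_\<sigma>]] flow_P \<chi>'_def)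
  qed
  have "F g = F gone" for g
  proof (rule ld_zero_imp_const[OF connected_G])
    show "mfd_smooth_at M F g" for g
    proof -
      have "smooth_at (\<lambda>z. snd z - (1/4) *\<^sub>R P (fst z) (snd z)) z" for z
        by (intro smooth_at_diff smooth_at_scaleR smooth_at_const smooth_at_bounded_bilinear[OF bbP] smooth_at_fst smooth_at_snd smooth_at_id)
      then have "mfd_smooth_at M (\<lambda>g. snd (cy g, \<chi>' g) - (1/4) *\<^sub>R P (fst (cy g, \<chi>' g)) (snd (cy g, \<chi>' g))) g"
        by (rule mfd_smooth_at_compose[where f="\<lambda>g. (cy g, \<chi>' g)" and h="\<lambda>z. snd z - (1/4) *\<^sub>R P (fst z) (snd z)"])
          (rule mfd_smooth_at_Pair[OF smooth_cy smc])
      then show ?thesis by (simp add: F_def[abs_def])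
    qed
    show "ld X F g = 0" for X g
    proof -
      obtain b Y k where X: "X = (b, Y, k)" by (cases X)
      have "((\<lambda>v. F (g \<odot> \<eta> v)) has_derivative (\<lambda>X. ld X \<chi>' g - (1/4) *\<^sub>R (P (cy g) (ld X \<chi>' g) +
         P ((- snd (snd X) / 2) *\<^sub>R A (A (flow A (- ct g / 2) (cx g))) + flow A (ct g / 2) (A (fst (snd X)))) (\<chi>' g)))) (at 0)"
        unfolding F_def
        using has_derivative_diff[OF has_derivative_ld[OF smc] has_derivative_scaleR_right[OF bounded_bilinear.FDERIV[OF bbP has_derivative_cy has_derivative_ld[OF smc]]]]
        by simp
      from ldI[OF this, of X] show ?thesis
        using inv[of g] by (simp add: X ldc P_simps PP inv_spinors_def)
    qed
  qed
  moreover have "F gone = \<psi> gone" by (simp add: F_def \<chi>'_def cy_def lA linear_\<sigma> A_simps P_simps)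
  ultimately have F: "\<chi>' g - (1/4) *\<^sub>R P (cy g) (\<chi>' g) = \<psi> gone" for g unfolding F_def by simp
  show ?thesis
  proof
    fix g
    have "P (cy g) (\<chi>' g) = P (cy g) (\<psi> gone)" using F[of g, symmetric] by (simp add: P_simps PP)
    then have "\<chi>' g = \<psi> gone + (1/4) *\<^sub>R P (cy g) (\<psi> gone)" using F[of g] by (simp add: algebra_simps)
    then have "flow \<sigma> (- (ct g / 2)) (\<chi>' g) = spinor_of (\<psi> gone) g" by (simp add: spinor_of_def)
    then show "\<psi> g = spinor_of (\<psi> gone) g" by (simp add: \<chi>'_def linear_\<sigma>)
  qed
qed

lemma PS_eq: "PS = spinor_of ` inv_spinors"
  using spinor_of_parallel parallel_eq_spinor_of parallel_inv_spinors[of _ gone] by blast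

section \<open>Dimension of the space of parallel spinors\<close>

lemma spinor_of_one: "spinor_of \<phi> gone = \<phi>"
  by (simp add: spinor_of_def cy_def linear_\<sigma> lA A_simps P_simps linear_0[OF lflow])

lemma scale_vec_linear: "linear (\<lambda>\<psi> :: complex^'s. z *s \<psi>)"
  by (rule linearI) (simp_all add: vec.scale_right_distrib scaleR_eq_scale_vec mult.commute)

lemma P_scale_vec: "P Z (z *s \<psi>) = z *s P Z \<psi>"
  by (simp add: P_def cm_def vector_scalar_commute)

lemma flow_scale_vec: "flow \<sigma> s (z *s \<psi>) = z *s flow \<sigma> s \<psi>"
  by (rule flow_intertwine[OF linear_\<sigma> linear_\<sigma> scale_vec_linear, symmetric]) (simp add: \<sigma>_def spin_scale_vec)

lemma spinor_space_dim_eq: "spinor_space_dim PS = vec.dim inv_spinors"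
proof -
  interpret fs: vector_space "\<lambda>(z::complex) (\<psi> :: 'g \<Rightarrow> complex^'s) g. z *s \<psi> g"
    by unfold_locales (auto simp: fun_eq_iff vec.scale_right_distrib vec.scale_left_distrib)
  \<comment> \<open>All functions on the group form an infinite-dimensional space; only the source
    of \<open>spinor_of\<close> is finite-dimensional, which suffices for an injective map.\<close>
  interpret vp: finite_dimensional_vector_space_pair_1 "(*s) :: complex \<Rightarrow> complex^'s \<Rightarrow> complex^'s" cart_basis
    "\<lambda>(z::complex) (\<psi> :: 'g \<Rightarrow> complex^'s) g. z *s \<psi> g"
    by unfold_locales
  have "spinor_of (x + y) = spinor_of x + spinor_of y" for x y
    by (rule ext) (simp add: spinor_of_def P_simps linear_add[OF linear_flow[OF linear_\<sigma>]] linear_cmul[OF linear_flow[OF linear_\<sigma>]] scaleR_add_right)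
  moreover have "spinor_of (z *s x) = (\<lambda>g. z *s spinor_of x g)" for z x
  proof
    fix g
    have e: "z *s x + (1/4) *\<^sub>R P (cy g) (z *s x) = z *s (x + (1/4) *\<^sub>R P (cy g) x)"
      by (simp add: P_scale_vec vec.scale_right_distrib scaleR_eq_scale_vec mult.commute)
    show "spinor_of (z *s x) g = z *s spinor_of x g" unfolding spinor_of_def e by (rule flow_scale_vec)
  qed
  ultimately have "Vector_Spaces.linear (*s) (\<lambda>(z::complex) (\<psi> :: 'g \<Rightarrow> complex^'s) g. z *s \<psi> g) spinor_of"
    unfolding Vector_Spaces.linear_iff using fs.vector_space_axioms vec.vector_space_axioms by blast
  moreover have "inj spinor_of" by (rule injI) (metis spinor_of_one)
  ultimately have "fs.dim (spinor_of ` inv_spinors) = vec.dim inv_spinors"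
    using vp.dim_image_eq inj_on_subset by blast
  then show ?thesis by (simp add: spinor_space_dim_def PS_eq)
qed

lemma inv_spinors_alt: "inv_spinors = {\<psi>. \<forall>Z\<in>W. cm (\<iota> Z) (cm \<alpha> \<psi>) = 0}"
  by (auto simp: inv_spinors_def cm_alpha_iota)

lemma dim_alpha_kernel: "2 * vec.dim {\<psi>. cm \<alpha> \<psi> = 0} = CARD('s)"
  using dim_cm_kernel_half[of "{}" \<alpha> "(0, 0, 1)"] vec_dim_card[where 'a=complex and 'n='s]
  by (simp add: B_simps del: vec.dim_UNIV)

text \<open>A non-null vector of \<open>W\<close> acts invertibly, so the condition reduces to
  \<open>cm \<alpha> \<psi> = 0\<close>, and a single null vector halves the dimension.\<close>

lemma dim_inv_spinors_not_isotropic: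
  assumes "\<not> totally_isotropic B W"
  shows "2 * vec.dim inv_spinors = CARD('s)"
proof -
  obtain x y where xy: "x \<in> W" "y \<in> W" "B x y \<noteq> 0" using assms by (auto simp: totally_isotropic_def)
  obtain z where z: "z \<in> W" "B z z \<noteq> 0"
  proof (cases "B x x = 0 \<and> B y y = 0")
    case True
    then have "B (x + y) (x + y) = 2 * B x y" using B_sym[of x y] by (simp add: B_simps)
    with xy that[of "x + y"] show thesis using subspace_add[OF subspace_W xy(1,2)] by simp
  qed (use that xy in blast)
  have "cm \<alpha> \<psi> = 0" if "cm (\<iota> z) (cm \<alpha> \<psi>) = 0" for \<psi>
    using cm_square[of "\<iota> z" "cm \<alpha> \<psi>"] that z by (simp add: cm_simps)
  then have "inv_spinors = {\<psi>. cm \<alpha> \<psi> = 0}"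
    using z(1) unfolding inv_spinors_alt by (auto simp: cm_simps)
  then show ?thesis using dim_alpha_kernel by simp
qed

text \<open>Invariance means that \<open>cm \<alpha> \<psi>\<close> lies in the joint kernel
  \<open>L\<close> of \<open>\<alpha>\<close> and \<open>W\<close>. Hence the dimension is that of
  the kernel of \<open>\<alpha>\<close>, half of the module, plus that of \<open>L\<close>, which
  \<open>dim W + 1\<close> successive halvings determine.\<close>

lemma dim_inv_spinors_isotropic:
  assumes iso: "totally_isotropic B W"
  shows "2 * vec.dim inv_spinors * 2 ^ dim W = CARD('s) * (2 ^ dim W + 1)"
proof -
  obtain S where S: "S \<subseteq> W" "independent S" "span S = W" "card S = dim W"
    using basis_exists[of W] span_subspace[OF _ _ subspace_W] by metis
  have fS: "finite S" using S(2) by (rule independent_imp_finite)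
  define T where "T = insert \<alpha> (\<iota> ` S)"
  have li: "linear \<iota>" by (rule linearI) auto
  have ii: "inj \<iota>" by (auto simp: inj_def)
  have indi: "independent (\<iota> ` S)"
    by (rule linear_independent_injective_image[OF li S(2)]) (rule inj_on_subset[OF ii subset_UNIV])
  have spi: "span (\<iota> ` S) = \<iota> ` W" using linear_span_image[OF li, of S] S(3) by simp
  have na: "\<alpha> \<notin> span (\<iota> ` S)" unfolding spi by auto
  then have naS: "\<alpha> \<notin> \<iota> ` S" by auto
  have indT: "independent T" unfolding T_def using indi na by (simp add: independent_insert)
  have isoT: "totally_isotropic Bf T"
  proof -
    have "B x y = 0" if "x \<in> S" "y \<in> S" for x y
      using iso S(1) that unfolding totally_isotropic_def by blast
    then show ?thesis unfolding T_def totally_isotropic_def by (auto simp: B_simps)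
  qed
  have cT: "card T = dim W + 1" using naS fS card_image[OF inj_on_subset[OF ii subset_UNIV, of S]] S(4) by (simp add: T_def)
  define L where "L = {\<psi>. \<forall>x\<in>T. cm x \<psi> = 0}"
  have dL: "vec.dim L * 2 ^ (dim W + 1) = CARD('s)"
    using dim_cm_kernel_isotropic[OF Bf_nondeg _ indT isoT] fS unfolding cT L_def by (simp add: T_def)
  have kS: "(\<forall>x\<in>\<iota> ` S. cm x \<psi> = 0) \<longleftrightarrow> (\<forall>Z\<in>W. cm (\<iota> Z) \<psi> = 0)" for \<psi>
    using cm_kernel_span[of "\<iota> ` S"] unfolding spi by (auto simp: set_eq_iff)
  have "inv_spinors = {\<psi>. (\<forall>x\<in>{}. cm x \<psi> = 0) \<and> cm \<alpha> \<psi> \<in> L}"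
    unfolding inv_spinors_alt L_def T_def using kS by (auto simp: cm_alpha_square)
  moreover have "vec.dim {\<psi>. (\<forall>x\<in>{}. cm x \<psi> = 0) \<and> cm \<alpha> \<psi> \<in> L} = vec.dim {\<psi>. \<forall>x\<in>insert \<alpha> {}. cm x \<psi> = 0} + vec.dim L"
    by (rule dim_cm_kernel_insert[where w'="(0, 0, 1)"])
      (auto simp: B_simps L_def T_def intro!: subspace_cm_kernel[of "insert \<alpha> (\<iota> ` S)", simplified])
  ultimately have "vec.dim inv_spinors = vec.dim {\<psi>. cm \<alpha> \<psi> = 0} + vec.dim L" by simp
  then have "2 * vec.dim inv_spinors * 2 ^ dim W = (2 * vec.dim {\<psi>. cm \<alpha> \<psi> = 0}) * 2 ^ dim W + vec.dim L * 2 ^ (dim W + 1)"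
    by (simp add: algebra_simps)
  then show ?thesis unfolding dL dim_alpha_kernel by (simp add: algebra_simps)
qed

end

lemma signature_dim:
  assumes "has_signature (B :: 'v::euclidean_space \<Rightarrow> 'v \<Rightarrow> real) p q"
  shows "DIM('v) = p + q"
proof -
  obtain E where E: "pseudo_onb B E" and p: "card {e\<in>E. B e e = -1} = p" and q: "card {e\<in>E. B e e = 1} = q"
    using assms unfolding has_signature_def by blast
  have iE: "independent E" and sE: "span E = UNIV" and n: "\<And>e. e \<in> E \<Longrightarrow> B e e = 1 \<or> B e e = -1"
    using E unfolding pseudo_onb_def by blast+
  have f: "finite E" using iE by (rule independent_imp_finite)
  have "DIM('v) = card E" using dim_span_eq_card_independent[OF iE] sE by simp
  also have "E = {e\<in>E. B e e = -1} \<union> {e\<in>E. B e e = 1}" using n by blast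
  also have "card ({e\<in>E. B e e = -1} \<union> {e\<in>E. B e e = 1}) = p + q"
    using f p q by (subst card_Un_disjoint) auto
  finally show ?thesis .
qed

lemma dext_parallel_spinors_dim:
  fixes cl :: "real \<times> 'v::euclidean_space \<times> real \<Rightarrow> complex^'s^'s" and nabla
  assumes "dext_holonomy B A G M \<eta> ca cx ct nabla" and sig: "has_signature B p q"
    and cl: "spinor_module (dext_form B) cl" and E: "pseudo_onb (dext_form B) E"
  shows "totally_isotropic B (range (A \<circ> A)) \<Longrightarrow>
      real (spinor_space_dim (parallel_spinors G M \<eta> (dext_form B) nabla cl E)) =
        2 ^ ((p + q) div 2) * (1 + 1 / 2 ^ dim (range (A \<circ> A)))"
    and "\<not> totally_isotropic B (range (A \<circ> A)) \<Longrightarrow>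
      spinor_space_dim (parallel_spinors G M \<eta> (dext_form B) nabla cl E) = 2 ^ ((p + q) div 2)"
proof -
  interpret dext_holonomy B A G M \<eta> ca cx ct nabla by fact
  interpret dext_spinors B A G M \<eta> ca cx ct nabla cl E
  proof (intro dext_spinors.intro clifford_frame.intro clifford.intro clifford_frame_axioms.intro)
    show "bilinear Bf" by (rule bBf)
    show "Bf x y = Bf y x" for x y by (rule Bf_sym)
    show "linear cl" "cl x ** cl y + cl y ** cl x = (- 2 * Bf x y) *\<^sub>R mat 1" for x y
      using cl by (auto simp only: spinor_module_def)
  qed fact+
  \<comment> \<open>The double extension adds two dimensions, so the spinor module of
    \<open>g\<close> is doubled for either parity of \<open>p + q\<close>.\<close>
  have card: "CARD('s) = 2 * 2 ^ ((p + q) div 2)"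
  proof -
    have "DIM(real \<times> 'v \<times> real) = p + q + 2" using signature_dim[OF sig] by simp
    then show ?thesis using cl by (simp add: spinor_module_def)
  qed
  have r: "range (A \<circ> A) = W" by (simp add: o_def)
  show "spinor_space_dim PS = 2 ^ ((p + q) div 2)" if "\<not> totally_isotropic B (range (A \<circ> A))"
    using dim_inv_spinors_not_isotropic that card unfolding r by (simp add: spinor_space_dim_eq)
  show "real (spinor_space_dim PS) = 2 ^ ((p + q) div 2) * (1 + 1 / 2 ^ dim (range (A \<circ> A)))"
    if "totally_isotropic B (range (A \<circ> A))"
  proof -
    have "vec.dim inv_spinors * 2 ^ dim W = 2 ^ ((p + q) div 2) * (2 ^ dim W + 1)"
      using dim_inv_spinors_isotropic that card unfolding r by simp
    then have "real (vec.dim inv_spinors) * 2 ^ dim W = 2 ^ ((p + q) div 2) * (2 ^ dim W + 1)"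
      unfolding of_nat_eq_iff[where 'a=real, symmetric] by (simp add: algebra_simps)
    then show ?thesis unfolding r spinor_space_dim_eq by (simp add: field_simps)
  qed
qed

theorem theorem5p1:
  fixes B :: "'v::euclidean_space \<Rightarrow> 'v \<Rightarrow> real"
    and A :: "'v \<Rightarrow> 'v"
    and p q :: nat
    and G :: "('g::{t2_space,second_countable_topology}, 'r) monoid_scheme"
    and M :: "('g, 'e::euclidean_space) atlas"
    and \<eta> :: "real \<times> 'v \<times> real \<Rightarrow> 'g"
    and nabla :: "('g \<Rightarrow> real \<times> 'v \<times> real) \<Rightarrow> ('g \<Rightarrow> real \<times> 'v \<times> real) \<Rightarrow> 'g \<Rightarrow> real \<times> 'v \<times> real"
  assumes "metric_lie_algebra_on UNIV (\<lambda>_ _. 0) B"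
    and "has_signature B p q"
    and "A \<in> so_algebra B"
    and "A \<noteq> (\<lambda>_. 0)"
    and "lie_group G M"
    and "simply_connected (UNIV :: 'g set)"
    and "has_lie_algebra G M \<eta> (dext_bracket A B)"
    and "levi_civita G M \<eta> (dext_form B) nabla"
  shows
    "(indecomposable (dext_bracket A B) (dext_form B) \<longleftrightarrow> totally_isotropic B {x. A x = 0}) \<and>

     (solvable G \<and>
      (\<forall>g. scalar_curvature (dext_bracket A B) (dext_form B) nabla g = 0) \<and>
      (\<forall>g. ricci_op (dext_bracket A B) (dext_form B) nabla g \<circ>
            ricci_op (dext_bracket A B) (dext_form B) nabla g = (\<lambda>_. 0)) \<and>
      (ricci_flat (dext_bracket A B) nabla \<longleftrightarrow> lin_trace (A \<circ> A) = 0) \<and>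
      (flat (dext_bracket A B) nabla \<longleftrightarrow> A \<circ> A = (\<lambda>_. 0))) \<and>

     ((\<forall>S \<in> holonomy_algebra G M \<eta> nabla. \<forall>T \<in> holonomy_algebra G M \<eta> nabla. S \<circ> T = T \<circ> S) \<and>
      holonomy_algebra G M \<eta> nabla =
        {(\<lambda>(a, Y, h). (B (A (A X)) Y, - (h *\<^sub>R A (A X)), 0)) | X. True} \<and>
      holonomy_algebra G M \<eta> nabla \<subseteq> so_algebra (dext_form B)) \<and>

     (\<forall>(cl :: real \<times> 'v \<times> real \<Rightarrow> complex^'s^'s) E.
        spinor_module (dext_form B) cl \<and> pseudo_onb (dext_form B) E \<longrightarrow>
        (totally_isotropic B (range (A \<circ> A)) \<longrightarrow>
          real (spinor_space_dim (parallel_spinors G M \<eta> (dext_form B) nabla cl E)) =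
            2 ^ ((p + q) div 2) * (1 + 1 / 2 ^ dim (range (A \<circ> A)))) \<and>
        (\<not> totally_isotropic B (range (A \<circ> A)) \<longrightarrow>
          spinor_space_dim (parallel_spinors G M \<eta> (dext_form B) nabla cl E) =
            2 ^ ((p + q) div 2)))"
proof -
  interpret dg: dext_group B A G M \<eta>
    by (intro dext_group.intro abelian_metric.intro lie_group_frame.intro dext_group_axioms.intro assms)
  interpret lc: dext_levi_civita B A G M \<eta> nabla
    by (intro dext_levi_civita.intro dg.dext_group_axioms dext_levi_civita_axioms.intro assms)
  obtain ca cx ct where coords: "dext_coords B A G M \<eta> ca cx ct"
  proof -
    obtain a x t where
      "\<And>g. mfd_smooth_at M a g" "\<And>g. mfd_smooth_at M x g" "\<And>g. mfd_smooth_at M t g"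
      "\<And>g b Y k. left_deriv G \<eta> (b, Y, k) t g = k" "\<And>g b Y k. left_deriv G \<eta> (b, Y, k) x g = flow A (t g) Y"
      "\<And>g b Y k. left_deriv G \<eta> (b, Y, k) a g = b + B (A (x g)) (flow A (t g) Y) / 2"
      "a \<one>\<^bsub>G\<^esub> = 0" "x \<one>\<^bsub>G\<^esub> = 0" "t \<one>\<^bsub>G\<^esub> = 0"
      by (rule dg.coordinates) (rule that)
    then show thesis by (intro that dext_coords.intro dg.dext_group_axioms dext_coords_axioms.intro)
  qed
  then have hol: "dext_holonomy B A G M \<eta> ca cx ct nabla"
    by (intro dext_holonomy.intro lc.dext_levi_civita_axioms)
  then interpret h: dext_holonomy B A G M \<eta> ca cx ct nabla .
  have "{(\<lambda>(a, Y, h). (B (A (A X)) Y, - (h *\<^sub>R A (A X)), 0)) | X. True} = {h.nilp X | X. True}"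
    by (simp only: h.nilp_def)
  then have hol_eq: "holonomy_algebra G M \<eta> nabla =
        {(\<lambda>(a, Y, h). (B (A (A X)) Y, - (h *\<^sub>R A (A X)), 0)) | X. True}"
    using h.holonomy_algebra_eq by (simp only:)
  have hol_comm: "\<forall>S \<in> holonomy_algebra G M \<eta> nabla. \<forall>T \<in> holonomy_algebra G M \<eta> nabla. S \<circ> T = T \<circ> S"
    unfolding h.holonomy_algebra_eq using h.nilp_commute by blast
  have hol_so: "holonomy_algebra G M \<eta> nabla \<subseteq> so_algebra (dext_form B)"
    unfolding h.holonomy_algebra_eq using h.nilp_so by blast
  show ?thesis
    by (intro conjI allI impI hol_eq hol_comm hol_so dg.indecomposable_iff[OF assms(4)] h.solvable_G
        lc.scalar_curvature_zero lc.ricci_op_nilpotent lc.ricci_flat_iff lc.flat_iff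
        dext_parallel_spinors_dim[OF hol assms(2)]) blast+
qed

end
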